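(* Let $(\mathcal A,\mathfrak H,D)$ be the tensor product of an even spectral triple $(\mathcal A_1,\mathfrak H_1,D_1)$ and a spectral triple $(\mathcal A_2,\mathfrak H_2,D_2)$. Suppose that for $i=1,2$, $\mathrm{Tr}(e^{-tD_i^2})\stackrel{t\to0}{\sim}f_i(-\log t)\,t^{\alpha_i}$, where $\alpha_i<0$ and $f_i:\mathbb R^{\ge0}\to\mathbb R$ is bounded and locally integrable with $\lim_{s\to0^+}s\mathcal L[f_i](s)$ existing and non-zero, and suppose that $\lim_{s\to0^+}s\mathcal L[f_1f_2](s)$ exists and is non-zero. Let $A_1\in\mathcal B(\mathfrak H_1)$ and $A_2\in\mathcal B(\mathfrak H_2)$ be weakly regular operators. (i) If $A_1$ is strongly regular then $\mathcal T(A_1\otimes A_2)=\mathcal T_1(A_1)\,\mathcal T(1\otimes A_2)$. (ii) If both $A_1$ and $A_2$ are strongly regular then $\mathcal T(A_1\otimes A_2)=\mathcal T_1(A_1)\,\mathcal T_2(A_2)$.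
   Context: Spectral triples: all Dirac operators are self-adjoint, invertible with compact inverse, and $e^{-tD_i^2}$ is trace class for $t>0$. Tensor product: $\mathcal A=\mathcal A_1\otimes\mathcal A_2$, $\mathfrak H=\mathfrak H_1\otimes\mathfrak H_2$, $D=D_1\otimes1+\chi\otimes D_2$, where $\chi$ is the $\mathbb Z/2$-grading of the first triple (commuting with the representation and anticommuting with $D_1$). $\mathcal L[f](s)=\int_0^\infty f(x)e^{-sx}dx$. $g_1\stackrel{t\to0}{\sim}g_2$ means $|g_1-g_2|=o(|g_2|)$ as $t\to0^+$. $A_i$ is weakly regular if $\mathrm{Tr}(e^{-tD_i^2}A_i)\stackrel{t\to0}{\sim}f_{A_i}(-\log t)t^{\alpha_i}$ where $f_{A_i}:\mathbb R^{\ge0}\to\mathbb C$ is bounded, non-zero, locally integrable and $\lim_{s\to0^+}s\mathcal L[f_{A_i}](s)$ exists. $A_i$ is strongly regular if there is a number $c_{A_i}$ with $\mathrm{Tr}(e^{-tD_i^2}A_i)-c_{A_i}\mathrm{Tr}(e^{-tD_i^2})=o(\mathrm{Tr}(e^{-tD_i^2}))$ as $t\to0^+$. The spectral states are $\mathcal T(B)=\lim_{s\to s_0^+}\mathrm{Tr}(|D|^{-s}B)/\mathrm{Tr}(|D|^{-s})$, with $s_0$ the abscissa of convergence of $\mathrm{Tr}(|D|^{-s})$, and $\mathcal T_i$ defined in the same way from $D_i$.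
   Formalization: In (i) the limit defining T(1⊗A_2) need not exist under the stated hypotheses; the formal version assumes that it exists and then proves that T(A_1⊗A_2) exists and the equation holds (and, if T_1(A_1)≠0, existence of T(A_1⊗A_2) implies that of T(1⊗A_2)). *)

theory Defs
  imports "HOL-Analysis.Analysis" "HOL-Library.Landau_Symbols"
begin

section \<open>Complex Hilbert spaces\<close>

text \<open>The real structure (norm, topology, completeness) is the library's; the complex inner
  product is conjugate-linear in its first argument and has the real one as its real part.\<close>

class chilbert_space = real_inner + complete_space +
  fixes scaleC :: "complex \<Rightarrow> 'a \<Rightarrow> 'a" (infixr \<open>*\<^sub>C\<close> 75)
    and cinner :: "'a \<Rightarrow> 'a \<Rightarrow> complex"
  assumes scaleC_add_right: "c *\<^sub>C (x + y) = c *\<^sub>C x + c *\<^sub>C y"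
    and scaleC_add_left: "(c + d) *\<^sub>C x = c *\<^sub>C x + d *\<^sub>C x"
    and scaleC_scaleC: "c *\<^sub>C d *\<^sub>C x = (c * d) *\<^sub>C x"
    and scaleC_of_real: "complex_of_real r *\<^sub>C x = r *\<^sub>R x"
    and cinner_commute: "cinner x y = cnj (cinner y x)"
    and cinner_add_right: "cinner x (y + z) = cinner x y + cinner x z"
    and cinner_scaleC_right: "cinner x (c *\<^sub>C y) = c * cinner x y"
    and Re_cinner: "Re (cinner x y) = inner x y"

definition cspan :: "'h::chilbert_space set \<Rightarrow> 'h set" where
  "cspan S = span {c *\<^sub>C x | c x. x \<in> S}"

definition is_onb :: "'h::chilbert_space set \<Rightarrow> bool" where
  "is_onb E \<longleftrightarrow> (\<forall>x\<in>E. \<forall>y\<in>E. cinner x y = (if x = y then 1 else 0)) \<and> closure (cspan E) = UNIV"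


section \<open>Bounded operators, trace class, trace\<close>

definition bounded_clinear :: "('h::chilbert_space \<Rightarrow> 'k::chilbert_space) \<Rightarrow> bool" where
  "bounded_clinear T \<longleftrightarrow> bounded_linear T \<and> (\<forall>c x. T (c *\<^sub>C x) = c *\<^sub>C T x)"

definition cadjoint :: "('h::chilbert_space \<Rightarrow> 'h) \<Rightarrow> 'h \<Rightarrow> 'h" where
  "cadjoint T = (THE S. \<forall>x y. cinner (T x) y = cinner x (S y))"

definition compact_op :: "('h::chilbert_space \<Rightarrow> 'h) \<Rightarrow> bool" where
  "compact_op K \<longleftrightarrow> bounded_clinear K \<and> compact (closure (K ` cball 0 1))"

definition positive_op :: "('h::chilbert_space \<Rightarrow> 'h) \<Rightarrow> bool" where
  "positive_op P \<longleftrightarrow> bounded_clinear P \<and>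
     (\<forall>x. cinner x (P x) \<in> \<real> \<and> 0 \<le> Re (cinner x (P x)))"

definition abs_op :: "('h::chilbert_space \<Rightarrow> 'h) \<Rightarrow> 'h \<Rightarrow> 'h" where
  "abs_op T = (THE P. positive_op P \<and> P \<circ> P = cadjoint T \<circ> T)"

definition trace_class :: "('h::chilbert_space \<Rightarrow> 'h) \<Rightarrow> bool" where
  "trace_class T \<longleftrightarrow> bounded_clinear T \<and>
     (\<exists>E. is_onb E \<and> (\<lambda>e. cinner e (abs_op T e)) summable_on E)"

text \<open>Meaningful for trace class operators only, for which the sum does not depend on the basis.\<close>

definition op_trace :: "('h::chilbert_space \<Rightarrow> 'h) \<Rightarrow> complex" where
  "op_trace T = (\<Sum>\<^sub>\<infinity>e\<in>(SOME E. is_onb E). cinner e (T e))"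


section \<open>Unbounded operators and spectral triples\<close>

text \<open>An unbounded operator is represented by its graph.\<close>

definition graph_adjoint :: "('h::chilbert_space \<times> 'h) set \<Rightarrow> ('h \<times> 'h) set" where
  "graph_adjoint D = {(y, z). \<forall>(x, w)\<in>D. cinner w y = cinner x z}"

text \<open>The adjoint of a densely defined graph is single-valued and linear, so the graph below is
  automatically that of a linear operator.\<close>

definition selfadjoint :: "('h::chilbert_space \<times> 'h) set \<Rightarrow> bool" where
  "selfadjoint D \<longleftrightarrow> closure (Domain D) = UNIV \<and> graph_adjoint D = D"

definition has_compact_inverse :: "('h::chilbert_space \<times> 'h) set \<Rightarrow> bool" where
  "has_compact_inverse D \<longleftrightarrow> (\<exists>K. compact_op K \<and> D = {(K y, y) | y. True})"

text \<open>Functional calculus for a self-adjoint \<open>D\<close> with compact inverse. The eigenvectors of such a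
  \<open>D\<close> are total, and \<open>f(D)\<close> multiplies the component along an eigenvector \<open>e\<close> with eigenvalue \<open>l\<close>
  by \<open>f l\<close>. If \<open>f\<close> is unbounded on the spectrum the result is not a bounded operator, since some
  \<open>x\<close> then have no suitable \<open>y\<close>.\<close>

definition fun_calc :: "('h::chilbert_space \<times> 'h) set \<Rightarrow> (real \<Rightarrow> real) \<Rightarrow> 'h \<Rightarrow> 'h" where
  "fun_calc D f x =
     (THE y. \<forall>l e. (e, l *\<^sub>R e) \<in> D \<longrightarrow> cinner e y = complex_of_real (f l) * cinner e x)"

definition heat_op :: "('h::chilbert_space \<times> 'h) set \<Rightarrow> real \<Rightarrow> 'h \<Rightarrow> 'h" where
  "heat_op D t = fun_calc D (\<lambda>l. exp (- t * l\<^sup>2))"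

definition abs_power :: "('h::chilbert_space \<times> 'h) set \<Rightarrow> real \<Rightarrow> 'h \<Rightarrow> 'h" where
  "abs_power D p = fun_calc D (\<lambda>l. \<bar>l\<bar> powr p)"

definition star_subalgebra :: "('h::chilbert_space \<Rightarrow> 'h) set \<Rightarrow> bool" where
  "star_subalgebra \<A> \<longleftrightarrow> \<A> \<subseteq> Collect bounded_clinear \<and> (\<lambda>x. 0) \<in> \<A> \<and>
     (\<forall>a\<in>\<A>. \<forall>b\<in>\<A>. (\<lambda>x. a x + b x) \<in> \<A> \<and> a \<circ> b \<in> \<A>) \<and>
     (\<forall>a\<in>\<A>. cadjoint a \<in> \<A> \<and> (\<forall>c. (\<lambda>x. c *\<^sub>C a x) \<in> \<A>))"

text \<open>\<open>a\<close> preserves the domain of \<open>D\<close>, and \<open>D a - a D\<close> extends to the bounded operator \<open>B\<close>.\<close>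

definition bounded_commutator ::
    "('h::chilbert_space \<times> 'h) set \<Rightarrow> ('h \<Rightarrow> 'h) \<Rightarrow> bool" where
  "bounded_commutator D a \<longleftrightarrow>
     (\<exists>B. bounded_clinear B \<and> (\<forall>(x, y)\<in>D. (a x, a y + B x) \<in> D))"

text \<open>The algebra is given by its image in the bounded operators. It need not be norm closed, and
  commutators with \<open>D\<close> need only be bounded on a norm dense part of it; this covers both the
  convention with a C*-algebra and the one with a dense subalgebra.\<close>

definition spectral_triple ::
    "('h::chilbert_space \<Rightarrow> 'h) set \<Rightarrow> ('h \<times> 'h) set \<Rightarrow> bool" where
  "spectral_triple \<A> D \<longleftrightarrow> star_subalgebra \<A> \<and>
     (\<forall>a\<in>\<A>. \<forall>\<epsilon>>0. \<exists>b\<in>\<A>. bounded_commutator D b \<and> onorm (\<lambda>x. a x - b x) < \<epsilon>) \<and>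
     selfadjoint D \<and> has_compact_inverse D \<and> (\<forall>t>0. trace_class (heat_op D t))"

definition even_spectral_triple ::
    "('h::chilbert_space \<Rightarrow> 'h) set \<Rightarrow> ('h \<times> 'h) set \<Rightarrow> ('h \<Rightarrow> 'h) \<Rightarrow> bool" where
  "even_spectral_triple \<A> D \<gamma> \<longleftrightarrow> spectral_triple \<A> D \<and>
     bounded_clinear \<gamma> \<and> \<gamma> \<circ> \<gamma> = id \<and> cadjoint \<gamma> = \<gamma> \<and>
     (\<forall>a\<in>\<A>. \<gamma> \<circ> a = a \<circ> \<gamma>) \<and> (\<forall>(x, y)\<in>D. (\<gamma> x, - \<gamma> y) \<in> D)"


section \<open>Tensor products\<close>

text \<open>\<open>'c\<close> is the Hilbert space completion of the algebraic tensor product of \<open>'a\<close> and \<open>'b\<close>;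
  this determines it up to a unique unitary compatible with the elementary tensors.\<close>

definition hilbert_tensor ::
    "('a::chilbert_space \<Rightarrow> 'b::chilbert_space \<Rightarrow> 'c::chilbert_space) \<Rightarrow> bool" where
  "hilbert_tensor ten \<longleftrightarrow>
     (\<forall>x x' y. ten (x + x') y = ten x y + ten x' y) \<and>
     (\<forall>x y y'. ten x (y + y') = ten x y + ten x y') \<and>
     (\<forall>c x y. ten (c *\<^sub>C x) y = c *\<^sub>C ten x y \<and> ten x (c *\<^sub>C y) = c *\<^sub>C ten x y) \<and>
     (\<forall>x x' y y'. cinner (ten x y) (ten x' y') = cinner x x' * cinner y y') \<and>
     closure (cspan {ten x y | x y. True}) = UNIV"

definition tensor_op ::
    "('a::chilbert_space \<Rightarrow> 'b::chilbert_space \<Rightarrow> 'c::chilbert_space) \<Rightarrow>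
     ('a \<Rightarrow> 'a) \<Rightarrow> ('b \<Rightarrow> 'b) \<Rightarrow> 'c \<Rightarrow> 'c" where
  "tensor_op ten A B =
     (THE T. bounded_clinear T \<and> (\<forall>x y. T (ten x y) = ten (A x) (B y)))"

definition tensor_algebra ::
    "('a::chilbert_space \<Rightarrow> 'b::chilbert_space \<Rightarrow> 'c::chilbert_space) \<Rightarrow>
     ('a \<Rightarrow> 'a) set \<Rightarrow> ('b \<Rightarrow> 'b) set \<Rightarrow> ('c \<Rightarrow> 'c) set" where
  "tensor_algebra ten \<A>1 \<A>2 =
     {\<lambda>z. \<Sum>i<n. tensor_op ten (a i) (b i) z | (n::nat) a b. \<forall>i<n. a i \<in> \<A>1 \<and> b i \<in> \<A>2}"

text \<open>\<open>D1 \<otimes> 1 + \<gamma> \<otimes> D2\<close>: the closure of the operator defined on the algebraic tensor product of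
  the domains. The real span is already a complex subspace, since the graph of \<open>D1\<close> is one.\<close>

definition tensor_dirac ::
    "('a::chilbert_space \<Rightarrow> 'b::chilbert_space \<Rightarrow> 'c::chilbert_space) \<Rightarrow>
     ('a \<times> 'a) set \<Rightarrow> ('a \<Rightarrow> 'a) \<Rightarrow> ('b \<times> 'b) set \<Rightarrow> ('c \<times> 'c) set" where
  "tensor_dirac ten D1 \<gamma> D2 = closure (span
     {(ten x y, ten x' y + ten (\<gamma> x) y') | x x' y y'. (x, x') \<in> D1 \<and> (y, y') \<in> D2})"


section \<open>Spectral states and regularity\<close>

text \<open>The set is bounded below by \<open>0\<close> as soon as the space is infinite-dimensional.\<close>

definition zeta_abscissa :: "('h::chilbert_space \<times> 'h) set \<Rightarrow> real" where
  "zeta_abscissa D = Inf {s. trace_class (abs_power D (- s))}"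

definition spectral_ratio ::
    "('h::chilbert_space \<times> 'h) set \<Rightarrow> ('h \<Rightarrow> 'h) \<Rightarrow> real \<Rightarrow> complex" where
  "spectral_ratio D B s = op_trace (abs_power D (- s) \<circ> B) / op_trace (abs_power D (- s))"

definition spectral_state_exists ::
    "('h::chilbert_space \<times> 'h) set \<Rightarrow> ('h \<Rightarrow> 'h) \<Rightarrow> bool" where
  "spectral_state_exists D B \<longleftrightarrow>
     (\<exists>\<tau>. (spectral_ratio D B \<longlongrightarrow> \<tau>) (at_right (zeta_abscissa D)))"

definition spectral_state ::
    "('h::chilbert_space \<times> 'h) set \<Rightarrow> ('h \<Rightarrow> 'h) \<Rightarrow> complex" where
  "spectral_state D B = Lim (at_right (zeta_abscissa D)) (spectral_ratio D B)"

definition laplace :: "(real \<Rightarrow> 'e::{banach, second_countable_topology}) \<Rightarrow> real \<Rightarrow> 'e" where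
  "laplace f s = (LINT x:{0..}|lebesgue. exp (- s * x) *\<^sub>R f x)"

text \<open>For functions on \<open>[0, \<infinity>)\<close>; their values on negative arguments play no role.\<close>

definition bounded_loc_integrable :: "(real \<Rightarrow> 'e::euclidean_space) \<Rightarrow> bool" where
  "bounded_loc_integrable f \<longleftrightarrow>
     bounded (f ` {0..}) \<and> (\<forall>b. f absolutely_integrable_on {0..b})"

definition asymp_at_0 :: "(real \<Rightarrow> complex) \<Rightarrow> (real \<Rightarrow> complex) \<Rightarrow> bool" where
  "asymp_at_0 g1 g2 \<longleftrightarrow> (\<lambda>t. g1 t - g2 t) \<in> o[at_right 0](g2)"

definition weakly_regular ::
    "('h::chilbert_space \<times> 'h) set \<Rightarrow> real \<Rightarrow> ('h \<Rightarrow> 'h) \<Rightarrow> bool" where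
  "weakly_regular D \<alpha> A \<longleftrightarrow> (\<exists>f :: real \<Rightarrow> complex.
     bounded_loc_integrable f \<and> (\<exists>x\<ge>0. f x \<noteq> 0) \<and>
     (\<exists>L. ((\<lambda>s. s *\<^sub>R laplace f s) \<longlongrightarrow> L) (at_right 0)) \<and>
     asymp_at_0 (\<lambda>t. op_trace (heat_op D t \<circ> A)) (\<lambda>t. f (- ln t) * of_real (t powr \<alpha>)))"

definition strongly_regular ::
    "('h::chilbert_space \<times> 'h) set \<Rightarrow> ('h \<Rightarrow> 'h) \<Rightarrow> bool" where
  "strongly_regular D A \<longleftrightarrow> (\<exists>c :: complex.
     (\<lambda>t. op_trace (heat_op D t \<circ> A) - c * op_trace (heat_op D t))
       \<in> o[at_right 0](\<lambda>t. op_trace (heat_op D t)))"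

end

theory Submission
  imports Defs
begin

text \<open>
  Diagonalise \<open>\<bar>D\<^sub>1\<bar>\<close>, \<open>\<bar>D\<^sub>2\<bar>\<close> and, in the product basis \<open>u\<^sub>i \<otimes> v\<^sub>j\<close>, the operator
  \<open>D\<^sup>2 = D\<^sub>1\<^sup>2 \<otimes> 1 + 1 \<otimes> D\<^sub>2\<^sup>2\<close>. Heat traces of elementary tensors are then products,
  \<open>Tr(exp(-tD\<^sup>2) (A\<^sub>1 \<otimes> A\<^sub>2)) = Tr(exp(-tD\<^sub>1\<^sup>2) A\<^sub>1) Tr(exp(-tD\<^sub>2\<^sup>2) A\<^sub>2)\<close>, and zeta functions are
  Mellin transforms of heat traces. The Laplace transform hypotheses say that the Mellin transform of the heat trace of
  \<open>D\<close> diverges at the abscissa of convergence \<open>- 2 (\<alpha>\<^sub>1 + \<alpha>\<^sub>2)\<close> (and similarly for \<open>D\<^sub>1\<close>, \<open>D\<^sub>2\<close>), so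
  that a perturbation which is small compared with the heat trace as \<open>t \<rightarrow> 0\<close> does not affect the limit of
  the quotient of the zeta functions. Strong regularity of \<open>A\<^sub>1\<close> with constant \<open>c\<close> makes
  \<open>A\<^sub>1 \<otimes> A\<^sub>2 - c (1 \<otimes> A\<^sub>2)\<close> such a perturbation.
\<close>

section \<open>Complex Hilbert spaces\<close>

\<comment> \<open>The product basis does not diagonalise D itself: D mixes
  \<open>ten (u i) (v j)\<close> with \<open>ten (\<gamma> (u i)) (v j)\<close>. Heat operators and
  powers of |D| are even functions of D, so the spectral arguments are phrased for a basis adapted
  to |D| (\<open>abs_spectrum\<close>), and of the closed operator D only symmetry and a total set
  of eigenvectors are established. With t = exp (- x), the factor \<open>t powr \<alpha>\<close>
  becomes \<open>exp (p * x)\<close> for \<open>p = - \<alpha>\<close>, \<open>f (- ln t)\<close>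
  becomes \<open>f x\<close>, and the Mellin transform at \<open>z = s / 2\<close> of the leading
  term is the Laplace transform of \<open>f\<close> at \<open>z - p\<close>. This is how the
  behaviour of \<open>s * laplace f s\<close> at 0 governs the zeta function at
  \<open>s = 2 * p\<close>. In (i) the limit T(1 \<otimes> A2) is not known to exist, so limits
  cannot be compared directly. Instead the ratio for A1 \<otimes> A2 minus c times the ratio for 1
  \<otimes> A2 is shown to tend to 0. Its heat trace is the error of A1 times the heat trace of A2,
  and the latter is at most the norm of A2 times the heat trace of D2.\<close>
subclass (in chilbert_space) banach ..

lemma cinner_add_left: "cinner (x + y) z = cinner x z + cinner (y::'h::chilbert_space) z"
  by (metis cinner_add_right cinner_commute complex_cnj_add)

lemma cinner_scaleC_left: "cinner (c *\<^sub>C x) y = cnj c * cinner (x::'h::chilbert_space) y"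
  by (metis cinner_scaleC_right cinner_commute complex_cnj_mult)

lemma cinner_scaleR_right: "cinner x (r *\<^sub>R y) = r *\<^sub>R cinner (x::'h::chilbert_space) y"
  by (metis cinner_scaleC_right scaleC_of_real scaleR_conv_of_real)

lemma cinner_scaleR_left: "cinner (r *\<^sub>R x) y = r *\<^sub>R cinner (x::'h::chilbert_space) y"
  by (metis cinner_scaleC_left scaleC_of_real scaleR_conv_of_real complex_cnj_complex_of_real)

lemma cinner_self: "cinner x x = complex_of_real ((norm (x::'h::chilbert_space))\<^sup>2)"
proof -
  have "Im (cinner x x) = 0"
    using arg_cong[OF cinner_commute[of x x], of Im] by simp
  then show ?thesis
    by (simp add: complex_eq_iff Re_cinner power2_norm_eq_inner)
qed

lemma norm_scaleC: "norm (c *\<^sub>C (x::'h::chilbert_space)) = cmod c * norm x"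
proof -
  have "complex_of_real ((norm (c *\<^sub>C x))\<^sup>2) = cnj c * c * complex_of_real ((norm x)\<^sup>2)"
    by (metis (no_types, opaque_lifting) cinner_scaleC_left cinner_scaleC_right cinner_self mult.assoc)
  also have "\<dots> = complex_of_real ((cmod c * norm x)\<^sup>2)"
    by (metis complex_norm_square mult.commute of_real_mult power_mult_distrib)
  finally have "(norm (c *\<^sub>C x))\<^sup>2 = (cmod c * norm x)\<^sup>2"
    using of_real_eq_iff by blast
  then show ?thesis by simp
qed

lemma norm_cinner_le: "cmod (cinner x y) \<le> norm x * norm (y::'h::chilbert_space)"
proof (cases "cinner x y = 0")
  case False
  define c where "c = cnj (cinner x y) / cmod (cinner x y)"
  have "cmod c = 1" using False by (simp add: c_def norm_divide)
  have "c * cinner x y = complex_of_real (cmod (cinner x y))"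
    using False complex_norm_square[of "cinner x y"]
    by (simp add: c_def field_simps power2_eq_square)
  then have "cmod (cinner x y) = Re (cinner x (c *\<^sub>C y))"
    by (simp add: cinner_scaleC_right)
  also have "\<dots> \<le> norm x * norm (c *\<^sub>C y)"
    by (simp add: Re_cinner norm_cauchy_schwarz)
  also have "\<dots> = norm x * norm y"
    by (simp add: norm_scaleC \<open>cmod c = 1\<close>)
  finally show ?thesis .
qed simp

lemma bounded_bilinear_cinner: "bounded_bilinear (cinner :: 'h::chilbert_space \<Rightarrow> 'h \<Rightarrow> complex)"
  by standard (auto simp: cinner_add_left cinner_add_right cinner_scaleR_left cinner_scaleR_right
      intro!: exI[of _ 1] norm_cinner_le)

lemma bounded_bilinear_scaleC: "bounded_bilinear (scaleC :: complex \<Rightarrow> 'h::chilbert_space \<Rightarrow> 'h)"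
proof (standard, goal_cases)
  case (3 r a b) then show ?case
    by (simp add: scaleR_conv_of_real flip: scaleC_scaleC scaleC_of_real)
next
  case (4 a r b) then show ?case
    by (simp add: scaleC_scaleC mult.commute flip: scaleC_of_real)
qed (auto simp: scaleC_add_left scaleC_add_right norm_scaleC intro!: exI[of _ 1])

lemmas cinner_zero_left [simp] = bounded_bilinear.zero_left[OF bounded_bilinear_cinner]
  and cinner_zero_right [simp] = bounded_bilinear.zero_right[OF bounded_bilinear_cinner]
  and cinner_minus_right = bounded_bilinear.minus_right[OF bounded_bilinear_cinner]
  and cinner_diff_left = bounded_bilinear.diff_left[OF bounded_bilinear_cinner]
  and cinner_diff_right = bounded_bilinear.diff_right[OF bounded_bilinear_cinner]
  and cinner_sum_left = bounded_bilinear.sum_left[OF bounded_bilinear_cinner]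
  and cinner_sum_right = bounded_bilinear.sum_right[OF bounded_bilinear_cinner]
  and bounded_linear_cinner_left = bounded_bilinear.bounded_linear_left[OF bounded_bilinear_cinner]
  and bounded_linear_cinner_right = bounded_bilinear.bounded_linear_right[OF bounded_bilinear_cinner]
  and bounded_linear_scaleC_right = bounded_bilinear.bounded_linear_right[OF bounded_bilinear_scaleC]

lemma cinner_eq_0_commute: "cinner x y = 0 \<longleftrightarrow> cinner (y::'h::chilbert_space) x = 0"
  by (metis cinner_commute complex_cnj_zero)

lemma cinner_ext: "(\<And>x. cinner x y = cinner x z) \<Longrightarrow> y = (z::'h::chilbert_space)"
  by (metis cinner_diff_right cinner_self norm_eq_zero of_real_eq_0_iff power_eq_0_iff right_minus_eq)

lemma norm_sum_orthogonal:
  fixes w :: "'i \<Rightarrow> 'h::chilbert_space"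
  assumes "finite F" "\<And>i j. i \<in> F \<Longrightarrow> j \<in> F \<Longrightarrow> i \<noteq> j \<Longrightarrow> cinner (w i) (w j) = 0"
  shows "(norm (\<Sum>i\<in>F. w i))\<^sup>2 = (\<Sum>i\<in>F. (norm (w i))\<^sup>2)"
proof -
  have "complex_of_real ((norm (\<Sum>i\<in>F. w i))\<^sup>2) = (\<Sum>i\<in>F. \<Sum>j\<in>F. cinner (w i) (w j))"
    by (subst cinner_self[symmetric]) (simp add: cinner_sum_left cinner_sum_right, rule sum.swap)
  also have "\<dots> = (\<Sum>i\<in>F. cinner (w i) (w i))"
  proof (rule sum.cong[OF refl])
    fix i assume i: "i \<in> F"
    have "(\<Sum>j\<in>F. cinner (w i) (w j)) = (\<Sum>j\<in>F. if i = j then cinner (w i) (w i) else 0)"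
      using assms i by (intro sum.cong) auto
    then show "(\<Sum>j\<in>F. cinner (w i) (w j)) = cinner (w i) (w i)"
      using assms i by simp
  qed
  also have "\<dots> = complex_of_real (\<Sum>i\<in>F. (norm (w i))\<^sup>2)"
    by (simp add: cinner_self)
  finally show ?thesis using of_real_eq_iff by blast
qed

text \<open>Pythagoras turns a tail of the vector sum into a tail of the sum of squared norms, so
  the net of finite partial sums is Cauchy and completeness gives a limit.\<close>

lemma summable_on_orthogonal:
  fixes w :: "'i \<Rightarrow> 'h::chilbert_space"
  assumes orth: "\<And>i j. i \<in> I \<Longrightarrow> j \<in> I \<Longrightarrow> i \<noteq> j \<Longrightarrow> cinner (w i) (w j) = 0"
    and sq: "(\<lambda>i. (norm (w i))\<^sup>2) summable_on I"
  shows "w summable_on I"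
proof -
  define S where "S = infsum (\<lambda>i. (norm (w i))\<^sup>2) I"
  have lim: "((\<lambda>F. \<Sum>i\<in>F. (norm (w i))\<^sup>2) \<longlongrightarrow> S) (finite_subsets_at_top I)"
    using sq has_sum_infsum unfolding S_def has_sum_def by blast
  have le: "(\<Sum>i\<in>F. (norm (w i))\<^sup>2) \<le> S" if "finite F" "F \<subseteq> I" for F
    unfolding S_def by (rule finite_sum_le_infsum) (use sq that in auto)
  let ?f = "filtermap (sum w) (finite_subsets_at_top I)"
  have "cauchy_filter ?f"
    unfolding cauchy_filter_metric_filtermap
  proof (intro allI impI)
    fix e :: real assume e: "e > 0"
    have "\<forall>\<^sub>F F in finite_subsets_at_top I. (\<Sum>i\<in>F. (norm (w i))\<^sup>2) > S - (e/2)\<^sup>2"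
      using lim e by (intro order_tendstoD) auto
    then obtain F where F: "finite F" "F \<subseteq> I"
      and FS: "\<And>G. finite G \<Longrightarrow> F \<subseteq> G \<Longrightarrow> G \<subseteq> I \<Longrightarrow> (\<Sum>i\<in>G. (norm (w i))\<^sup>2) > S - (e/2)\<^sup>2"
      unfolding eventually_finite_subsets_at_top by metis
    have near: "dist (sum w G) (sum w F) < e / 2" if G: "finite G" "F \<subseteq> G" "G \<subseteq> I" for G
    proof -
      have "(norm (sum w (G - F)))\<^sup>2 = (\<Sum>i\<in>G - F. (norm (w i))\<^sup>2)"
        using G orth by (intro norm_sum_orthogonal) (auto simp: subset_iff)
      also have "\<dots> = (\<Sum>i\<in>G. (norm (w i))\<^sup>2) - (\<Sum>i\<in>F. (norm (w i))\<^sup>2)"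
        using G by (simp add: sum_diff)
      also have "\<dots> < (e/2)\<^sup>2" using le[OF G(1,3)] FS[OF F(1) _ F(2)] by auto
      finally have "norm (sum w (G - F)) < e/2"
        using e power2_less_imp_less[of "norm (sum w (G - F))" "e/2"] by simp
      then show ?thesis using G by (simp add: dist_norm sum_diff)
    qed
    show "\<exists>P. eventually P (finite_subsets_at_top I) \<and>
        (\<forall>x y. P x \<and> P y \<longrightarrow> dist (sum w x) (sum w y) < e)"
    proof (intro exI[of _ "\<lambda>G. finite G \<and> F \<subseteq> G \<and> G \<subseteq> I"] conjI allI impI)
      show "\<forall>\<^sub>F G in finite_subsets_at_top I. finite G \<and> F \<subseteq> G \<and> G \<subseteq> I"
        unfolding eventually_finite_subsets_at_top using F by (intro exI[of _ F]) simp
    next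
      fix x y assume "(finite x \<and> F \<subseteq> x \<and> x \<subseteq> I) \<and> (finite y \<and> F \<subseteq> y \<and> y \<subseteq> I)"
      then show "dist (sum w x) (sum w y) < e"
        using near[of x] near[of y] dist_triangle_half_l[of "sum w x" "sum w F" e "sum w y"]
        by (simp add: dist_commute)
    qed
  qed
  moreover have "complete (UNIV::'h set)"
    by (meson Cauchy_convergent UNIV_I complete_def convergent_def)
  ultimately obtain L where "?f \<le> nhds L"
    using cauchy_filter_complete_converges[of ?f UNIV] by (auto simp: filtermap_bot_iff)
  then show ?thesis
    by (auto simp: summable_on_def has_sum_def filterlim_def)
qed

section \<open>Orthonormal bases and diagonal operators\<close>

text \<open>Indexed, so that a product basis can be indexed by pairs. Totality says that only 0 is
  orthogonal to the family; for eigenvectors and elementary tensors this is easier to check than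
  density of the span, which follows in \<open>is_onb_image\<close>.\<close>

locale onb_family =
  fixes I :: "'i set" and u :: "'i \<Rightarrow> 'h::chilbert_space"
  assumes orthonormal: "i \<in> I \<Longrightarrow> j \<in> I \<Longrightarrow> cinner (u i) (u j) = (if i = j then 1 else 0)"
    and total: "(\<And>i. i \<in> I \<Longrightarrow> cinner (u i) x = 0) \<Longrightarrow> x = 0"
begin

lemma norm_basis: "i \<in> I \<Longrightarrow> norm (u i) = 1"
  using orthonormal[of i i] cinner_self[of "u i"]
  by (simp add: power2_eq_1_iff flip: of_real_power) (metis norm_ge_zero not_one_le_zero neg_0_le_iff_le zero_le_one order_antisym)

lemma coeff_eqI: "(\<And>i. i \<in> I \<Longrightarrow> cinner (u i) x = cinner (u i) y) \<Longrightarrow> x = y"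
  using total[of "x - y"] by (simp add: cinner_diff_right)

lemma cinner_basis_sum:
  assumes "finite F" "F \<subseteq> I" "j \<in> I"
  shows "cinner (u j) (\<Sum>i\<in>F. c i *\<^sub>C u i) = (if j \<in> F then c j else 0)"
proof -
  have "cinner (u j) (\<Sum>i\<in>F. c i *\<^sub>C u i) = (\<Sum>i\<in>F. if j = i then c i else 0)"
    unfolding cinner_sum_right cinner_scaleC_right
    using assms by (intro sum.cong) (auto simp: orthonormal subset_iff)
  then show ?thesis using assms by simp
qed

lemma norm_basis_sum:
  assumes "finite F" "F \<subseteq> I"
  shows "(norm (\<Sum>i\<in>F. c i *\<^sub>C u i))\<^sup>2 = (\<Sum>i\<in>F. (cmod (c i))\<^sup>2)"
proof -
  have "(norm (\<Sum>i\<in>F. c i *\<^sub>C u i))\<^sup>2 = (\<Sum>i\<in>F. (norm (c i *\<^sub>C u i))\<^sup>2)"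
    using assms
    by (intro norm_sum_orthogonal) (auto simp: cinner_scaleC_left cinner_scaleC_right orthonormal subset_iff)
  also have "\<dots> = (\<Sum>i\<in>F. (cmod (c i))\<^sup>2)"
    using assms by (intro sum.cong) (auto simp: norm_scaleC norm_basis subset_iff)
  finally show ?thesis .
qed

lemma bessel:
  assumes F: "finite F" "F \<subseteq> I"
  shows "(\<Sum>i\<in>F. (cmod (cinner (u i) x))\<^sup>2) \<le> (norm x)\<^sup>2"
proof -
  define p where "p = (\<Sum>i\<in>F. cinner (u i) x *\<^sub>C u i)"
  have "cinner (u i) (x - p) = 0" if "i \<in> F" for i
    using that F by (simp add: cinner_diff_right p_def cinner_basis_sum subset_iff)
  then have "cinner p (x - p) = 0"
    by (subst (1) p_def) (simp add: cinner_sum_left cinner_scaleC_left)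
  then have "inner p (x - p) = 0" by (simp flip: Re_cinner)
  then have "(norm (p + (x - p)))\<^sup>2 = (norm p)\<^sup>2 + (norm (x - p))\<^sup>2"
    by (intro norm_add_Pythagorean) (simp add: orthogonal_def)
  then have "(norm p)\<^sup>2 \<le> (norm x)\<^sup>2" by simp
  then show ?thesis using F by (simp add: p_def norm_basis_sum)
qed

lemma square_summable_coeff: "(\<lambda>i. (cmod (cinner (u i) x))\<^sup>2) summable_on I"
  by (rule nonneg_bdd_above_summable_on) (auto intro!: bdd_aboveI2[where M = "(norm x)\<^sup>2"] bessel)

lemma square_summable_imp_summable:
  assumes "(\<lambda>i. (cmod (c i))\<^sup>2) summable_on I"
  shows "(\<lambda>i. c i *\<^sub>C u i) summable_on I"
proof (rule summable_on_orthogonal)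
  show "(\<lambda>i. (norm (c i *\<^sub>C u i))\<^sup>2) summable_on I"
    using assms by (rule summable_on_cong[THEN iffD1, rotated]) (simp add: norm_scaleC norm_basis)
qed (auto simp: cinner_scaleC_left cinner_scaleC_right orthonormal)

lemma coeff_infsum:
  assumes "(\<lambda>i. c i *\<^sub>C u i) summable_on I" "j \<in> I"
  shows "cinner (u j) (\<Sum>\<^sub>\<infinity>i\<in>I. c i *\<^sub>C u i) = c j"
proof -
  have "((\<lambda>i. cinner (u j) (c i *\<^sub>C u i)) has_sum cinner (u j) (\<Sum>\<^sub>\<infinity>i\<in>I. c i *\<^sub>C u i)) I"
    using has_sum_bounded_linear[OF bounded_linear_cinner_right] assms has_sum_infsum by blast
  moreover have "((\<lambda>i. cinner (u j) (c i *\<^sub>C u i)) has_sum c j) I"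
    using assms by (intro has_sum_finite_neutralI[of "{j}"]) (auto simp: cinner_scaleC_right orthonormal)
  ultimately show ?thesis using has_sum_unique by blast
qed

lemma expansion: "((\<lambda>i. cinner (u i) x *\<^sub>C u i) has_sum x) I"
proof -
  have s: "(\<lambda>i. cinner (u i) x *\<^sub>C u i) summable_on I"
    by (intro square_summable_imp_summable square_summable_coeff)
  have "(\<Sum>\<^sub>\<infinity>i\<in>I. cinner (u i) x *\<^sub>C u i) = x"
    by (rule coeff_eqI) (simp add: coeff_infsum[OF s])
  then show ?thesis using s by (metis has_sum_infsum)
qed

lemma parseval: "((\<lambda>i. cinner y (u i) * cinner (u i) x) has_sum cinner y x) I"
  using has_sum_bounded_linear[OF bounded_linear_cinner_right[of y] expansion[of x]]
  by (simp add: cinner_scaleC_right mult.commute)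

lemma parseval_norm: "((\<lambda>i. (cmod (cinner (u i) x))\<^sup>2) has_sum (norm x)\<^sup>2) I"
proof -
  have "cinner x (u i) * cinner (u i) x = of_real ((cmod (cinner (u i) x))\<^sup>2)" for i
    by (subst cinner_commute) (metis complex_norm_square mult.commute)
  then show ?thesis
    using parseval[of x x] unfolding cinner_self by (simp only: has_sum_of_real_iff)
qed

end

section \<open>Bounded linear functionals evaluated on an orthonormal basis\<close>

locale cfunctional =
  fixes \<phi> :: "'h::chilbert_space \<Rightarrow> complex" and C :: real
  assumes \<phi>_add: "\<phi> (x + y) = \<phi> x + \<phi> y"
    and \<phi>_scaleC: "\<phi> (c *\<^sub>C x) = c * \<phi> x"
    and C_nonneg: "0 \<le> C"
    and \<phi>_bound: "cmod (\<phi> x) \<le> C * norm x"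
begin

lemma \<phi>_bounded_linear: "bounded_linear \<phi>"
proof (rule bounded_linear_intro[where K = C])
  show "\<phi> (r *\<^sub>R x) = r *\<^sub>R \<phi> x" for r x
    by (metis \<phi>_scaleC scaleC_of_real scaleR_conv_of_real)
qed (use \<phi>_add \<phi>_bound in \<open>simp_all add: mult.commute\<close>)

lemma \<phi>_sum: "\<phi> (\<Sum>i\<in>F. c i *\<^sub>C x i) = (\<Sum>i\<in>F. c i * \<phi> (x i))"
proof -
  interpret bounded_linear \<phi> by (rule \<phi>_bounded_linear)
  show ?thesis by (simp add: sum \<phi>_scaleC)
qed

end

lemma complex_phase: obtains w where "cmod w = 1" "w * z = complex_of_real (cmod z)"
proof (cases "z = 0")
  case True then show ?thesis using that[of 1] by simp
next
  case False
  then show ?thesis using that[of "cnj z / cmod z"] complex_norm_square[of z]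
    by (simp add: norm_divide field_simps power2_eq_square)
qed

context onb_family
begin

text \<open>Turning all terms positive by phases, the sum becomes a value of \<open>\<phi>\<close> at a vector of the
  same norm as the projection of \<open>x\<close>.\<close>

lemma functional_abs_sum_le:
  assumes "cfunctional \<phi> C" "finite F" "F \<subseteq> I"
  shows "(\<Sum>i\<in>F. cmod (cinner (u i) x * \<phi> (u i))) \<le> C * norm x"
proof -
  interpret cfunctional \<phi> C by fact
  have "\<forall>i. \<exists>w. cmod w = 1 \<and> w * (cinner (u i) x * \<phi> (u i)) = of_real (cmod (cinner (u i) x * \<phi> (u i)))"
    using complex_phase by metis
  then obtain w where w: "\<And>i. cmod (w i) = 1"
    "\<And>i. w i * (cinner (u i) x * \<phi> (u i)) = of_real (cmod (cinner (u i) x * \<phi> (u i)))"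
    by metis
  define y where "y = (\<Sum>i\<in>F. (w i * cinner (u i) x) *\<^sub>C u i)"
  have "complex_of_real (\<Sum>i\<in>F. cmod (cinner (u i) x * \<phi> (u i))) = \<phi> y"
    unfolding y_def \<phi>_sum of_real_sum by (intro sum.cong refl) (metis w(2) mult.assoc)
  then have "(\<Sum>i\<in>F. cmod (cinner (u i) x * \<phi> (u i))) \<le> cmod (\<phi> y)"
    by (metis norm_of_real abs_ge_self)
  also have "\<dots> \<le> C * norm y" by (rule \<phi>_bound)
  also have "\<dots> \<le> C * norm x"
  proof (rule mult_left_mono)
    have "(norm y)\<^sup>2 \<le> (norm x)\<^sup>2"
      using bessel[of F x] assms(2,3) by (simp add: y_def norm_basis_sum norm_mult w(1))
    then show "norm y \<le> norm x" by simp
    show "0 \<le> C" by (rule C_nonneg)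
  qed
  finally show ?thesis .
qed

lemma functional_has_sum:
  assumes "cfunctional \<phi> C"
  shows "((\<lambda>i. cinner (u i) x * \<phi> (u i)) has_sum \<phi> x) I"
  using has_sum_bounded_linear[OF cfunctional.\<phi>_bounded_linear[OF assms] expansion[of x]]
  by (simp add: cfunctional.\<phi>_scaleC[OF assms])

text \<open>\<open>y\<close> is the truncated Riesz vector of \<open>\<phi>\<close>:
  \<open>\<phi> y = S\<close> and \<open>norm y\<close> is the square root of \<open>S\<close>, so
  boundedness of \<open>\<phi>\<close> gives \<open>S \<le> C * sqrt S\<close>.\<close>

lemma functional_square_sum_le:
  assumes "cfunctional \<phi> C" "finite F" "F \<subseteq> I"
  shows "(\<Sum>i\<in>F. (cmod (\<phi> (u i)))\<^sup>2) \<le> C\<^sup>2"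
proof -
  interpret cfunctional \<phi> C by fact
  define y where "y = (\<Sum>i\<in>F. cnj (\<phi> (u i)) *\<^sub>C u i)"
  define S where "S = (\<Sum>i\<in>F. (cmod (\<phi> (u i)))\<^sup>2)"
  have ny: "(norm y)\<^sup>2 = S"
    using assms(2,3) by (simp add: y_def norm_basis_sum S_def)
  have "\<phi> y = complex_of_real S"
    unfolding y_def \<phi>_sum S_def of_real_sum
    by (intro sum.cong refl) (metis complex_norm_square mult.commute)
  moreover have "0 \<le> S" by (simp add: S_def sum_nonneg)
  ultimately have "S \<le> C * norm y" using \<phi>_bound[of y] by simp
  then have "norm y * norm y \<le> C * norm y" by (simp add: power2_eq_square flip: ny)
  then have "norm y \<le> C" using C_nonneg
    by (cases "norm y = 0") (auto simp: mult_le_cancel_right)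
  then have "(norm y)\<^sup>2 \<le> C\<^sup>2" by (intro power_mono) auto
  then show ?thesis by (simp add: ny flip: S_def)
qed

end

section \<open>Bounded operators, adjoints and positive operators\<close>

lemma bounded_clinearD:
  assumes "bounded_clinear T"
  shows "bounded_linear T" "T (c *\<^sub>C x) = c *\<^sub>C T x" "T (x + y) = T x + T y" "T (x - y) = T x - T y"
    "T 0 = 0" "T (r *\<^sub>R x) = r *\<^sub>R T x" "T (- x) = - T x" "norm (T x) \<le> onorm T * norm x"
proof -
  have b: "bounded_linear T" using assms by (simp add: bounded_clinear_def)
  interpret bounded_linear T by fact
  show "bounded_linear T" "T (c *\<^sub>C x) = c *\<^sub>C T x" "T (x + y) = T x + T y" "T (x - y) = T x - T y"
    "T 0 = 0" "T (r *\<^sub>R x) = r *\<^sub>R T x" "T (- x) = - T x" "norm (T x) \<le> onorm T * norm x"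
    using assms onorm[OF b] b by (simp_all add: bounded_clinear_def add diff zero scale neg)
qed

lemma cfunctional_cinner:
  assumes "bounded_clinear B"
  shows "cfunctional (\<lambda>x. cinner y (B x)) (norm y * onorm B)"
proof
  show "cmod (cinner y (B x)) \<le> norm y * onorm B * norm x" for x
  proof -
    have "cmod (cinner y (B x)) \<le> norm y * norm (B x)" by (rule norm_cinner_le)
    also have "\<dots> \<le> norm y * (onorm B * norm x)"
      by (intro mult_left_mono bounded_clinearD(8)[OF assms]) simp
    finally show ?thesis by (simp add: mult.assoc)
  qed
  show "0 \<le> norm y * onorm B"
    using onorm_pos_le[OF bounded_clinearD(1)[OF assms]] by simp
qed (simp_all add: bounded_clinearD[OF assms] cinner_add_right cinner_scaleC_right)

lemma bounded_clinear_intro: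
  assumes "\<And>x y. T (x + y) = T x + T y" "\<And>c x. T (c *\<^sub>C x) = c *\<^sub>C T x" "\<And>x. norm (T x) \<le> C * norm x"
  shows "bounded_clinear T"
  unfolding bounded_clinear_def
proof (intro conjI allI assms(2) bounded_linear_intro[where K = C])
  show "T (r *\<^sub>R x) = r *\<^sub>R T x" for r x by (metis assms(2) scaleC_of_real)
qed (use assms in \<open>simp_all add: mult.commute\<close>)

lemma bounded_clinear_id: "bounded_clinear id"
  by (rule bounded_clinear_intro[where C = 1]) auto

lemma bounded_clinear_compose:
  "bounded_clinear A \<Longrightarrow> bounded_clinear B \<Longrightarrow> bounded_clinear (A \<circ> B)"
  unfolding bounded_clinear_def by (auto intro: bounded_linear_compose simp: o_def)

lemma cadjoint_eqI:
  assumes "\<And>x y. cinner (T x) y = cinner x (S y)"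
  shows "cadjoint T = S"
  unfolding cadjoint_def
proof (rule the_equality)
  fix S' assume "\<forall>x y. cinner (T x) y = cinner x (S' y)"
  then show "S' = S" by (intro ext cinner_ext) (metis assms)
qed (use assms in blast)

text \<open>\<open>cadjoint\<close> is a definite description, so an adjoint has to be produced. Its
  value at \<open>y\<close> is built from the coefficients \<open>cinner (T (u i)) y\<close>, which
  are square summable because \<open>\<lambda>x. cinner y (T x)\<close> is a bounded
  functional.\<close>

lemma (in onb_family) cadjoint_works:
  fixes T :: "'h \<Rightarrow> 'h"
  assumes T: "bounded_clinear T"
  shows "cinner (T x) y = cinner x (cadjoint T y)"
proof -
  define S where "S y = (\<Sum>\<^sub>\<infinity>i\<in>I. cinner (T (u i)) y *\<^sub>C u i)" for y
  have "cinner (T x) y = cinner x (S y)" for x y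
  proof -
    interpret F: cfunctional "\<lambda>x. cinner y (T x)" "norm y * onorm T"
      by (rule cfunctional_cinner[OF T])
    have s: "(\<lambda>i. cinner (T (u i)) y *\<^sub>C u i) summable_on I"
    proof (rule square_summable_imp_summable)
      have "(\<lambda>i. (cmod (cinner y (T (u i))))\<^sup>2) summable_on I"
        by (rule nonneg_bdd_above_summable_on)
          (auto intro!: bdd_aboveI2 functional_square_sum_le F.cfunctional_axioms)
      then show "(\<lambda>i. (cmod (cinner (T (u i)) y))\<^sup>2) summable_on I"
        by (metis (no_types, lifting) cinner_commute complex_mod_cnj summable_on_cong)
    qed
    have "((\<lambda>i. cinner (u i) x * cinner y (T (u i))) has_sum cinner y (T x)) I"
      by (rule functional_has_sum[OF F.cfunctional_axioms])
    moreover have "((\<lambda>i. cinner (u i) x * cinner y (T (u i))) has_sum cinner (S y) x) I"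
    proof -
      have "cinner (S y) (u i) = cinner y (T (u i))" if "i \<in> I" for i
        using coeff_infsum[OF s that] unfolding S_def by (metis cinner_commute)
      with parseval[of "S y" x] show ?thesis
        by (subst has_sum_cong[where g = "\<lambda>i. cinner (S y) (u i) * cinner (u i) x"]) auto
    qed
    ultimately show ?thesis using has_sum_unique by (metis cinner_commute)
  qed
  then show ?thesis using cadjoint_eqI[of T S] by metis
qed

text \<open>Polarisation: the defect \<open>B\<close> of symmetry is sesquilinear and vanishes on
  the diagonal because the form is real. Its values at \<open>x + y\<close> and
  \<open>x + \<i> *\<^sub>C y\<close> then give \<open>B x y + B y x = 0\<close> and
  \<open>B x y - B y x = 0\<close>.\<close>

lemma positive_op_symmetric:
  assumes "positive_op P"
  shows "cinner (P x) y = cinner x (P y)"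
proof -
  have lin: "bounded_clinear P" and real: "\<And>x. cinner x (P x) \<in> \<real>"
    using assms by (auto simp: positive_op_def)
  define B where "B x y = cinner x (P y) - cinner (P x) y" for x y
  have B0: "B x x = 0" for x
    using real[of x] unfolding B_def by (metis Reals_cnj_iff cinner_commute right_minus_eq)
  have "B (x + y) (x + y) = B x x + B x y + B y x + B y y"
    by (simp add: B_def bounded_clinearD[OF lin] cinner_add_left cinner_add_right)
  moreover have "B (x + \<i> *\<^sub>C y) (x + \<i> *\<^sub>C y) = B x x + \<i> * B x y - \<i> * B y x + B y y"
    by (simp add: B_def bounded_clinearD[OF lin] cinner_add_left cinner_add_right
        cinner_scaleC_left cinner_scaleC_right algebra_simps)
  ultimately have "B x y + B y x = 0" "\<i> * (B x y - B y x) = 0"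
    by (simp_all add: B0 algebra_simps)
  then have "B x y = 0" by simp
  then show ?thesis by (simp add: B_def)
qed

section \<open>Operators that are diagonal in an orthonormal basis\<close>

definition diag_op :: "'i set \<Rightarrow> ('i \<Rightarrow> 'h::chilbert_space) \<Rightarrow> ('i \<Rightarrow> real) \<Rightarrow> 'h \<Rightarrow> 'h" where
  "diag_op I u g x = (\<Sum>\<^sub>\<infinity>i\<in>I. (of_real (g i) * cinner (u i) x) *\<^sub>C u i)"

locale diagonal = onb_family I u for I :: "'i set" and u :: "'i \<Rightarrow> 'h::chilbert_space" +
  fixes g :: "'i \<Rightarrow> real" and C :: real
  assumes diag_bound: "i \<in> I \<Longrightarrow> \<bar>g i\<bar> \<le> C"
begin

lemma diag_summable: "(\<lambda>i. (of_real (g i) * cinner (u i) x) *\<^sub>C u i) summable_on I"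
proof (rule square_summable_imp_summable, rule summable_on_comparison_test)
  show "(\<lambda>i. C\<^sup>2 * (cmod (cinner (u i) x))\<^sup>2) summable_on I"
    by (intro summable_on_cmult_right square_summable_coeff)
  fix i assume "i \<in> I"
  then have "\<bar>g i\<bar>\<^sup>2 \<le> C\<^sup>2" using diag_bound[of i] by (intro power_mono) auto
  then show "(cmod (of_real (g i) * cinner (u i) x))\<^sup>2 \<le> C\<^sup>2 * (cmod (cinner (u i) x))\<^sup>2"
    by (auto simp: norm_mult power_mult_distrib intro!: mult_right_mono)
qed simp

lemma diag_coeff: "i \<in> I \<Longrightarrow> cinner (u i) (diag_op I u g x) = of_real (g i) * cinner (u i) x"
  unfolding diag_op_def by (rule coeff_infsum[OF diag_summable])

lemma diag_eqI: "(\<And>i. i \<in> I \<Longrightarrow> cinner (u i) y = of_real (g i) * cinner (u i) x) \<Longrightarrow> y = diag_op I u g x"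
  by (rule coeff_eqI) (simp add: diag_coeff)

lemma norm_diag_le: "norm (diag_op I u g x) \<le> C * norm x"
proof (cases "I = {}")
  case True
  then show ?thesis using total[of x] total[of "diag_op I u g x"] by auto
next
  case False
  then have C: "0 \<le> C" using diag_bound by force
  have "(norm (diag_op I u g x))\<^sup>2 \<le> C\<^sup>2 * (norm x)\<^sup>2"
  proof (rule has_sum_mono[OF parseval_norm has_sum_cmult_right[OF parseval_norm]])
    fix i assume i: "i \<in> I"
    then have "\<bar>g i\<bar>\<^sup>2 \<le> C\<^sup>2" using diag_bound[of i] by (intro power_mono) auto
    then show "(cmod (cinner (u i) (diag_op I u g x)))\<^sup>2 \<le> C\<^sup>2 * (cmod (cinner (u i) x))\<^sup>2"
      using i by (auto simp: diag_coeff norm_mult power_mult_distrib intro!: mult_right_mono)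
  qed
  then have "(norm (diag_op I u g x))\<^sup>2 \<le> (C * norm x)\<^sup>2" by (simp add: power_mult_distrib)
  then show ?thesis using C power2_le_imp_le[of "norm (diag_op I u g x)" "C * norm x"] by simp
qed

lemma bounded_clinear_diag: "bounded_clinear (diag_op I u g)"
proof (rule bounded_clinear_intro[where C = C])
  show "diag_op I u g (x + y) = diag_op I u g x + diag_op I u g y" for x y
    by (rule diag_eqI[symmetric]) (simp add: diag_coeff cinner_add_right algebra_simps)
  show "diag_op I u g (c *\<^sub>C x) = c *\<^sub>C diag_op I u g x" for c x
    by (rule diag_eqI[symmetric]) (simp add: diag_coeff cinner_scaleC_right algebra_simps)
qed (rule norm_diag_le)

lemma diag_basis: "i \<in> I \<Longrightarrow> diag_op I u g (u i) = g i *\<^sub>R u i"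
  by (rule diag_eqI[symmetric]) (simp add: cinner_scaleR_right scaleR_conv_of_real orthonormal)

lemma diag_form:
  "((\<lambda>i. of_real (g i) * (cinner y (u i) * cinner (u i) x)) has_sum cinner y (diag_op I u g x)) I"
  using parseval[of y "diag_op I u g x"]
  by (rule has_sum_cong[THEN iffD1, rotated]) (simp add: diag_coeff)

lemma diag_symmetric: "cinner (diag_op I u g x) y = cinner x (diag_op I u g y)"
proof -
  have "((\<lambda>i. of_real (g i) * (cinner x (u i) * cinner (u i) y)) has_sum cinner (diag_op I u g x) y) I"
    using parseval[of "diag_op I u g x" y]
  proof (rule has_sum_cong[THEN iffD1, rotated])
    fix i assume "i \<in> I"
    then have "cinner (diag_op I u g x) (u i) = of_real (g i) * cinner x (u i)"
      by (subst (1 2) cinner_commute) (simp add: diag_coeff)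
    then show "cinner (diag_op I u g x) (u i) * cinner (u i) y =
        of_real (g i) * (cinner x (u i) * cinner (u i) y)" by simp
  qed
  then show ?thesis using diag_form[of x y] has_sum_unique by blast
qed

end

section \<open>Traces of diagonal operators\<close>

lemma closure_cspan_total:
  assumes "closure (cspan S) = UNIV" "\<And>s. s \<in> S \<Longrightarrow> cinner s x = 0"
  shows "x = (0::'h::chilbert_space)"
proof -
  have "cspan S \<subseteq> {y. cinner y x = 0}"
    unfolding cspan_def
  proof (rule span_minimal)
    show "subspace {y. cinner y x = 0}"
      by (auto simp: subspace_def cinner_add_left cinner_scaleR_left)
  qed (auto simp: cinner_scaleC_left assms(2))
  moreover have "closed {y. cinner y x = 0}"
    by (intro closed_Collect_eq continuous_intros
        linear_continuous_on[OF bounded_linear_cinner_left])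
  ultimately have "closure (cspan S) \<subseteq> {y. cinner y x = 0}"
    by (rule closure_minimal)
  then have "cinner x x = 0" using assms(1) by auto
  then show "x = 0" by (simp add: cinner_self)
qed

lemma is_onb_imp_onb_family:
  assumes "is_onb E"
  shows "onb_family E (\<lambda>e. e)"
proof
  show "cinner i j = (if i = j then 1 else 0)" if "i \<in> E" "j \<in> E" for i j
    using assms that by (simp add: is_onb_def)
  fix x assume orth: "\<And>i. i \<in> E \<Longrightarrow> cinner i x = 0"
  show "x = 0"
    using assms orth by (intro closure_cspan_total[of E]) (auto simp: is_onb_def)
qed

context onb_family
begin

lemma inj_basis: "inj_on u I"
  by (rule inj_onI) (metis orthonormal zero_neq_one)

lemma is_onb_image: "is_onb (u ` I)"
  unfolding is_onb_def
proof (intro conjI ballI)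
  show "cinner x y = (if x = y then 1 else 0)" if "x \<in> u ` I" "y \<in> u ` I" for x y
    using that inj_basis by (auto simp: orthonormal inj_on_def)
  have "x \<in> closure (cspan (u ` I))" for x
  proof -
    have "\<forall>\<^sub>F F in finite_subsets_at_top I. (\<Sum>i\<in>F. cinner (u i) x *\<^sub>C u i) \<in> closure (cspan (u ` I))"
    proof (rule eventually_finite_subsets_at_top_weakI)
      fix F assume F: "finite F" "F \<subseteq> I"
      have "(\<Sum>i\<in>F. cinner (u i) x *\<^sub>C u i) \<in> cspan (u ` I)"
        unfolding cspan_def using F by (intro span_sum span_base) auto
      then show "(\<Sum>i\<in>F. cinner (u i) x *\<^sub>C u i) \<in> closure (cspan (u ` I))"
        using closure_subset by blast
    qed
    then show ?thesis
      using expansion[of x] unfolding has_sum_def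
      by (intro Lim_in_closed_set[OF closed_closure]) auto
  qed
  then show "closure (cspan (u ` I)) = UNIV" by blast
qed

text \<open>\<open>op_trace\<close> picks a basis by choice, so a value has to be verified in every
  basis; \<open>is_onb_image\<close> ensures that there is one.\<close>

lemma op_trace_eqI:
  fixes T :: "'h \<Rightarrow> 'h"
  assumes "\<And>E. is_onb E \<Longrightarrow> (\<Sum>\<^sub>\<infinity>e\<in>E. cinner e (T e)) = c"
  shows "op_trace T = (c::complex)"
  unfolding op_trace_def using someI[of is_onb, OF is_onb_image] by (intro assms) simp

end

context diagonal
begin

text \<open>Uniqueness of the positive square root is only needed for a diagonal operator, where it can
  be checked on each eigenvector \<open>u i\<close>: if \<open>P \<circ> P\<close> multiplies \<open>u i\<close> by \<open>(g i)\<^sup>2\<close>, then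
  \<open>v = P (u i) - g i u i\<close> satisfies \<open>P v = - g i v\<close>.\<close>

lemma abs_op_diag:
  assumes nonneg: "\<And>i. i \<in> I \<Longrightarrow> 0 \<le> g i"
  shows "abs_op (diag_op I u g) = diag_op I u g"
  unfolding abs_op_def
proof (rule the_equality)
  let ?T = "diag_op I u g"
  have adj: "cadjoint ?T = ?T" by (rule cadjoint_eqI) (rule diag_symmetric)
  show "positive_op ?T \<and> ?T \<circ> ?T = cadjoint ?T \<circ> ?T"
    unfolding adj positive_op_def
  proof (intro conjI allI refl bounded_clinear_diag)
    fix x
    have h: "((\<lambda>i. of_real (g i * (cmod (cinner (u i) x))\<^sup>2)) has_sum cinner x (?T x)) I"
      using diag_form[of x x]
    proof (rule has_sum_cong[THEN iffD1, rotated])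
      fix i
      have "cinner x (u i) * cinner (u i) x = of_real ((cmod (cinner (u i) x))\<^sup>2)"
        by (subst cinner_commute) (metis complex_norm_square mult.commute)
      then show "of_real (g i) * (cinner x (u i) * cinner (u i) x) =
          complex_of_real (g i * (cmod (cinner (u i) x))\<^sup>2)" by simp
    qed
    show "cinner x (?T x) \<in> \<real>"
      using diag_symmetric[of x x] by (metis Reals_cnj_iff cinner_commute)
    show "0 \<le> Re (cinner x (?T x))"
      using has_sum_Re[OF h] by (rule has_sum_nonneg) (simp add: nonneg)
  qed
  fix P assume P: "positive_op P \<and> P \<circ> P = cadjoint ?T \<circ> ?T"
  then have lin: "bounded_clinear P" and pos: "\<And>x. 0 \<le> Re (cinner x (P x))"
    by (auto simp: positive_op_def)
  have PP: "P (P x) = ?T (?T x)" for x using P adj by (metis comp_apply)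
  have sym: "cinner (P x) y = cinner x (P y)" for x y using P positive_op_symmetric by blast
  have Pu: "P (u i) = g i *\<^sub>R u i" if i: "i \<in> I" for i
  proof -
    have PPu: "P (P (u i)) = g i *\<^sub>R g i *\<^sub>R u i"
      using i by (simp add: PP diag_basis bounded_clinearD[OF bounded_clinear_diag])
    show ?thesis
    proof (cases "g i = 0")
      case True
      then have "cinner (P (u i)) (P (u i)) = 0" using PPu by (simp add: sym)
      then show ?thesis using True by (simp add: cinner_self)
    next
      case False
      define v where "v = P (u i) - g i *\<^sub>R u i"
      have "P v = - (g i *\<^sub>R v)"
        by (simp add: v_def bounded_clinearD[OF lin] PPu scaleR_diff_right)
      then have "cinner v (P v) = - of_real (g i * (norm v)\<^sup>2)"
        by (simp add: cinner_minus_right cinner_scaleR_right cinner_self scaleR_conv_of_real)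
      then have "g i * (norm v)\<^sup>2 \<le> 0" using pos[of v] by simp
      moreover have "g i > 0" using False nonneg[OF i] by simp
      ultimately have "v = 0" by (simp add: mult_le_0_iff)
      then show ?thesis by (simp add: v_def)
    qed
  qed
  show "P = ?T"
  proof (rule ext, rule diag_eqI)
    fix x i assume "i \<in> I"
    then show "cinner (u i) (P x) = of_real (g i) * cinner (u i) x"
      by (simp add: Pu cinner_scaleR_left scaleR_conv_of_real flip: sym)
  qed
qed

text \<open>\<open>trace_class\<close> allows an arbitrary basis \<open>E\<close>. For the converse,
  Parseval writes each \<open>g i\<close> as the sum over \<open>E\<close> of \<open>h i e\<close>,
  and for fixed \<open>e\<close> finitely many of these stay below the quadratic form at
  \<open>e\<close>; hence every finite sum of \<open>g\<close> is at most the trace \<open>S\<close>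
  computed in \<open>E\<close>.\<close>

lemma trace_class_diag:
  assumes nonneg: "\<And>i. i \<in> I \<Longrightarrow> 0 \<le> g i"
  shows "trace_class (diag_op I u g) \<longleftrightarrow> g summable_on I"
proof -
  have abs: "abs_op (diag_op I u g) = diag_op I u g"
    by (rule abs_op_diag) (rule nonneg)
  show ?thesis
  proof
    assume g: "g summable_on I"
    have "(\<lambda>i. cinner (u i) (diag_op I u g (u i))) summable_on I"
      using summable_on_of_real[OF g]
      by (rule summable_on_cong[THEN iffD1, rotated]) (simp add: diag_coeff orthonormal)
    then have "(\<lambda>e. cinner e (diag_op I u g e)) summable_on (u ` I)"
      by (simp add: summable_on_reindex[OF inj_basis] o_def)
    then show "trace_class (diag_op I u g)"
      unfolding trace_class_def abs
      using bounded_clinear_diag is_onb_image by blast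
  next
    assume "trace_class (diag_op I u g)"
    then obtain E where "is_onb E" and s: "(\<lambda>e. cinner e (diag_op I u g e)) summable_on E"
      unfolding trace_class_def abs by blast
    interpret E: onb_family E "\<lambda>e. e" by (rule is_onb_imp_onb_family) fact
    define h where "h i e = g i * (cmod (cinner e (u i)))\<^sup>2" for i e
    have h: "((\<lambda>i. h i e) has_sum Re (cinner e (diag_op I u g e))) I" for e
      using has_sum_Re[OF diag_form[of e e]]
    proof (rule has_sum_cong[THEN iffD1, rotated])
      fix i
      have "cinner e (u i) * cinner (u i) e = of_real ((cmod (cinner e (u i)))\<^sup>2)"
        by (subst (2) cinner_commute) (metis complex_norm_square)
      then show "Re (of_real (g i) * (cinner e (u i) * cinner (u i) e)) = h i e"
        by (simp add: h_def)
    qed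
    define S where "S = (\<Sum>\<^sub>\<infinity>e\<in>E. Re (cinner e (diag_op I u g e)))"
    have "sum g F \<le> S" if F: "finite F" "F \<subseteq> I" for F
    proof -
      have hi: "((\<lambda>e. h i e) has_sum g i) E" if "i \<in> F" for i
        using has_sum_cmult_right[OF E.parseval_norm[of "u i"], of "g i"] that F
        by (simp add: h_def norm_basis subset_iff)
      have "((\<lambda>e. \<Sum>i\<in>F. h i e) has_sum sum g F) E"
        using F(1) hi by (induction F rule: finite_induct) (auto intro: has_sum_add)
      moreover have "((\<lambda>e. Re (cinner e (diag_op I u g e))) has_sum S) E"
        unfolding S_def by (intro has_sum_infsum summable_on_Re s)
      ultimately show ?thesis
      proof (rule has_sum_mono)
        show "(\<Sum>i\<in>F. h i e) \<le> Re (cinner e (diag_op I u g e))" for e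
          by (rule finite_sum_le_has_sum[OF h F]) (use nonneg in \<open>auto simp: h_def\<close>)
      qed
    qed
    then show "g summable_on I"
      using nonneg by (intro nonneg_bdd_above_summable_on) (auto intro!: bdd_aboveI2)
  qed
qed

text \<open>Basis independence of the trace for operators of this form. The trace in
  \<open>E\<close> is a double series over both bases; row \<open>i\<close> has absolute sum at most
  \<open>onorm B * g i\<close>, which is summable in \<open>i\<close>, so the two summations may be
  exchanged.\<close>

lemma op_trace_diag:
  assumes nonneg: "\<And>i. i \<in> I \<Longrightarrow> 0 \<le> g i" and sum: "g summable_on I" and B: "bounded_clinear B"
  shows "op_trace (diag_op I u g \<circ> B) = (\<Sum>\<^sub>\<infinity>i\<in>I. of_real (g i) * cinner (u i) (B (u i)))"
proof (rule op_trace_eqI)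
  fix E :: "'h set" assume "is_onb E"
  then interpret E: onb_family E "\<lambda>e. e" by (rule is_onb_imp_onb_family)
  define a where "a i e = of_real (g i) * (cinner e (u i) * cinner (u i) (B e))" for i e
  have fu: "cfunctional (\<lambda>x. cinner (u i) (B x)) (onorm B)" if "i \<in> I" for i
    using cfunctional_cinner[OF B, of "u i"] that by (simp add: norm_basis)
  have K: "0 \<le> onorm B" using onorm_pos_le[OF bounded_clinearD(1)[OF B]] .
  have rows: "(\<lambda>e. norm (a i e)) summable_on E" "(\<Sum>\<^sub>\<infinity>e\<in>E. norm (a i e)) \<le> onorm B * g i"
    "((\<lambda>e. a i e) has_sum of_real (g i) * cinner (u i) (B (u i))) E" if i: "i \<in> I" for i
  proof -
    have fin: "(\<Sum>e\<in>F. norm (a i e)) \<le> onorm B * g i" if "finite F" "F \<subseteq> E" for F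
      using mult_left_mono[OF E.functional_abs_sum_le[OF fu[OF i] that, of "u i"] nonneg[OF i]] i nonneg[OF i]
      by (simp add: a_def norm_mult sum_distrib_left norm_basis mult.commute mult.left_commute)
    show *: "(\<lambda>e. norm (a i e)) summable_on E"
      by (rule nonneg_bdd_above_summable_on) (auto intro!: bdd_aboveI2 fin)
    show "(\<Sum>\<^sub>\<infinity>e\<in>E. norm (a i e)) \<le> onorm B * g i"
      by (rule infsum_le_finite_sums[OF * fin])
    show "((\<lambda>e. a i e) has_sum of_real (g i) * cinner (u i) (B (u i))) E"
      unfolding a_def by (intro has_sum_cmult_right E.functional_has_sum[OF fu[OF i]])
  qed
  have "(\<lambda>x. norm (case x of (i, e) \<Rightarrow> a i e)) summable_on I \<times> E"
  proof (subst Infinite_Sum.abs_summable_on_Sigma_iff, intro conjI ballI)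
    show "(\<lambda>i. norm (\<Sum>\<^sub>\<infinity>e\<in>E. norm (case (i, e) of (i, e) \<Rightarrow> a i e))) summable_on I"
    proof (rule Infinite_Sum.abs_summable_on_comparison_test)
      show "(\<lambda>i. norm (onorm B * g i)) summable_on I"
        using summable_on_cmult_right[OF sum, of "onorm B"] nonneg K
        by (subst summable_on_cong[where g = "\<lambda>i. onorm B * g i"]) auto
      fix i assume i: "i \<in> I"
      have "0 \<le> (\<Sum>\<^sub>\<infinity>e\<in>E. norm (a i e))" by (rule infsum_nonneg) simp
      then show "norm (\<Sum>\<^sub>\<infinity>e\<in>E. norm (case (i, e) of (i, e) \<Rightarrow> a i e)) \<le> norm (onorm B * g i)"
        using rows(2)[OF i] nonneg[OF i] K by simp
    qed
  qed (use rows(1) in simp)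
  then have s: "(\<lambda>(i, e). a i e) summable_on I \<times> E" by (rule abs_summable_summable)
  have "(\<Sum>\<^sub>\<infinity>e\<in>E. cinner e ((diag_op I u g \<circ> B) e)) = (\<Sum>\<^sub>\<infinity>e\<in>E. \<Sum>\<^sub>\<infinity>i\<in>I. a i e)"
  proof (rule infsum_cong)
    fix e
    show "cinner e ((diag_op I u g \<circ> B) e) = (\<Sum>\<^sub>\<infinity>i\<in>I. a i e)"
      using diag_form[of e "B e"] by (simp add: a_def infsumI)
  qed
  also have "\<dots> = (\<Sum>\<^sub>\<infinity>i\<in>I. \<Sum>\<^sub>\<infinity>e\<in>E. a i e)"
    by (rule infsum_swap_banach[symmetric, OF s])
  also have "\<dots> = (\<Sum>\<^sub>\<infinity>i\<in>I. of_real (g i) * cinner (u i) (B (u i)))"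
    by (intro infsum_cong infsumI rows(3))
  finally show "(\<Sum>\<^sub>\<infinity>e\<in>E. cinner e ((diag_op I u g \<circ> B) e)) =
      (\<Sum>\<^sub>\<infinity>i\<in>I. of_real (g i) * cinner (u i) (B (u i)))" .
qed

end

section \<open>Functional calculus\<close>

text \<open>The basis need not consist of eigenvectors of \<open>D\<close>: for even functions of \<open>D\<close> it suffices
  that it is adapted to the spectral decomposition of \<open>\<bar>D\<bar>\<close>.\<close>

locale abs_spectrum = onb_family I u for I :: "'i set" and u :: "'i \<Rightarrow> 'h::chilbert_space" +
  fixes D :: "('h \<times> 'h) set" and \<nu> :: "'i \<Rightarrow> real" and \<delta> :: real
  assumes eigenvectors_total: "(\<And>l e. (e, l *\<^sub>R e) \<in> D \<Longrightarrow> cinner e y = 0) \<Longrightarrow> y = 0"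
    and eigenvalue_abs: "(e, l *\<^sub>R e) \<in> D \<Longrightarrow> i \<in> I \<Longrightarrow> cinner e (u i) \<noteq> 0 \<Longrightarrow> \<bar>l\<bar> = \<nu> i"
    and \<delta>_pos: "0 < \<delta>" and \<nu>_ge: "i \<in> I \<Longrightarrow> \<delta> \<le> \<nu> i"
begin

lemma \<nu>_pos: "i \<in> I \<Longrightarrow> 0 < \<nu> i"
  using \<delta>_pos \<nu>_ge by force

lemma fun_calc_eqI:
  assumes "\<And>l e. (e, l *\<^sub>R e) \<in> D \<Longrightarrow> cinner e y = of_real (f l) * cinner e x"
  shows "fun_calc D f x = y"
  unfolding fun_calc_def
proof (rule the_equality)
  fix y' assume "\<forall>l e. (e, l *\<^sub>R e) \<in> D \<longrightarrow> cinner e y' = of_real (f l) * cinner e x"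
  then have "y' - y = 0"
    using assms by (intro eigenvectors_total) (auto simp: cinner_diff_right)
  then show "y' = y" by simp
qed (use assms in blast)

lemma even_on_spectrum:
  assumes "\<And>l. f \<bar>l\<bar> = f l" "(e, l *\<^sub>R e) \<in> D" "i \<in> I"
  shows "of_real (f l) * cinner e (u i) = of_real (f (\<nu> i)) * cinner e (u i)"
  using eigenvalue_abs[OF assms(2,3)] assms(1)[of l] by (cases "cinner e (u i) = 0") auto

lemma fun_calc_basis:
  assumes "\<And>l. f \<bar>l\<bar> = f l" "i \<in> I"
  shows "fun_calc D f (u i) = f (\<nu> i) *\<^sub>R u i"
  by (intro fun_calc_eqI)
    (simp only: cinner_scaleR_right scaleR_conv_of_real even_on_spectrum[of f, OF assms(1) _ assms(2)])

text \<open>By \<open>eigenvalue_abs\<close> an eigenvector of \<open>D\<close> with eigenvalue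
  \<open>l\<close> meets only those \<open>u i\<close> with \<open>\<nu> i = \<bar>l\<bar>\<close>.
  An even \<open>f\<close> has the same value \<open>f l\<close> at all of these, so this factor can
  be pulled out of Parseval's sum.\<close>

lemma fun_calc_diag:
  assumes even: "\<And>l. f \<bar>l\<bar> = f l" and "\<And>i. i \<in> I \<Longrightarrow> \<bar>f (\<nu> i)\<bar> \<le> C"
  shows "fun_calc D f = diag_op I u (\<lambda>i. f (\<nu> i))"
proof
  interpret diagonal I u "\<lambda>i. f (\<nu> i)" C by standard (use assms in auto)
  fix x
  show "fun_calc D f x = diag_op I u (\<lambda>i. f (\<nu> i)) x"
  proof (rule fun_calc_eqI)
    fix l e assume e: "(e, l *\<^sub>R e) \<in> D"
    have ev: "of_real (f (\<nu> i)) * cinner e (u i) = of_real (f l) * cinner e (u i)" if "i \<in> I" for i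
      by (rule even_on_spectrum[symmetric]) (fact even e that)+
    have "((\<lambda>i. of_real (f l) * (cinner e (u i) * cinner (u i) x)) has_sum
        cinner e (diag_op I u (\<lambda>i. f (\<nu> i)) x)) I"
      using diag_form[of e x]
      by (rule has_sum_cong[THEN iffD1, rotated])
        (simp only: mult.assoc[symmetric] ev)
    moreover have "((\<lambda>i. of_real (f l) * (cinner e (u i) * cinner (u i) x)) has_sum
        of_real (f l) * cinner e x) I"
      by (intro has_sum_cmult_right parseval)
    ultimately show "cinner e (diag_op I u (\<lambda>i. f (\<nu> i)) x) = of_real (f l) * cinner e x"
      using has_sum_unique by blast
  qed
qed

text \<open>No bound on \<open>f\<close> along the spectrum is assumed: a trace class operator is
  bounded, and its norm supplies one. This allows powers of either sign, as the set in
  \<open>zeta_abscissa\<close> does.\<close>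

lemma trace_class_fun_calc:
  assumes even: "\<And>l. f \<bar>l\<bar> = f l" and nonneg: "\<And>l. 0 \<le> f l" and tc: "trace_class (fun_calc D f)"
  shows "(\<lambda>i. f (\<nu> i)) summable_on I"
proof -
  let ?T = "fun_calc D f"
  have lin: "bounded_clinear ?T" using tc by (simp add: trace_class_def)
  have bound: "\<bar>f (\<nu> i)\<bar> \<le> onorm ?T" if "i \<in> I" for i
    using bounded_clinearD(8)[OF lin, of "u i"] that by (simp add: fun_calc_basis even norm_basis)
  interpret diagonal I u "\<lambda>i. f (\<nu> i)" "onorm ?T" by standard (rule bound)
  have "?T = diag_op I u (\<lambda>i. f (\<nu> i))" by (rule fun_calc_diag) (use even bound in auto)
  then show ?thesis using tc trace_class_diag nonneg by simp
qed

lemma heat_exp_summable: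
  assumes "trace_class (heat_op D t)"
  shows "(\<lambda>i. exp (- t * (\<nu> i)\<^sup>2)) summable_on I"
  using trace_class_fun_calc[of "\<lambda>l. exp (- t * l\<^sup>2)"] assms by (simp add: heat_op_def)

lemma op_trace_heat:
  assumes sum: "(\<lambda>i. exp (- t * (\<nu> i)\<^sup>2)) summable_on I" and t: "0 < t" and B: "bounded_clinear B"
  shows "op_trace (heat_op D t \<circ> B) =
    (\<Sum>\<^sub>\<infinity>i\<in>I. of_real (exp (- t * (\<nu> i)\<^sup>2)) * cinner (u i) (B (u i)))"
proof -
  interpret diagonal I u "\<lambda>i. exp (- t * (\<nu> i)\<^sup>2)" 1
    by standard (use t in simp)
  have "heat_op D t = diag_op I u (\<lambda>i. exp (- t * (\<nu> i)\<^sup>2))"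
    unfolding heat_op_def by (rule fun_calc_diag[where C = 1]) (use t in auto)
  then show ?thesis using op_trace_diag[OF _ sum B] by simp
qed

lemma abs_power_diag:
  assumes "0 \<le> s"
  shows "abs_power D (- s) = diag_op I u (\<lambda>i. \<nu> i powr - s)" "diagonal I u (\<lambda>i. \<nu> i powr - s) (\<delta> powr - s)"
proof -
  have le: "\<bar>\<nu> i powr - s\<bar> \<le> \<delta> powr - s" if "i \<in> I" for i
    using assms \<nu>_ge[OF that] \<delta>_pos by (simp add: powr_mono2')
  have "abs_power D (- s) = diag_op I u (\<lambda>i. \<bar>\<nu> i\<bar> powr - s)"
    unfolding abs_power_def
    by (rule fun_calc_diag[where C = "\<delta> powr - s"]) (use le in \<open>auto simp: \<nu>_pos abs_of_pos\<close>)
  also have "\<dots> = diag_op I u (\<lambda>i. \<nu> i powr - s)"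
    unfolding diag_op_def by (intro ext infsum_cong) (simp add: \<nu>_pos abs_of_pos)
  finally show "abs_power D (- s) = diag_op I u (\<lambda>i. \<nu> i powr - s)" .
  show "diagonal I u (\<lambda>i. \<nu> i powr - s) (\<delta> powr - s)" by standard (rule le)
qed

lemma op_trace_abs_power:
  assumes s: "0 \<le> s" and sum: "(\<lambda>i. \<nu> i powr - s) summable_on I" and B: "bounded_clinear B"
  shows "op_trace (abs_power D (- s) \<circ> B) =
    (\<Sum>\<^sub>\<infinity>i\<in>I. of_real (\<nu> i powr - s) * cinner (u i) (B (u i)))"
  unfolding abs_power_diag(1)[OF s]
  by (rule diagonal.op_trace_diag[OF abs_power_diag(2)[OF s]]) (use sum B in auto)

lemma trace_class_abs_power:
  assumes "0 \<le> s" "(\<lambda>i. \<nu> i powr - s) summable_on I"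
  shows "trace_class (abs_power D (- s))"
  unfolding abs_power_diag(1)[OF assms(1)]
  by (subst diagonal.trace_class_diag[OF abs_power_diag(2)[OF assms(1)]]) (use assms(2) in auto)

lemma abs_power_summable:
  assumes "trace_class (abs_power D (- s))"
  shows "(\<lambda>i. \<nu> i powr - s) summable_on I"
proof -
  have "(\<lambda>i. \<bar>\<nu> i\<bar> powr - s) summable_on I"
    using trace_class_fun_calc[of "\<lambda>l. \<bar>l\<bar> powr - s"] assms by (simp add: abs_power_def)
  then show ?thesis
    by (rule summable_on_cong[THEN iffD1, rotated]) (simp add: \<nu>_pos abs_of_pos)
qed

end

section \<open>The spectral theorem for compact symmetric operators\<close>

lemma selfadjoint_symmetric:
  assumes "selfadjoint D" "(x, w) \<in> D" "(y, z) \<in> D"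
  shows "cinner w y = cinner x z"
  using assms unfolding selfadjoint_def graph_adjoint_def by blast

text \<open>The square of the norm \<open>\<mu>\<close> of \<open>K\<close> on \<open>M\<close> is
  an eigenvalue of \<open>K \<circ> K\<close>: for unit vectors \<open>x n\<close> with
  \<open>norm (K (x n))\<close> tending to \<open>\<mu>\<close>, the vectors
  \<open>K (K (x n)) - \<mu>\<^sup>2 *\<^sub>R x n\<close> tend to 0, and compactness makes a
  subsequence converge. Factoring \<open>K \<circ> K - \<mu>\<^sup>2\<close> then yields an
  eigenvalue \<open>\<mu>\<close> or \<open>- \<mu>\<close> of \<open>K\<close>.\<close>

lemma compact_symmetric_eigenvector:
  fixes K :: "'h::chilbert_space \<Rightarrow> 'h"
  assumes K: "compact_op K" and sym: "\<And>x y. cinner (K x) y = cinner x (K y)"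
    and inj: "\<And>x. K x = 0 \<Longrightarrow> x = 0"
    and M: "closed M" "subspace M" "K ` M \<subseteq> M" and x0: "x0 \<in> M" "x0 \<noteq> 0"
  obtains e \<kappa> where "e \<in> M" "norm e = 1" "K e = \<kappa> *\<^sub>R e"
proof -
  have lin: "bounded_clinear K" and cpt: "compact (closure (K ` cball 0 1))"
    using K by (auto simp: compact_op_def)
  note K_simps = bounded_clinearD[OF lin]
  have isym: "inner (K x) y = inner x (K y)" for x y
    by (metis Re_cinner sym)
  define S where "S = (\<lambda>x. norm (K x)) ` {x \<in> M. norm x = 1}"
  have bdd: "bdd_above S"
    unfolding S_def using K_simps(8) by (intro bdd_aboveI2[where M = "onorm K"]) (metis (mono_tags) mem_Collect_eq mult.right_neutral)
  define x1 where "x1 = (1 / norm x0) *\<^sub>R x0"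
  have x1: "x1 \<in> M" "norm x1 = 1"
    using x0 M(2) by (auto simp: x1_def subspace_scale)
  define \<mu> where "\<mu> = Sup S"
  have le\<mu>: "norm (K x) \<le> \<mu>" if "x \<in> M" "norm x = 1" for x
    unfolding \<mu>_def by (rule cSup_upper[OF _ bdd]) (use that in \<open>auto simp: S_def\<close>)
  have "0 < norm (K x1)" using inj[of x1] x1(2) by auto
  then have \<mu>: "0 < \<mu>" using le\<mu>[OF x1] by linarith
  have le: "norm (K x) \<le> \<mu> * norm x" if "x \<in> M" for x
  proof (cases "x = 0")
    case True then show ?thesis by (simp add: K_simps)
  next
    case False
    then have "norm (K ((1 / norm x) *\<^sub>R x)) \<le> \<mu>"
      using that M(2) by (intro le\<mu>) (auto simp: subspace_scale)
    then show ?thesis using False by (simp add: K_simps field_simps)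
  qed
  have "\<exists>x. x \<in> M \<and> norm x = 1 \<and> \<mu> - 1 / real (Suc n) < norm (K x)" for n
  proof -
    have "\<mu> - 1 / real (Suc n) < Sup S" by (simp add: \<mu>_def)
    moreover have "S \<noteq> {}" using x1 by (auto simp: S_def)
    ultimately obtain s where "s \<in> S" "\<mu> - 1 / real (Suc n) < s"
      using less_cSupD by metis
    then show ?thesis unfolding S_def by blast
  qed
  then obtain x where x: "\<And>n. x n \<in> M" "\<And>n. norm (x n) = 1"
    "\<And>n. \<mu> - 1 / real (Suc n) < norm (K (x n))" by metis
  have "(\<lambda>n. \<mu> - 1 / real (Suc n)) \<longlonglongrightarrow> \<mu> - 0"
    by (intro tendsto_diff tendsto_const LIMSEQ_Suc[OF lim_1_over_n])
  then have lim0: "(\<lambda>n. \<mu> - 1 / real (Suc n)) \<longlonglongrightarrow> \<mu>" by simp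
  have lim\<mu>: "(\<lambda>n. norm (K (x n))) \<longlonglongrightarrow> \<mu>"
  proof (rule tendsto_sandwich[OF _ _ lim0 tendsto_const])
    show "\<forall>\<^sub>F n in sequentially. \<mu> - 1 / real (Suc n) \<le> norm (K (x n))"
      using x(3) less_imp_le by (intro always_eventually) blast
    show "\<forall>\<^sub>F n in sequentially. norm (K (x n)) \<le> \<mu>"
      using x(1,2) le\<mu> by (intro always_eventually) blast
  qed
  have sq_le: "(norm (K (K (x n)) - \<mu>\<^sup>2 *\<^sub>R x n))\<^sup>2 \<le> \<mu>\<^sup>2 * (\<mu>\<^sup>2 - (norm (K (x n)))\<^sup>2)" for n
  proof -
    have "(norm (K (K (x n)) - \<mu>\<^sup>2 *\<^sub>R x n))\<^sup>2 =
        (norm (K (K (x n))))\<^sup>2 - 2 * \<mu>\<^sup>2 * (norm (K (x n)))\<^sup>2 + \<mu>\<^sup>2 * \<mu>\<^sup>2"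
    proof -
      have "(norm (K (K (x n)) - \<mu>\<^sup>2 *\<^sub>R x n))\<^sup>2 = (norm (K (K (x n))))\<^sup>2 + (norm (\<mu>\<^sup>2 *\<^sub>R x n))\<^sup>2
          - 2 * inner (K (K (x n))) (\<mu>\<^sup>2 *\<^sub>R x n)"
        unfolding power2_norm_eq_inner inner_diff_left inner_diff_right by (simp add: inner_commute)
      moreover have "inner (K (K (x n))) (\<mu>\<^sup>2 *\<^sub>R x n) = \<mu>\<^sup>2 * (norm (K (x n)))\<^sup>2"
        by (simp add: isym[of "K (x n)"] power2_norm_eq_inner)
      ultimately show ?thesis using x(2)[of n] by (simp add: power2_eq_square)
    qed
    moreover have "norm (K (K (x n))) \<le> \<mu> * norm (K (x n))"
      using M(3) x(1) by (intro le) auto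
    then have "(norm (K (K (x n))))\<^sup>2 \<le> \<mu>\<^sup>2 * (norm (K (x n)))\<^sup>2"
      by (metis norm_ge_zero power_mono power_mult_distrib)
    ultimately show ?thesis by (simp add: algebra_simps)
  qed
  have "(\<lambda>n. \<mu>\<^sup>2 * (\<mu>\<^sup>2 - (norm (K (x n)))\<^sup>2)) \<longlonglongrightarrow> \<mu>\<^sup>2 * (\<mu>\<^sup>2 - \<mu>\<^sup>2)"
    by (intro tendsto_intros lim\<mu>)
  then have lim_sq: "(\<lambda>n. \<mu>\<^sup>2 * (\<mu>\<^sup>2 - (norm (K (x n)))\<^sup>2)) \<longlonglongrightarrow> 0" by simp
  have "(\<lambda>n. (norm (K (K (x n)) - \<mu>\<^sup>2 *\<^sub>R x n))\<^sup>2) \<longlonglongrightarrow> 0"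
    by (rule tendsto_sandwich[OF always_eventually always_eventually tendsto_const lim_sq])
      (use sq_le zero_le_power2 in blast)+
  from tendsto_real_sqrt[OF this]
  have "(\<lambda>n. norm (K (K (x n)) - \<mu>\<^sup>2 *\<^sub>R x n)) \<longlonglongrightarrow> 0"
    by (simp only: real_sqrt_abs abs_norm_cancel real_sqrt_zero)
  then have d0: "(\<lambda>n. K (K (x n)) - \<mu>\<^sup>2 *\<^sub>R x n) \<longlonglongrightarrow> 0"
    by (rule tendsto_norm_zero_cancel)
  have "\<forall>n. K (x n) \<in> closure (K ` cball 0 1)"
    using x(2) by (intro allI subsetD[OF closure_subset]) auto
  then obtain w r where r: "strict_mono r" and w: "(\<lambda>n. K (x (r n))) \<longlonglongrightarrow> w"
    using seq_compactE[OF compact_imp_seq_compact[OF cpt], of "\<lambda>n. K (x n)"] unfolding o_def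
    by metis
  have d0r: "(\<lambda>n. K (K (x (r n))) - \<mu>\<^sup>2 *\<^sub>R x (r n)) \<longlonglongrightarrow> 0"
    using LIMSEQ_subseq_LIMSEQ[OF d0 r] by (simp add: o_def)
  have KKw: "(\<lambda>n. K (K (x (r n)))) \<longlonglongrightarrow> K w"
    by (intro bounded_linear.tendsto[OF K_simps(1)] w)
  \<comment> \<open>\<open>K (K (x (r n)))\<close> converges to \<open>K w\<close> and differs from
    \<open>\<mu>\<^sup>2 *\<^sub>R x (r n)\<close> by a null sequence, so the maximising vectors
    themselves converge to this \<open>z\<close>.\<close>
  define z where "z = (1 / \<mu>\<^sup>2) *\<^sub>R K w"
  have xz: "(\<lambda>n. x (r n)) \<longlonglongrightarrow> z"
    using tendsto_scaleR[OF tendsto_const[of "1 / \<mu>\<^sup>2"] tendsto_diff[OF KKw d0r]] \<mu>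
    by (simp add: z_def)
  have zM: "z \<in> M"
    using closed_sequentially[OF M(1) _ xz] x(1) by blast
  have nz: "norm z = 1"
    using LIMSEQ_unique[OF tendsto_norm[OF xz]] x(2) by simp
  have "(\<lambda>n. K (K (x (r n))) - \<mu>\<^sup>2 *\<^sub>R x (r n)) \<longlonglongrightarrow> K (K z) - \<mu>\<^sup>2 *\<^sub>R z"
    by (intro tendsto_intros bounded_linear.tendsto[OF K_simps(1)] xz)
  from LIMSEQ_unique[OF this d0r] have KKz: "K (K z) = \<mu>\<^sup>2 *\<^sub>R z"
    by simp
  \<comment> \<open>\<open>KKz\<close> makes \<open>v\<close> an eigenvector for
    \<open>\<mu>\<close> unless it vanishes, in which case \<open>z\<close> is one for
    \<open>- \<mu>\<close>.\<close>
  define v where "v = K z + \<mu> *\<^sub>R z"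
  show ?thesis
  proof (cases "v = 0")
    case True
    then have "K z = (- \<mu>) *\<^sub>R z" by (simp add: v_def eq_neg_iff_add_eq_0)
    then show ?thesis using that zM nz by blast
  next
    case False
    have "K v = \<mu> *\<^sub>R v" by (simp add: v_def K_simps KKz power2_eq_square scaleR_add_right add.commute)
    moreover have "v \<in> M" using M zM by (auto simp: v_def subspace_add subspace_scale)
    ultimately show ?thesis
      using False M(2) by (intro that[of "(1 / norm v) *\<^sub>R v" \<mu>]) (auto simp: K_simps subspace_scale)
  qed
qed

text \<open>Zorn's lemma gives a maximal orthonormal set of eigenvectors. Its orthogonal complement
  is closed and, by symmetry, invariant under \<open>K\<close>, so if it were non-zero it would
  contain one more eigenvector.\<close>

lemma compact_symmetric_eigenbasis:
  fixes K :: "'h::chilbert_space \<Rightarrow> 'h"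
  assumes K: "compact_op K" and sym: "\<And>x y. cinner (K x) y = cinner x (K y)"
    and inj: "\<And>x. K x = 0 \<Longrightarrow> x = 0"
  obtains E where "onb_family E (\<lambda>e. e)" "\<And>e. e \<in> E \<Longrightarrow> \<exists>\<kappa>. K e = \<kappa> *\<^sub>R e"
proof -
  have lin: "bounded_clinear K" using K by (simp add: compact_op_def)
  define \<S> where "\<S> = {E. (\<forall>x\<in>E. \<forall>y\<in>E. cinner x y = (if x = y then 1 else 0)) \<and> (\<forall>e\<in>E. \<exists>\<kappa>. K e = \<kappa> *\<^sub>R e)}"
  have "{} \<in> \<S>" by (simp add: \<S>_def)
  then have "\<exists>E\<in>\<S>. \<forall>X\<in>\<S>. E \<subseteq> X \<longrightarrow> X = E"
  proof (intro subset_Zorn_nonempty)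
    fix \<C> assume ch: "\<C> \<noteq> {}" "subset.chain \<S> \<C>"
    have sub: "E \<in> \<S>" if "E \<in> \<C>" for E using ch(2) that by (auto simp: subset_chain_def)
    have "cinner x y = (if x = y then 1 else 0)" if xy: "x \<in> X" "X \<in> \<C>" "y \<in> Y" "Y \<in> \<C>" for x y X Y
    proof -
      have "X \<subseteq> Y \<or> Y \<subseteq> X" using ch(2) xy by (auto simp: subset_chain_def)
      then obtain Z where "Z \<in> \<C>" "x \<in> Z" "y \<in> Z" using xy by blast
      then show ?thesis using sub[of Z] by (simp add: \<S>_def)
    qed
    moreover have "\<exists>\<kappa>. K e = \<kappa> *\<^sub>R e" if "e \<in> X" "X \<in> \<C>" for e X
      using sub[OF that(2)] that(1) by (simp add: \<S>_def)
    ultimately show "\<Union>\<C> \<in> \<S>" unfolding \<S>_def by blast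
  qed auto
  then obtain E where E: "E \<in> \<S>" and max: "\<And>X. X \<in> \<S> \<Longrightarrow> E \<subseteq> X \<Longrightarrow> X = E" by blast
  have on: "cinner x y = (if x = y then 1 else 0)" if "x \<in> E" "y \<in> E" for x y
    using E that by (simp add: \<S>_def)
  have ev: "\<exists>\<kappa>. K e = \<kappa> *\<^sub>R e" if "e \<in> E" for e
    using E that by (simp add: \<S>_def)
  have "onb_family E (\<lambda>e. e)"
  proof
    fix x assume orth: "\<And>e. e \<in> E \<Longrightarrow> cinner e x = 0"
    show "x = 0"
    proof (rule ccontr)
      assume "x \<noteq> 0"
      define M where "M = {x. \<forall>e\<in>E. cinner e x = 0}"
      have "closed M"
      proof -
        have "M = (\<Inter>e\<in>E. {x. cinner e x = 0})" by (auto simp: M_def)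
        moreover have "closed {x. cinner e x = 0}" for e :: 'h
          by (intro closed_Collect_eq continuous_intros linear_continuous_on[OF bounded_linear_cinner_right])
        ultimately show ?thesis by auto
      qed
      moreover have "subspace M"
        by (auto simp: M_def subspace_def cinner_add_right cinner_scaleR_right)
      moreover have "K ` M \<subseteq> M"
      proof safe
        fix x assume x: "x \<in> M"
        have "cinner e (K x) = 0" if "e \<in> E" for e
        proof -
          obtain \<kappa> where "K e = \<kappa> *\<^sub>R e" using ev[OF \<open>e \<in> E\<close>] by blast
          then show ?thesis using x \<open>e \<in> E\<close> by (simp add: M_def cinner_scaleR_left flip: sym)
        qed
        then show "K x \<in> M" by (simp add: M_def)
      qed
      moreover have "x \<in> M" using orth by (simp add: M_def)
      ultimately obtain e \<kappa> where e: "e \<in> M" "norm e = 1" "K e = \<kappa> *\<^sub>R e"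
        using compact_symmetric_eigenvector[OF K sym inj _ _ _ _ \<open>x \<noteq> 0\<close>] by metis
      have "cinner e' e = 0" "cinner e e' = 0" if "e' \<in> E" for e'
        using e(1) that by (auto simp: M_def cinner_eq_0_commute)
      moreover have e1: "cinner e e = 1" using e(2) by (simp add: cinner_self)
      moreover have "e \<notin> E" using e(1) e1 by (auto simp: M_def)
      ultimately have "insert e E \<in> \<S>"
        using e(3) on ev unfolding \<S>_def by auto
      then show False using max[of "insert e E"] \<open>e \<notin> E\<close> by blast
    qed
  qed (use on in auto)
  then show ?thesis using that ev by blast
qed

lemma selfadjoint_eigenbasis:
  assumes sa: "selfadjoint D" and ci: "has_compact_inverse D"
  obtains E l \<delta> where "abs_spectrum E (\<lambda>e. e) D (\<lambda>e. \<bar>l e\<bar>) \<delta>" "\<And>e. e \<in> E \<Longrightarrow> (e, l e *\<^sub>R e) \<in> D"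
proof -
  obtain K where K: "compact_op K" and D: "D = {(K y, y) | y. True}"
    using ci by (auto simp: has_compact_inverse_def)
  have lin: "bounded_clinear K" using K by (simp add: compact_op_def)
  have sym: "cinner (K x) y = cinner x (K y)" for x y
    using selfadjoint_symmetric[OF sa, of "K x" x "K y" y] D by auto
  \<comment> \<open>A vector in the kernel of \<open>K\<close> is orthogonal to the range of
    \<open>K\<close>, which is the dense domain of \<open>D\<close>.\<close>
  have inj: "x = 0" if "K x = 0" for x
  proof -
    have "Domain D \<subseteq> {y. cinner x y = 0}"
      using that by (auto simp: D simp flip: sym)
    moreover have "closed {y. cinner x y = 0}"
      by (intro closed_Collect_eq continuous_intros linear_continuous_on[OF bounded_linear_cinner_right])
    ultimately have "closure (Domain D) \<subseteq> {y. cinner x y = 0}" by (rule closure_minimal)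
    then have "cinner x x = 0" using sa by (auto simp: selfadjoint_def)
    then show ?thesis by (simp add: cinner_self)
  qed
  obtain E where onb: "onb_family E (\<lambda>e. e)" and ev: "\<And>e. e \<in> E \<Longrightarrow> \<exists>\<kappa>. K e = \<kappa> *\<^sub>R e"
    using compact_symmetric_eigenbasis[OF K sym inj] by blast
  interpret onb_family E "\<lambda>e. e" by (rule onb)
  have "\<exists>l. (e, l *\<^sub>R e) \<in> D" if e: "e \<in> E" for e
  proof -
    obtain \<kappa> where \<kappa>: "K e = \<kappa> *\<^sub>R e" using ev[OF e] by blast
    moreover have "\<kappa> \<noteq> 0" using inj[of e] \<kappa> norm_basis[OF e] by auto
    ultimately have "K ((1 / \<kappa>) *\<^sub>R e) = e" by (simp add: bounded_clinearD[OF lin])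
    then show ?thesis unfolding D by (metis (mono_tags, lifting) mem_Collect_eq)
  qed
  then obtain l where l: "\<And>e. e \<in> E \<Longrightarrow> (e, l e *\<^sub>R e) \<in> D" by metis
  have pos: "0 \<le> onorm K" by (rule onorm_pos_le[OF bounded_clinearD(1)[OF lin]])
  \<comment> \<open>The reciprocal of the norm of the inverse bounds the spectrum away from 0; the
    added 1 keeps the denominator positive on the zero space.\<close>
  have "abs_spectrum E (\<lambda>e. e) D (\<lambda>e. \<bar>l e\<bar>) (1 / (onorm K + 1))"
  proof
    show "y = 0" if "\<And>l e. (e, l *\<^sub>R e) \<in> D \<Longrightarrow> cinner e y = 0" for y
      using total that l by blast
    \<comment> \<open>Eigenvectors of a symmetric operator with different eigenvalues are
      orthogonal.\<close>
    show "\<bar>k\<bar> = \<bar>l i\<bar>" if "(e, k *\<^sub>R e) \<in> D" "i \<in> E" "cinner e i \<noteq> 0" for e k i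
      using selfadjoint_symmetric[OF sa that(1) l[OF that(2)]] that(3)
      by (simp add: cinner_scaleR_left cinner_scaleR_right)
    show "0 < 1 / (onorm K + 1)" using pos by simp
    show "1 / (onorm K + 1) \<le> \<bar>l e\<bar>" if e: "e \<in> E" for e
    proof -
      have "e = K (l e *\<^sub>R e)" using l[OF e] by (auto simp: D)
      then have "1 \<le> onorm K * \<bar>l e\<bar>"
        using bounded_clinearD(8)[OF lin, of "l e *\<^sub>R e"] norm_basis[OF e] by simp
      also have "\<dots> \<le> (onorm K + 1) * \<bar>l e\<bar>" by (intro mult_right_mono) auto
      finally show ?thesis using pos by (simp add: field_simps)
    qed
  qed
  then show ?thesis using that l by blast
qed

section \<open>Tensor products\<close>

lemma bounded_clinear_eqI:
  assumes T: "bounded_clinear T" and S: "bounded_clinear S"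
    and dense: "closure (cspan G) = UNIV" and eq: "\<And>x. x \<in> G \<Longrightarrow> T x = S x"
  shows "T = S"
proof -
  have "cspan G \<subseteq> {x. T x = S x}"
    unfolding cspan_def
  proof (rule span_minimal)
    show "subspace {x. T x = S x}"
      by (auto simp: subspace_def bounded_clinearD[OF T] bounded_clinearD[OF S])
  qed (auto simp: bounded_clinearD(2)[OF T] bounded_clinearD(2)[OF S] eq)
  moreover have "closed {x. T x = S x}"
    using T S unfolding bounded_clinear_def
    by (intro closed_Collect_eq linear_continuous_on) auto
  ultimately have "closure (cspan G) \<subseteq> {x. T x = S x}" by (rule closure_minimal)
  then show ?thesis using dense by auto
qed

locale tensor_product =
  fixes ten :: "'a::chilbert_space \<Rightarrow> 'b::chilbert_space \<Rightarrow> 'c::chilbert_space"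
  assumes hilbert_tensor: "hilbert_tensor ten"
begin

lemma ten_add_left: "ten (x + x') y = ten x y + ten x' y"
  and ten_add_right: "ten x (y + y') = ten x y + ten x y'"
  and ten_scaleC_left: "ten (c *\<^sub>C x) y = c *\<^sub>C ten x y"
  and ten_scaleC_right: "ten x (c *\<^sub>C y) = c *\<^sub>C ten x y"
  and cinner_ten: "cinner (ten x y) (ten x' y') = cinner x x' * cinner y y'"
  and ten_dense: "closure (cspan {ten x y | x y. True}) = UNIV"
  using hilbert_tensor unfolding hilbert_tensor_def by blast+

lemma ten_scaleR_left: "ten (r *\<^sub>R x) y = r *\<^sub>R ten x y"
  by (metis scaleC_of_real ten_scaleC_left)

lemma ten_scaleR_right: "ten x (r *\<^sub>R y) = r *\<^sub>R ten x y"
  by (metis scaleC_of_real ten_scaleC_right)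

lemma norm_ten: "norm (ten x y) = norm x * norm y"
proof -
  have "complex_of_real ((norm (ten x y))\<^sup>2) = complex_of_real ((norm x * norm y)\<^sup>2)"
    by (metis cinner_self cinner_ten of_real_mult power_mult_distrib)
  then have "(norm (ten x y))\<^sup>2 = (norm x * norm y)\<^sup>2" using of_real_eq_iff by blast
  then show ?thesis by simp
qed

lemma bounded_bilinear_ten: "bounded_bilinear ten"
  by standard (auto simp: ten_add_left ten_add_right ten_scaleR_left ten_scaleR_right norm_ten
      intro!: exI[of _ 1])

text \<open>Lets a construction on the second factor serve for the first as well.\<close>

lemma flip: "tensor_product (\<lambda>y x. ten x y)"
proof
  have "{ten x y | y x. True} = {ten x y | x y. True}" by blast
  then show "Defs.hilbert_tensor (\<lambda>y x. ten x y)"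
    using hilbert_tensor unfolding hilbert_tensor_def by (simp add: mult.commute)
qed

end

section \<open>Product bases and the tensor product of two bounded operators\<close>

locale tensor_bases = tensor_product ten + U: onb_family I u + V: onb_family J v
  for ten :: "'a::chilbert_space \<Rightarrow> 'b::chilbert_space \<Rightarrow> 'c::chilbert_space"
    and I :: "'i set" and u :: "'i \<Rightarrow> 'a" and J :: "'j set" and v :: "'j \<Rightarrow> 'b"
begin

text \<open>For totality, expand one factor at a time: a vector orthogonal to all products of basis
  vectors is orthogonal to all \<open>ten (u i) y\<close>, then to all elementary tensors, whose
  span is dense.\<close>

lemma onb_family_ten: "onb_family (I \<times> J) (\<lambda>(i, j). ten (u i) (v j))"
proof
  show "cinner (case p of (i, j) \<Rightarrow> ten (u i) (v j)) (case q of (i, j) \<Rightarrow> ten (u i) (v j)) = (if p = q then 1 else 0)"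
    if "p \<in> I \<times> J" "q \<in> I \<times> J" for p q
    using that by (auto simp: cinner_ten U.orthonormal V.orthonormal split: if_splits)
  fix z assume "\<And>p. p \<in> I \<times> J \<Longrightarrow> cinner (case p of (i, j) \<Rightarrow> ten (u i) (v j)) z = 0"
  then have orth: "\<And>i j. i \<in> I \<Longrightarrow> j \<in> J \<Longrightarrow> cinner (ten (u i) (v j)) z = 0" by force
  have 1: "cinner (ten (u i) y) z = 0" if "i \<in> I" for i y
  proof -
    have "bounded_linear (\<lambda>y. cinner (ten (u i) y) z)"
      by (intro bounded_linear_compose[OF bounded_linear_cinner_left]
          bounded_bilinear.bounded_linear_right[OF bounded_bilinear_ten])
    from has_sum_bounded_linear[OF this V.expansion[of y]]
    have "((\<lambda>j. 0) has_sum cinner (ten (u i) y) z) J"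
      by (rule has_sum_cong[THEN iffD1, rotated])
        (simp add: ten_scaleC_right cinner_scaleC_left orth that)
    then show ?thesis using has_sum_unique has_sum_0_simp by blast
  qed
  have "cinner (ten x y) z = 0" for x y
  proof -
    have "bounded_linear (\<lambda>x. cinner (ten x y) z)"
      by (intro bounded_linear_compose[OF bounded_linear_cinner_left]
          bounded_bilinear.bounded_linear_left[OF bounded_bilinear_ten])
    from has_sum_bounded_linear[OF this U.expansion[of x]]
    have "((\<lambda>i. 0) has_sum cinner (ten x y) z) I"
      by (rule has_sum_cong[THEN iffD1, rotated])
        (simp add: ten_scaleC_left cinner_scaleC_left 1)
    then show ?thesis using has_sum_unique has_sum_0_simp by blast
  qed
  then show "z = 0" by (intro closure_cspan_total[OF ten_dense]) auto
qed

text \<open>The partial inner product with \<open>u i\<close>, that is, the adjoint of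
  \<open>ten (u i)\<close> applied to \<open>z\<close>. By \<open>slice_norm\<close> the slices
  embed the tensor product isometrically into the square summable families in the second
  factor.\<close>

definition slice :: "'i \<Rightarrow> 'c \<Rightarrow> 'b" where
  "slice i z = (\<Sum>\<^sub>\<infinity>j\<in>J. cinner (ten (u i) (v j)) z *\<^sub>C v j)"

context
  fixes i assumes i: "i \<in> I"
begin

lemma slice_summable: "(\<lambda>j. cinner (ten (u i) (v j)) z *\<^sub>C v j) summable_on J"
proof (rule V.square_summable_imp_summable)
  interpret W: onb_family "I \<times> J" "\<lambda>(i, j). ten (u i) (v j)" by (rule onb_family_ten)
  have "(\<lambda>p. (cmod (cinner (case p of (i, j) \<Rightarrow> ten (u i) (v j)) z))\<^sup>2) summable_on Pair i ` J"
    using i by (intro summable_on_subset[OF W.square_summable_coeff]) auto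
  then show "(\<lambda>j. (cmod (cinner (ten (u i) (v j)) z))\<^sup>2) summable_on J"
    by (subst (asm) summable_on_reindex) (auto simp: o_def inj_on_def)
qed

lemma slice_coeff: "j \<in> J \<Longrightarrow> cinner (v j) (slice i z) = cinner (ten (u i) (v j)) z"
  unfolding slice_def by (rule V.coeff_infsum[OF slice_summable])

lemma slice_add: "slice i (z + z') = slice i z + slice i z'"
  by (rule V.coeff_eqI) (simp add: slice_coeff cinner_add_right)

lemma slice_scaleC: "slice i (c *\<^sub>C z) = c *\<^sub>C slice i z"
  by (rule V.coeff_eqI) (simp add: slice_coeff cinner_scaleC_right)

lemma slice_ten: "slice i (ten x y) = cinner (u i) x *\<^sub>C y"
  by (rule V.coeff_eqI) (simp add: slice_coeff cinner_scaleC_right cinner_ten)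

end

lemma slice_norm: "((\<lambda>i. (norm (slice i z))\<^sup>2) has_sum (norm z)\<^sup>2) I"
proof -
  interpret W: onb_family "I \<times> J" "\<lambda>(i, j). ten (u i) (v j)" by (rule onb_family_ten)
  show ?thesis
  proof (rule has_sum_SigmaD[OF W.parseval_norm[of z]])
    fix i assume i: "i \<in> I"
    show "((\<lambda>j. (cmod (cinner (case (i, j) of (i, j) \<Rightarrow> ten (u i) (v j)) z))\<^sup>2) has_sum (norm (slice i z))\<^sup>2) J"
      using V.parseval_norm[of "slice i z"]
      by (rule has_sum_cong[THEN iffD1, rotated]) (simp add: slice_coeff i)
  qed
qed

text \<open>Constructs 1 \<otimes> B by applying \<open>B\<close> to every slice. The summands
  \<open>w z i\<close> are orthogonal with norm at most \<open>onorm B * norm (slice i z)\<close>,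
  so \<open>slice_norm\<close> gives both convergence of the series and the bound for
  \<open>T\<close>.\<close>

lemma tensor_right_exists:
  assumes B: "bounded_clinear B"
  obtains T where "bounded_clinear T" "\<And>x y. T (ten x y) = ten x (B y)"
proof -
  define w where "w z i = ten (u i) (B (slice i z))" for z i
  define T where "T z = (\<Sum>\<^sub>\<infinity>i\<in>I. w z i)" for z
  note B_simps = bounded_clinearD[OF B]
  have K: "0 \<le> onorm B" by (rule onorm_pos_le[OF B_simps(1)])
  have orth: "cinner (w z i) (w z j) = 0" if "i \<in> I" "j \<in> I" "i \<noteq> j" for i j z
    using that by (simp add: w_def cinner_ten U.orthonormal)
  have nw: "(norm (w z i))\<^sup>2 \<le> (onorm B)\<^sup>2 * (norm (slice i z))\<^sup>2" if "i \<in> I" for z i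
  proof -
    have "norm (w z i) \<le> onorm B * norm (slice i z)"
      using that B_simps(8) by (simp add: w_def norm_ten U.norm_basis)
    then show ?thesis by (metis norm_ge_zero power_mono power_mult_distrib)
  qed
  have sl: "(\<lambda>i. (norm (slice i z))\<^sup>2) summable_on I" for z
    using slice_norm by (rule has_sum_imp_summable)
  have sum: "w z summable_on I" for z
  proof (rule summable_on_orthogonal[OF orth])
    show "(\<lambda>i. (norm (w z i))\<^sup>2) summable_on I"
      by (rule summable_on_comparison_test[OF summable_on_cmult_right[OF sl]]) (use nw in auto)
  qed
  have "norm (T z) \<le> onorm B * norm z" for z
  proof -
    have "norm (sum (w z) F) \<le> onorm B * norm z" if F: "finite F" "F \<subseteq> I" for F
    proof -
      have "(norm (sum (w z) F))\<^sup>2 = (\<Sum>i\<in>F. (norm (w z i))\<^sup>2)"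
        by (intro norm_sum_orthogonal) (use F in \<open>blast intro: orth\<close>)+
      also have "\<dots> \<le> (\<Sum>i\<in>F. (onorm B)\<^sup>2 * (norm (slice i z))\<^sup>2)"
        using F nw by (intro sum_mono) auto
      also have "\<dots> \<le> (onorm B)\<^sup>2 * (norm z)\<^sup>2"
        using finite_sum_le_has_sum[OF slice_norm F, of z]
        by (simp add: mult_left_mono flip: sum_distrib_left)
      finally show ?thesis
        using K power2_le_imp_le[of "norm (sum (w z) F)" "onorm B * norm z"] by (simp add: power_mult_distrib)
    qed
    moreover have "(w z has_sum T z) I" unfolding T_def using sum by simp
    ultimately show ?thesis
      unfolding has_sum_def
      by (intro tendsto_upperbound[OF tendsto_norm] eventually_finite_subsets_at_top_weakI) auto
  qed
  moreover have "T (z + z') = T z + T z'" for z z'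
  proof -
    have "T (z + z') = (\<Sum>\<^sub>\<infinity>i\<in>I. w z i + w z' i)"
      unfolding T_def by (intro infsum_cong) (simp add: w_def slice_add B_simps ten_add_right)
    then show ?thesis by (simp add: T_def infsum_add sum)
  qed
  moreover have "T (c *\<^sub>C z) = c *\<^sub>C T z" for c z
  proof -
    have "((\<lambda>i. c *\<^sub>C w z i) has_sum c *\<^sub>C T z) I"
      unfolding T_def using sum by (intro has_sum_bounded_linear[OF bounded_linear_scaleC_right]) simp
    then have "(w (c *\<^sub>C z) has_sum c *\<^sub>C T z) I"
      by (rule has_sum_cong[THEN iffD1, rotated]) (simp add: w_def slice_scaleC B_simps ten_scaleC_right)
    then show ?thesis unfolding T_def by (rule infsumI)
  qed
  ultimately have "bounded_clinear T" by (intro bounded_clinear_intro[where C = "onorm B"])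
  moreover have "T (ten x y) = ten x (B y)" for x y
  proof -
    have "((\<lambda>i. ten (cinner (u i) x *\<^sub>C u i) (B y)) has_sum ten x (B y)) I"
      by (intro has_sum_bounded_linear[OF bounded_bilinear.bounded_linear_left[OF bounded_bilinear_ten]] U.expansion)
    then have "(w (ten x y) has_sum ten x (B y)) I"
      by (rule has_sum_cong[THEN iffD1, rotated])
        (simp add: w_def slice_ten B_simps ten_scaleC_right ten_scaleC_left)
    then show ?thesis unfolding T_def by (rule infsumI)
  qed
  ultimately show ?thesis using that by blast
qed

text \<open>A \<otimes> B is the composition of A \<otimes> 1, obtained from the flipped tensor
  product, with 1 \<otimes> B; density of the elementary tensors gives the uniqueness that the
  definite description in \<open>tensor_op\<close> requires.\<close>

lemma tensor_op_works:
  assumes A: "bounded_clinear A" and B: "bounded_clinear B"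
  shows "bounded_clinear (tensor_op ten A B)" "tensor_op ten A B (ten x y) = ten (A x) (B y)"
proof -
  obtain S where S: "bounded_clinear S" "\<And>x y. S (ten x y) = ten x (B y)"
    using tensor_right_exists[OF B] by blast
  interpret F: tensor_bases "\<lambda>y x. ten x y" J v I u
    by (intro tensor_bases.intro flip U.onb_family_axioms V.onb_family_axioms)
  obtain R where R: "bounded_clinear R" "\<And>x y. R (ten x y) = ten (A x) y"
    using F.tensor_right_exists[OF A] by metis
  let ?P = "\<lambda>T. bounded_clinear T \<and> (\<forall>x y. T (ten x y) = ten (A x) (B y))"
  have "\<exists>!T. ?P T"
  proof (rule ex1I)
    show "?P (R \<circ> S)" using R S bounded_clinear_compose[OF R(1) S(1)] by simp
    fix T assume T: "?P T"
    show "T = R \<circ> S"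
      by (rule bounded_clinear_eqI[OF _ bounded_clinear_compose[OF R(1) S(1)] ten_dense]) (use T R S in auto)
  qed
  from theI'[OF this] have "?P (tensor_op ten A B)" unfolding tensor_op_def .
  then show "bounded_clinear (tensor_op ten A B)" "tensor_op ten A B (ten x y) = ten (A x) (B y)" by auto
qed

end

section \<open>The Dirac operator of the product and its square\<close>

lemma closure_span_minimal:
  "G \<subseteq> S \<Longrightarrow> subspace S \<Longrightarrow> closed S \<Longrightarrow> closure (span G) \<subseteq> S"
  by (simp add: closure_minimal span_minimal)

text \<open>Symmetry is a computation on the generators of the graph. It passes to the closed span
  one argument at a time, first in \<open>r\<close> with \<open>s\<close> a generator, then in
  \<open>s\<close> with \<open>r\<close> arbitrary.\<close>

lemma (in tensor_product) tensor_dirac_symmetric: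
  assumes D1: "\<And>x x' z z'. (x, x') \<in> D1 \<Longrightarrow> (z, z') \<in> D1 \<Longrightarrow> cinner x' z = cinner x z'"
    and D2: "\<And>x x' z z'. (x, x') \<in> D2 \<Longrightarrow> (z, z') \<in> D2 \<Longrightarrow> cinner x' z = cinner x z'"
    and \<gamma>: "\<And>x y. cinner (\<gamma> x) y = cinner x (\<gamma> y)"
    and pq: "(p, q) \<in> tensor_dirac ten D1 \<gamma> D2" "(p', q') \<in> tensor_dirac ten D1 \<gamma> D2"
  shows "cinner q p' = cinner p q'"
proof -
  define G where "G = {(ten x y, ten x' y + ten (\<gamma> x) y') | x x' y y'. (x, x') \<in> D1 \<and> (y, y') \<in> D2}"
  have D: "tensor_dirac ten D1 \<gamma> D2 = closure (span G)" by (simp add: tensor_dirac_def G_def)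
  have cont: "continuous_on UNIV (\<lambda>r. cinner x (fst r))" "continuous_on UNIV (\<lambda>r. cinner x (snd r))"
    "continuous_on UNIV (\<lambda>r. cinner (fst r) x)" "continuous_on UNIV (\<lambda>r. cinner (snd r) x)" for x :: 'c
    by (intro bounded_bilinear.continuous_on[OF bounded_bilinear_cinner] continuous_intros)+
  have gen: "cinner (snd r) (fst s) = cinner (fst r) (snd s)" if "r \<in> G" "s \<in> G" for r s
  proof -
    obtain x x' y y' where r: "r = (ten x y, ten x' y + ten (\<gamma> x) y')" "(x, x') \<in> D1" "(y, y') \<in> D2"
      using \<open>r \<in> G\<close> by (auto simp: G_def)
    obtain z z' w w' where s: "s = (ten z w, ten z' w + ten (\<gamma> z) w')" "(z, z') \<in> D1" "(w, w') \<in> D2"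
      using \<open>s \<in> G\<close> by (auto simp: G_def)
    show ?thesis
      by (simp add: r(1) s(1) cinner_add_left cinner_add_right cinner_ten D1[OF r(2) s(2)] D2[OF r(3) s(3)] \<gamma>)
  qed
  have 1: "closure (span G) \<subseteq> {r. cinner (snd r) (fst s) = cinner (fst r) (snd s)}" if "s \<in> G" for s
  proof (rule closure_span_minimal)
    show "subspace {r. cinner (snd r) (fst s) = cinner (fst r) (snd s)}"
      by (auto simp: subspace_def cinner_add_left cinner_scaleR_left)
    show "closed {r. cinner (snd r) (fst s) = cinner (fst r) (snd s)}"
      by (intro closed_Collect_eq cont)
  qed (use gen that in auto)
  have "closure (span G) \<subseteq> {s. cinner (snd r) (fst s) = cinner (fst r) (snd s)}" if "r \<in> closure (span G)" for r
  proof (rule closure_span_minimal)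
    show "subspace {s. cinner (snd r) (fst s) = cinner (fst r) (snd s)}"
      by (auto simp: subspace_def cinner_add_right cinner_scaleR_right)
    show "closed {s. cinner (snd r) (fst s) = cinner (fst r) (snd s)}"
      by (intro closed_Collect_eq cont)
  qed (use 1 that in auto)
  from this[OF pq(1)[unfolded D]] show ?thesis using pq(2) unfolding D by auto
qed

lemma closure_subspace:
  fixes S :: "'h::real_normed_vector set"
  assumes S: "subspace S"
  shows "subspace (closure S)"
  unfolding subspace_def
proof (intro conjI ballI allI)
  show "0 \<in> closure S" using subspace_0[OF S] closure_subset by blast
  fix x assume "x \<in> closure S"
  then obtain a where a: "\<And>n. a n \<in> S" "a \<longlonglongrightarrow> x" unfolding closure_sequential by blast
  show "c *\<^sub>R x \<in> closure S" for c
    unfolding closure_sequential using a S by (intro exI[of _ "\<lambda>n. c *\<^sub>R a n"]) (auto intro: tendsto_intros subspace_scale)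
  fix y assume "y \<in> closure S"
  then obtain b where "\<And>n. b n \<in> S" "b \<longlonglongrightarrow> y" unfolding closure_sequential by blast
  then show "x + y \<in> closure S"
    unfolding closure_sequential using a S by (intro exI[of _ "\<lambda>n. a n + b n"]) (auto intro: tendsto_intros subspace_add)
qed

text \<open>On the span of \<open>ten (u i) (v j)\<close> and
  \<open>ten (\<gamma> (u i)) (v j)\<close> the operator D acts as the matrix with rows
  \<open>l i\<close>, \<open>k j\<close> and \<open>k j\<close>, \<open>- l i\<close>; the minus
  sign is the anticommutation with \<gamma>. The square of this matrix is the scalar
  \<open>(l i)\<^sup>2 + (k j)\<^sup>2\<close>, so the product vectors are eigenvectors of the
  square of D.\<close>

lemma (in tensor_product) tensor_dirac_abs_spectrum:
  assumes S1: "abs_spectrum I u D1 \<nu>1 \<delta>1" and l: "\<And>i. i \<in> I \<Longrightarrow> (u i, l i *\<^sub>R u i) \<in> D1"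
    and \<nu>1: "\<And>i. i \<in> I \<Longrightarrow> \<nu>1 i = \<bar>l i\<bar>"
    and S2: "abs_spectrum J v D2 \<nu>2 \<delta>2" and k: "\<And>j. j \<in> J \<Longrightarrow> (v j, k j *\<^sub>R v j) \<in> D2"
    and \<nu>2: "\<And>j. j \<in> J \<Longrightarrow> \<nu>2 j = \<bar>k j\<bar>"
    and sa: "selfadjoint D1" "selfadjoint D2"
    and \<gamma>: "bounded_clinear \<gamma>" "\<gamma> \<circ> \<gamma> = id" "cadjoint \<gamma> = \<gamma>" "\<And>x y. (x, y) \<in> D1 \<Longrightarrow> (\<gamma> x, - \<gamma> y) \<in> D1"
  shows "abs_spectrum (I \<times> J) (\<lambda>(i, j). ten (u i) (v j)) (tensor_dirac ten D1 \<gamma> D2)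
    (\<lambda>(i, j). sqrt ((\<nu>1 i)\<^sup>2 + (\<nu>2 j)\<^sup>2)) \<delta>1"
proof -
  let ?D = "tensor_dirac ten D1 \<gamma> D2" and ?\<nu> = "\<lambda>(i, j). sqrt ((\<nu>1 i)\<^sup>2 + (\<nu>2 j)\<^sup>2)"
  interpret S1: abs_spectrum I u D1 \<nu>1 \<delta>1 by (rule S1)
  interpret S2: abs_spectrum J v D2 \<nu>2 \<delta>2 by (rule S2)
  interpret tensor_bases ten I u J v by unfold_locales
  interpret W: onb_family "I \<times> J" "\<lambda>(i, j). ten (u i) (v j)" by (rule onb_family_ten)
  have \<gamma>sym: "cinner (\<gamma> x) y = cinner x (\<gamma> y)" for x y
    using S1.cadjoint_works[OF \<gamma>(1)] \<gamma>(3) by simp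
  have sym: "cinner q p' = cinner p q'" if "(p, q) \<in> ?D" "(p', q') \<in> ?D" for p q p' q'
    by (rule tensor_dirac_symmetric[OF selfadjoint_symmetric[OF sa(1)] selfadjoint_symmetric[OF sa(2)] \<gamma>sym that])
  have sub: "subspace ?D"
    unfolding tensor_dirac_def by (intro closure_subspace subspace_span)
  have gen: "(ten x y, ten x' y + ten (\<gamma> x) y') \<in> ?D" if "(x, x') \<in> D1" "(y, y') \<in> D2" for x x' y y'
    unfolding tensor_dirac_def using that by (intro subsetD[OF closure_subset] span_base) blast
  \<comment> \<open>\<open>w\<close> is the image of the product vector under D, and the second pair
    applies D once more.\<close>
  have ex: "\<exists>w. (ten (u i) (v j), w) \<in> ?D \<and> (w, (?\<nu> (i, j))\<^sup>2 *\<^sub>R ten (u i) (v j)) \<in> ?D"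
    if ij: "i \<in> I" "j \<in> J" for i j
  proof -
    let ?a = "ten (u i) (v j)" and ?b = "ten (\<gamma> (u i)) (v j)"
    define w where "w = l i *\<^sub>R ?a + k j *\<^sub>R ?b"
    have a: "(?a, w) \<in> ?D"
      using gen[OF l[OF ij(1)] k[OF ij(2)]] by (simp add: w_def ten_scaleR_left ten_scaleR_right)
    have "\<gamma> (\<gamma> x) = x" for x using \<gamma>(2) by (metis comp_apply id_apply)
    then have b: "(?b, k j *\<^sub>R ?a - l i *\<^sub>R ?b) \<in> ?D"
      using gen[OF \<gamma>(4)[OF l[OF ij(1)]] k[OF ij(2)]]
      by (simp add: ten_scaleR_left ten_scaleR_right bounded_clinearD[OF \<gamma>(1)]
          bounded_bilinear.minus_left[OF bounded_bilinear_ten])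
    have "l i *\<^sub>R (?a, w) + k j *\<^sub>R (?b, k j *\<^sub>R ?a - l i *\<^sub>R ?b) \<in> ?D"
      by (intro subspace_add[OF sub] subspace_scale[OF sub] a b)
    also have "l i *\<^sub>R (?a, w) + k j *\<^sub>R (?b, k j *\<^sub>R ?a - l i *\<^sub>R ?b) = (w, (?\<nu> (i, j))\<^sup>2 *\<^sub>R ?a)"
      using ij by (simp add: w_def \<nu>1 \<nu>2 algebra_simps power2_eq_square)
    finally show ?thesis using a by blast
  qed
  show ?thesis
  proof
    fix y assume orth: "\<And>m e. (e, m *\<^sub>R e) \<in> ?D \<Longrightarrow> cinner e y = 0"
    show "y = 0"
    proof (rule W.total)
      fix p assume "p \<in> I \<times> J"
      then obtain i j where p: "p = (i, j)" and ij: "i \<in> I" "j \<in> J" by blast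
      define a n where "a = ten (u i) (v j)" and "n = ?\<nu> (i, j)"
      obtain w where w: "(a, w) \<in> ?D" "(w, n\<^sup>2 *\<^sub>R a) \<in> ?D" using ex[OF ij] unfolding a_def n_def by blast
      \<comment> \<open>If D maps \<open>a\<close> to \<open>w\<close> and \<open>w\<close> to
        \<open>n\<^sup>2 *\<^sub>R a\<close>, then \<open>w + n *\<^sub>R a\<close> and
        \<open>w - n *\<^sub>R a\<close> are zero or eigenvectors for \<open>n\<close> and
        \<open>- n\<close>. Their difference is a non-zero multiple of \<open>a\<close>, so a vector
        orthogonal to both is orthogonal to \<open>a\<close>.\<close>
      have mem: "(w, n\<^sup>2 *\<^sub>R a) + r *\<^sub>R (a, w) \<in> ?D" for r
        by (intro subspace_add[OF sub] subspace_scale[OF sub] w)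
      have "(w, n\<^sup>2 *\<^sub>R a) + n *\<^sub>R (a, w) = (w + n *\<^sub>R a, n *\<^sub>R (w + n *\<^sub>R a))"
        "(w, n\<^sup>2 *\<^sub>R a) + (- n) *\<^sub>R (a, w) = (w - n *\<^sub>R a, (- n) *\<^sub>R (w - n *\<^sub>R a))"
        by (simp_all add: algebra_simps power2_eq_square)
      then have "(w + n *\<^sub>R a, n *\<^sub>R (w + n *\<^sub>R a)) \<in> ?D" "(w - n *\<^sub>R a, (- n) *\<^sub>R (w - n *\<^sub>R a)) \<in> ?D"
        using mem[of n] mem[of "- n"] by metis+
      from orth[OF this(1)] orth[OF this(2)]
      have "n *\<^sub>R cinner a y = 0"
        by (simp add: cinner_add_left cinner_diff_left cinner_scaleR_left)
      moreover have "n \<noteq> 0"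
        using S1.\<nu>_pos[OF ij(1)] by (simp add: n_def sum_power2_eq_zero_iff)
      ultimately show "cinner (case p of (i, j) \<Rightarrow> ten (u i) (v j)) y = 0"
        by (simp add: p a_def)
    qed
  next
    fix e m p assume e: "(e, m *\<^sub>R e) \<in> ?D" "p \<in> I \<times> J" "cinner e (case p of (i, j) \<Rightarrow> ten (u i) (v j)) \<noteq> 0"
    obtain i j where p: "p = (i, j)" "i \<in> I" "j \<in> J" using e(2) by blast
    let ?a = "ten (u i) (v j)" and ?n = "?\<nu> (i, j)"
    obtain w where w: "(?a, w) \<in> ?D" "(w, ?n\<^sup>2 *\<^sub>R ?a) \<in> ?D" using ex[OF p(2,3)] by blast
    \<comment> \<open>Moving D twice across the inner product compares \<open>m\<^sup>2\<close> with
      the eigenvalue of \<open>?a\<close> under the square of D.\<close>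
    have "m *\<^sub>R m *\<^sub>R cinner e ?a = ?n\<^sup>2 *\<^sub>R cinner e ?a"
      using sym[OF e(1) w(1)] sym[OF e(1) w(2)] by (simp add: cinner_scaleR_left cinner_scaleR_right)
    then have "m\<^sup>2 = ?n\<^sup>2" using e(3) by (simp add: p(1) power2_eq_square)
    then have "\<bar>m\<bar> = \<bar>?n\<bar>" by (simp only: abs_eq_iff power2_eq_iff)
    then show "\<bar>m\<bar> = ?\<nu> p" by (simp add: p(1))
  next
    show "0 < \<delta>1" by (rule S1.\<delta>_pos)
    fix p assume "p \<in> I \<times> J"
    then obtain i j where p: "p = (i, j)" "i \<in> I" by blast
    have "\<delta>1 \<le> \<nu>1 i" using p S1.\<nu>_ge by blast
    also have "\<dots> \<le> sqrt ((\<nu>1 i)\<^sup>2 + (\<nu>2 j)\<^sup>2)" by (rule real_sqrt_sum_squares_ge1)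
    finally show "\<delta>1 \<le> ?\<nu> p" by (simp add: p)
  qed
qed

section \<open>Mellin transforms of heat traces\<close>

definition mellin_kernel :: "real \<Rightarrow> real \<Rightarrow> real" where
  "mellin_kernel z x = exp (- z * x - exp (- x))"

text \<open>\<open>\<Gamma>(z)\<close> after the substitution \<open>t = e\<^sup>-\<^sup>x\<close>; in ratios of zeta functions it cancels.\<close>

definition mellin_const :: "real \<Rightarrow> real" where
  "mellin_const z = (\<integral>x. mellin_kernel z x \<partial>lborel)"

lemma integrable_exp_Ici:
  assumes "0 < (z::real)"
  shows "integrable lborel (\<lambda>x. indicator {0..} x * exp (- z * x))"
proof -
  have "(\<lambda>x. exp (- z * x)) absolutely_integrable_on {0..}"
    using has_integral_exp_minus_to_infinity[OF assms, of 0]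
    by (intro nonnegative_absolutely_integrable_1) (auto simp: integrable_on_def)
  then have "integrable lebesgue (\<lambda>x. indicator {0..} x * exp (- z * x))"
    by (simp add: set_integrable_def)
  then show ?thesis
    by (subst (asm) integrable_completion) auto
qed

lemma integrable_mellin_kernel:
  assumes z: "0 < z"
  shows "integrable lborel (mellin_kernel z)"
proof -
  \<comment> \<open>\<open>exp\<close> has slope \<open>2 * z\<close> at \<open>a\<close>. Its
    tangent line there shows that, for negative \<open>x\<close>, \<open>exp (- x)\<close> outweighs
    the growth of \<open>- z * x\<close> and leaves the decay \<open>exp (z * x)\<close> up to the
    factor \<open>C\<close>.\<close>
  define a where "a = ln (2 * z)"
  define C where "C = exp \<bar>2 * z * (a - 1)\<bar>"
  define h where "h x = indicator {0..} x * exp (- z * x)" for x :: real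
  have h: "integrable lborel h" unfolding h_def by (rule integrable_exp_Ici[OF z])
  have "integrable lborel (\<lambda>x. h (0 + (- 1) * x))"
    using h by (intro lborel_integrable_real_affine) auto
  then have hm: "integrable lborel (\<lambda>x. h (- x))" by simp
  show ?thesis
  proof (rule Bochner_Integration.integrable_bound)
    show "integrable lborel (\<lambda>x. C * (h x + h (- x)))" using h hm by simp
    show "mellin_kernel z \<in> borel_measurable lborel"
      unfolding mellin_kernel_def by measurable
    show "AE x in lborel. norm (mellin_kernel z x) \<le> norm (C * (h x + h (- x)))"
    proof (rule AE_I2)
      fix x :: real
      have C1: "1 \<le> C" by (simp add: C_def)
      have "mellin_kernel z x \<le> C * (h x + h (- x))"
      proof (cases "0 \<le> x")
        case True
        then have "mellin_kernel z x \<le> exp (- z * x)" by (simp add: mellin_kernel_def)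
        also have "\<dots> \<le> h x + h (- x)" using True by (simp add: h_def)
        also have "\<dots> \<le> C * (h x + h (- x))"
          using C1 mult_right_mono[of 1 C "h x + h (- x)"] by (simp add: h_def)
        finally show ?thesis .
      next
        case False
        have "2 * z * (1 + (- x - a)) \<le> 2 * z * exp (- x - a)"
          using z by (intro mult_left_mono exp_ge_add_one_self) auto
        also have "\<dots> = exp (- x)" using z by (simp add: a_def exp_diff)
        finally have "- z * x - exp (- x) \<le> 2 * z * (a - 1) + z * x" by (simp add: algebra_simps)
        then have "mellin_kernel z x \<le> exp (\<bar>2 * z * (a - 1)\<bar> + z * x)"
          unfolding mellin_kernel_def exp_le_cancel_iff by linarith
        also have "\<dots> = C * h (- x)" using False by (simp add: C_def h_def exp_add)
        finally show ?thesis using False by (simp add: h_def)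
      qed
      then show "norm (mellin_kernel z x) \<le> norm (C * (h x + h (- x)))"
        by (simp add: mellin_kernel_def)
    qed
  qed
qed

lemma mellin_const_pos:
  assumes "0 < z"
  shows "0 < mellin_const z"
proof -
  have "mellin_const z \<noteq> 0"
  proof
    assume "mellin_const z = 0"
    then have "AE x in lborel. mellin_kernel z x = 0"
      unfolding mellin_const_def
      by (subst (asm) integral_nonneg_eq_0_iff_AE) (auto simp: integrable_mellin_kernel assms mellin_kernel_def)
    then have "AE x in (lborel :: real measure). False" by (simp add: mellin_kernel_def)
    then show False by (simp add: eventually_False ae_filter_eq_bot_iff)
  qed
  moreover have "0 \<le> mellin_const z"
    unfolding mellin_const_def by (rule Bochner_Integration.integral_nonneg) (simp add: mellin_kernel_def)
  ultimately show ?thesis by simp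
qed

text \<open>Replacing \<open>t\<close> by \<open>t / m\<^sup>2\<close> in the Gamma integral is, in
  the variable \<open>x\<close>, a translation by \<open>2 * ln m\<close>.\<close>

lemma mellin_scaled:
  assumes m: "0 < m" and z: "0 < z"
  shows "has_bochner_integral lborel (\<lambda>x. exp (- z * x - m\<^sup>2 * exp (- x))) (m powr (- 2 * z) * mellin_const z)"
proof -
  have eq: "exp (- z * (2 * ln m + 1 * y) - m\<^sup>2 * exp (- (2 * ln m + 1 * y))) = m powr (- 2 * z) * mellin_kernel z y" for y
  proof -
    have "exp (2 * ln m) = m\<^sup>2" using m by (simp only: exp_double exp_ln)
    moreover have "exp (- (2 * ln m + y)) = exp (- y) / exp (2 * ln m)"
      by (simp flip: exp_diff)
    ultimately have "m\<^sup>2 * exp (- (2 * ln m + y)) = exp (- y)"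
      using m by simp
    then show ?thesis
      using m by (simp add: mellin_kernel_def powr_def exp_add[symmetric] algebra_simps)
  qed
  have "has_bochner_integral lborel (\<lambda>y. m powr (- 2 * z) * mellin_kernel z y) (m powr (- 2 * z) * mellin_const z)"
    unfolding mellin_const_def
    by (intro has_bochner_integral_mult_right has_bochner_integral_integrable integrable_mellin_kernel z)
  then show ?thesis
    by (subst lborel_has_bochner_integral_real_affine_iff[where c = 1 and t = "2 * ln m"])
      (simp_all only: eq abs_one div_by_1 scaleR_one, simp_all)
qed

text \<open>In the variable \<open>x = - log t\<close>, \<open>heat_sum\<close> is the heat trace of an operator whose absolute value
  has the eigenvalues \<open>m k\<close>, twisted by the weights \<open>c\<close>.\<close>

locale heat_data =
  fixes K :: "'k set" and m :: "'k \<Rightarrow> real" and \<delta> :: real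
  assumes \<delta>_pos: "0 < \<delta>" and m_ge: "k \<in> K \<Longrightarrow> \<delta> \<le> m k"
    and heat_summable: "0 < t \<Longrightarrow> (\<lambda>k. exp (- t * (m k)\<^sup>2)) summable_on K"
begin

lemma m_pos: "k \<in> K \<Longrightarrow> 0 < m k"
  using \<delta>_pos m_ge by force

definition heat_sum :: "('k \<Rightarrow> 'e::{banach, second_countable_topology}) \<Rightarrow> real \<Rightarrow> 'e" where
  "heat_sum c x = (\<Sum>\<^sub>\<infinity>k\<in>K. exp (- exp (- x) * (m k)\<^sup>2) *\<^sub>R c k)"

text \<open>The zeta function at \<open>s = 2 * z\<close>; the halved variable is the exponent that
  occurs in the Mellin transform in \<open>t\<close>.\<close>

definition zeta_sum :: "('k \<Rightarrow> 'e::{banach, second_countable_topology}) \<Rightarrow> real \<Rightarrow> 'e" where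
  "zeta_sum c z = (\<Sum>\<^sub>\<infinity>k\<in>K. m k powr (- 2 * z) *\<^sub>R c k)"

text \<open>Makes \<open>count_space K\<close> sigma-finite, so that Fubini's theorem applies to
  sums against integrals.\<close>

lemma countable_K: "countable K"
  using abs_summable_countable[of "\<lambda>k. exp (- 1 * (m k)\<^sup>2)" K] heat_summable[of 1] by simp

lemma abs_summable_weighted:
  fixes c :: "'k \<Rightarrow> 'e::{banach, second_countable_topology}"
  assumes "w summable_on K" "\<And>k. k \<in> K \<Longrightarrow> 0 \<le> w k" "\<And>k. k \<in> K \<Longrightarrow> norm (c k) \<le> B"
  shows "(\<lambda>k. norm (w k *\<^sub>R c k)) summable_on K"
proof (rule summable_on_comparison_test)
  show "(\<lambda>k. w k * B) summable_on K" by (intro summable_on_cmult_left assms)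
  show "norm (w k *\<^sub>R c k) \<le> w k * B" if "k \<in> K" for k
    using assms(2,3)[OF that] by (simp add: mult_left_mono)
qed simp

lemma norm_heat_sum_le:
  fixes c :: "'k \<Rightarrow> 'e::{banach, second_countable_topology}"
  assumes "\<And>k. k \<in> K \<Longrightarrow> norm (c k) \<le> B"
  shows "norm (heat_sum c x) \<le> B * heat_sum (\<lambda>k. 1) x"
proof -
  have s: "(\<lambda>k. exp (- exp (- x) * (m k)\<^sup>2)) summable_on K" by (rule heat_summable) simp
  have "norm (heat_sum c x) \<le> (\<Sum>\<^sub>\<infinity>k\<in>K. norm (exp (- exp (- x) * (m k)\<^sup>2) *\<^sub>R c k))"
    unfolding heat_sum_def by (rule norm_infsum_bound) (rule abs_summable_weighted[OF s _ assms], auto)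
  also have "\<dots> \<le> (\<Sum>\<^sub>\<infinity>k\<in>K. B * exp (- exp (- x) * (m k)\<^sup>2))"
    by (intro infsum_mono abs_summable_weighted[OF s _ assms] summable_on_cmult_right s)
      (use assms in \<open>auto simp: mult.commute intro!: mult_right_mono\<close>)
  also have "\<dots> = B * heat_sum (\<lambda>k. 1) x"
    unfolding heat_sum_def by (subst infsum_cmult_right) (use s in auto)
  finally show ?thesis .
qed

lemma heat_sum_one_nonneg: "0 \<le> heat_sum (\<lambda>k. 1::real) x"
  unfolding heat_sum_def by (rule infsum_nonneg) simp

lemma heat_sum_one_mono:
  assumes "x \<le> y"
  shows "heat_sum (\<lambda>k. 1::real) x \<le> heat_sum (\<lambda>k. 1) y"
proof -
  have s: "(\<lambda>k. exp (- exp (- x) * (m k)\<^sup>2) *\<^sub>R (1::real)) summable_on K" for x :: real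
    using heat_summable[of "exp (- x)"] by simp
  show ?thesis
    unfolding heat_sum_def using assms by (intro infsum_mono s) (simp add: mult_right_mono)
qed

text \<open>Each term contributes \<open>mellin_scaled\<close>. Sum and integral are exchanged by
  Fubini's theorem; absolute integrability comes from the summable zeta series and the bounded
  weights.\<close>

lemma heat_sum_mellin:
  fixes c :: "'k \<Rightarrow> 'e::{banach, second_countable_topology}"
  assumes z: "0 < z" and sum: "(\<lambda>k. m k powr (- 2 * z)) summable_on K"
    and c: "\<And>k. k \<in> K \<Longrightarrow> norm (c k) \<le> B"
  shows "has_bochner_integral lborel (\<lambda>x. exp (- z * x) *\<^sub>R heat_sum c x) (mellin_const z *\<^sub>R zeta_sum c z)"
proof -
  define f where "f p = exp (- z * snd p - (m (fst p))\<^sup>2 * exp (- snd p)) *\<^sub>R c (fst p)" for p :: "'k \<times> real"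
  interpret P: pair_sigma_finite "count_space K" "lborel :: real measure"
    by (intro pair_sigma_finite.intro sigma_finite_measure_count_space_countable countable_K sigma_finite_lborel)
  have meas: "f \<in> borel_measurable (count_space K \<Otimes>\<^sub>M lborel)"
  proof (rule measurable_pair_measure_countable1[OF countable_K])
    show "(\<lambda>y. f (x, y)) \<in> borel_measurable lborel" for x
      by (simp add: f_def)
  qed
  have hk: "has_bochner_integral lborel (\<lambda>x. f (k, x)) ((m k powr (- 2 * z) * mellin_const z) *\<^sub>R c k)"
    "has_bochner_integral lborel (\<lambda>x. norm (f (k, x))) ((m k powr (- 2 * z) * mellin_const z) * norm (c k))"
    if "k \<in> K" for k
    using has_bochner_integral_scaleR_left[OF mellin_scaled[OF m_pos[OF that] z], of "c k"]
      has_bochner_integral_mult_left[OF mellin_scaled[OF m_pos[OF that] z], of "norm (c k)"]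
    by (auto simp: f_def)
  have abs: "(\<lambda>k. norm (m k powr (- 2 * z) *\<^sub>R c k)) summable_on K"
    by (rule abs_summable_weighted[OF sum _ c]) auto
  have int: "integrable (count_space K \<Otimes>\<^sub>M lborel) f"
  proof (rule P.Fubini_integrable[OF meas])
    have "(\<lambda>k. norm ((m k powr (- 2 * z) * mellin_const z) * norm (c k))) summable_on K"
      using summable_on_cmult_right[OF abs, of "mellin_const z"] mellin_const_pos[OF z]
      by (simp add: abs_mult mult_ac)
    then have "integrable (count_space K) (\<lambda>k. (m k powr (- 2 * z) * mellin_const z) * norm (c k))"
      unfolding abs_summable_equivalent abs_summable_on_def .
    moreover have "integrable (count_space K) (\<lambda>k. \<integral>y. norm (f (k, y)) \<partial>lborel) \<longleftrightarrow>
        integrable (count_space K) (\<lambda>k. (m k powr (- 2 * z) * mellin_const z) * norm (c k))"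
      by (rule Bochner_Integration.integrable_cong[OF refl])
        (intro has_bochner_integral_integral_eq hk(2), simp)
    ultimately show "integrable (count_space K) (\<lambda>k. \<integral>y. norm (f (k, y)) \<partial>lborel)"
      by simp
    show "AE k in count_space K. integrable lborel (\<lambda>y. f (k, y))"
      using hk(1) by (auto simp: AE_count_space has_bochner_integral_iff)
  qed
  \<comment> \<open>Integrals over \<open>count_space K\<close> are \<open>infsetsum\<close>;
    absolute summability identifies them with \<open>infsum\<close>.\<close>
  have inner: "(\<integral>k. f (k, x) \<partial>count_space K) = exp (- z * x) *\<^sub>R heat_sum c x" for x
  proof -
    have s: "(\<lambda>k. exp (- exp (- x) * (m k)\<^sup>2)) summable_on K" by (rule heat_summable) simp
    have a: "(\<lambda>k. norm (exp (- exp (- x) * (m k)\<^sup>2) *\<^sub>R c k)) summable_on K"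
      by (rule abs_summable_weighted[OF s _ c]) auto
    have "(\<lambda>k. norm (exp (- z * x) *\<^sub>R exp (- exp (- x) * (m k)\<^sup>2) *\<^sub>R c k)) summable_on K"
      using summable_on_cmult_right[OF a, of "exp (- z * x)"] by (simp add: mult.assoc)
    then have "infsetsum (\<lambda>k. exp (- z * x) *\<^sub>R exp (- exp (- x) * (m k)\<^sup>2) *\<^sub>R c k) K =
        (\<Sum>\<^sub>\<infinity>k\<in>K. exp (- z * x) *\<^sub>R exp (- exp (- x) * (m k)\<^sup>2) *\<^sub>R c k)"
      by (rule infsetsum_infsum[OF abs_summable_equivalent[THEN iffD1]])
    also have "\<dots> = exp (- z * x) *\<^sub>R heat_sum c x"
      unfolding heat_sum_def by (rule infsum_scaleR_right)
    also have "infsetsum (\<lambda>k. exp (- z * x) *\<^sub>R exp (- exp (- x) * (m k)\<^sup>2) *\<^sub>R c k) K = (\<integral>k. f (k, x) \<partial>count_space K)"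
      unfolding infsetsum_def f_def by (simp add: exp_diff exp_minus divide_inverse mult.commute)
    finally show ?thesis .
  qed
  interpret Q: pair_sigma_finite "lborel :: real measure" "count_space K"
    by (intro pair_sigma_finite.intro sigma_finite_measure_count_space_countable countable_K sigma_finite_lborel)
  have "integrable lborel (\<lambda>x. \<integral>k. f (k, x) \<partial>count_space K)"
    using Q.integrable_fst'[OF P.integrable_product_swap[OF int]] by simp
  moreover have "(\<integral>x. (\<integral>k. f (k, x) \<partial>count_space K) \<partial>lborel) = (\<integral>k. (\<integral>x. f (k, x) \<partial>lborel) \<partial>count_space K)"
    using P.Fubini_integral[of "\<lambda>k x. f (k, x)"] int by simp
  moreover have "(\<integral>k. (\<integral>x. f (k, x) \<partial>lborel) \<partial>count_space K) = mellin_const z *\<^sub>R zeta_sum c z"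
  proof -
    have "(\<integral>k. (\<integral>x. f (k, x) \<partial>lborel) \<partial>count_space K) =
        infsetsum (\<lambda>k. mellin_const z *\<^sub>R m k powr (- 2 * z) *\<^sub>R c k) K"
      unfolding infsetsum_def
      by (intro Bochner_Integration.integral_cong) (auto simp: has_bochner_integral_integral_eq[OF hk(1)] mult.commute)
    also have "\<dots> = (\<Sum>\<^sub>\<infinity>k\<in>K. mellin_const z *\<^sub>R m k powr (- 2 * z) *\<^sub>R c k)"
    proof (rule infsetsum_infsum[OF abs_summable_equivalent[THEN iffD1]])
      show "(\<lambda>k. norm (mellin_const z *\<^sub>R m k powr (- 2 * z) *\<^sub>R c k)) summable_on K"
        using summable_on_cmult_right[OF abs, of "\<bar>mellin_const z\<bar>"] by (simp add: mult.assoc abs_mult)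
    qed
    also have "\<dots> = mellin_const z *\<^sub>R zeta_sum c z"
      unfolding zeta_sum_def by (rule infsum_scaleR_right)
    finally show ?thesis .
  qed
  ultimately show ?thesis by (simp add: has_bochner_integral_iff inner)
qed

end

section \<open>Behaviour at the abscissa of convergence\<close>

context heat_data
begin

text \<open>Summability is what \<open>heat_sum_mellin\<close> presupposes, so here only finite
  partial sums are integrated. Their integrands all stay below one integrable function
  \<open>b\<close>, whatever the finite set.\<close>

lemma zeta_summable:
  assumes p: "0 < p" "p < z" and upper: "\<And>x. 0 \<le> x \<Longrightarrow> heat_sum (\<lambda>k. 1) x \<le> C * exp (p * x)"
  shows "(\<lambda>k. m k powr (- 2 * z)) summable_on K"
proof (rule nonneg_bdd_above_summable_on)
  \<comment> \<open>The first summand is a majorant for \<open>x \<ge> 0\<close>, where the growth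
    bound leaves decay at rate \<open>z - p\<close>; the second one for \<open>x < 0\<close>, where
    the spectral gap \<open>\<delta>\<close> gives decay.\<close>
  define b where "b x = C * (indicator {0..} x * exp (- (z - p) * x))
      + heat_sum (\<lambda>k. 1) 0 * exp (\<delta>\<^sup>2) * exp (- z * x - \<delta>\<^sup>2 * exp (- x))" for x :: real
  have z: "0 < z" using p by simp
  have C: "0 \<le> C" using upper[of 0] heat_sum_one_nonneg[of 0] by simp
  have b: "integrable lborel b"
    unfolding b_def using p mellin_scaled[OF \<delta>_pos z]
    by (intro Bochner_Integration.integrable_add integrable_mult_right integrable_exp_Ici)
      (simp_all add: has_bochner_integral_iff)
  have "(\<Sum>k\<in>F. m k powr (- 2 * z)) \<le> (\<integral>x. b x \<partial>lborel) / mellin_const z" if F: "finite F" "F \<subseteq> K" for F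
  proof -
    let ?g = "\<lambda>x. \<Sum>k\<in>F. exp (- z * x - (m k)\<^sup>2 * exp (- x))"
    have g: "has_bochner_integral lborel ?g (\<Sum>k\<in>F. m k powr (- 2 * z) * mellin_const z)"
      using F m_pos z by (intro has_bochner_integral_sum mellin_scaled) auto
    have le: "?g x \<le> b x" for x
    proof -
      have fin: "(\<Sum>k\<in>F. exp (- exp (- x) * (m k)\<^sup>2)) \<le> heat_sum (\<lambda>k. 1) x" for x
        using heat_summable[of "exp (- x)"] F
        by (auto simp: heat_sum_def intro!: finite_sum_le_infsum)
      have gx: "?g x = exp (- z * x) * (\<Sum>k\<in>F. exp (- exp (- x) * (m k)\<^sup>2))"
        by (simp add: sum_distrib_left exp_diff exp_minus divide_inverse mult.commute)
      show ?thesis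
      proof (cases "0 \<le> x")
        case True
        have "?g x \<le> exp (- z * x) * (C * exp (p * x))"
          unfolding gx using fin[of x] upper[OF True] by (intro mult_left_mono) auto
        also have "\<dots> = C * exp (- (z - p) * x)"
          by (simp add: exp_add[symmetric] algebra_simps)
        finally show ?thesis
          using True heat_sum_one_nonneg[of 0] by (simp add: b_def add_increasing2)
      next
        case False
        \<comment> \<open>With \<open>t = exp (- x) > 1\<close>, one unit of time is spent on the
          trace at \<open>x = 0\<close> and the remaining \<open>t - 1\<close> is estimated by the
          gap.\<close>
        have "exp (- exp (- x) * (m k)\<^sup>2) \<le> exp (- (m k)\<^sup>2) * exp (\<delta>\<^sup>2 - \<delta>\<^sup>2 * exp (- x))" if "k \<in> F" for k
        proof -
          have "\<delta>\<^sup>2 \<le> (m k)\<^sup>2" using that F m_ge \<delta>_pos by (intro power_mono) auto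
          then have "0 \<le> ((m k)\<^sup>2 - \<delta>\<^sup>2) * (exp (- x) - 1)" using False by (intro mult_nonneg_nonneg) auto
          then show ?thesis by (simp add: exp_add[symmetric] algebra_simps)
        qed
        then have "(\<Sum>k\<in>F. exp (- exp (- x) * (m k)\<^sup>2)) \<le> (\<Sum>k\<in>F. exp (- (m k)\<^sup>2)) * exp (\<delta>\<^sup>2 - \<delta>\<^sup>2 * exp (- x))"
          unfolding sum_distrib_right by (rule sum_mono)
        also have "\<dots> \<le> heat_sum (\<lambda>k. 1) 0 * exp (\<delta>\<^sup>2 - \<delta>\<^sup>2 * exp (- x))"
          using fin[of 0] by (intro mult_right_mono) auto
        finally have "?g x \<le> exp (- z * x) * (heat_sum (\<lambda>k. 1) 0 * exp (\<delta>\<^sup>2 - \<delta>\<^sup>2 * exp (- x)))"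
          unfolding gx by (intro mult_left_mono) auto
        also have "exp (- z * x) * (heat_sum (\<lambda>k. 1) 0 * exp (\<delta>\<^sup>2 - \<delta>\<^sup>2 * exp (- x))) =
            heat_sum (\<lambda>k. 1) 0 * (exp (- z * x) * exp (\<delta>\<^sup>2 - \<delta>\<^sup>2 * exp (- x)))"
          by (rule mult.left_commute)
        also have "exp (- z * x) * exp (\<delta>\<^sup>2 - \<delta>\<^sup>2 * exp (- x)) =
            exp (\<delta>\<^sup>2) * exp (- z * x - \<delta>\<^sup>2 * exp (- x))"
          by (simp flip: exp_add)
        also have "heat_sum (\<lambda>k. 1) 0 * \<dots> = b x" using False by (simp add: b_def)
        finally show ?thesis .
      qed
    qed
    have "(\<Sum>k\<in>F. m k powr (- 2 * z)) * mellin_const z = (\<integral>x. ?g x \<partial>lborel)"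
      using has_bochner_integral_integral_eq[OF g] by (simp add: sum_distrib_right)
    also have "\<dots> \<le> (\<integral>x. b x \<partial>lborel)"
      using g b le by (intro Bochner_Integration.integral_mono) (auto simp: has_bochner_integral_iff)
    finally show ?thesis using mellin_const_pos[OF z] by (simp add: field_simps)
  qed
  then show "bdd_above (sum (\<lambda>k. m k powr (- 2 * z)) ` {F. F \<subseteq> K \<and> finite F})"
    by (auto intro!: bdd_aboveI2)
qed simp

lemma heat_sum_mellin_one:
  assumes "0 < z" "(\<lambda>k. m k powr (- 2 * z)) summable_on K"
  shows "has_bochner_integral lborel (\<lambda>x. exp (- z * x) * heat_sum (\<lambda>k. 1) x)
    (mellin_const z * zeta_sum (\<lambda>k. 1) z)"
  using heat_sum_mellin[OF assms, of "\<lambda>k. 1::real" 1] by simp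

text \<open>Since \<open>\<epsilon> \<L>[f](\<epsilon>)\<close> has a non-zero limit, \<open>\<L>[f](\<epsilon>)\<close> and hence the Mellin transform of the
  heat trace blow up at the exponent \<open>p\<close>.\<close>

lemma mellin_zeta_at_top:
  fixes f :: "real \<Rightarrow> real"
  assumes p: "0 < p" and upper: "\<And>x. 0 \<le> x \<Longrightarrow> heat_sum (\<lambda>k. 1) x \<le> C * exp (p * x)"
    and f: "\<And>x. 0 \<le> x \<Longrightarrow> \<bar>f x\<bar> \<le> B" and X: "0 \<le> X" and c: "0 < c"
    and lower: "\<And>x. X \<le> x \<Longrightarrow> 0 \<le> f x \<and> c * f x * exp (p * x) \<le> heat_sum (\<lambda>k. 1) x"
    and lim: "((\<lambda>s. s * laplace f s) \<longlongrightarrow> L) (at_right 0)" "L \<noteq> 0"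
  shows "filterlim (\<lambda>z. mellin_const z * zeta_sum (\<lambda>k. 1) z) at_top (at_right p)"
proof -
  have B: "0 \<le> B" using f[of 0] by linarith
  \<comment> \<open>On \<open>{0..X}\<close> the bound \<open>B\<close> for \<open>f\<close> is
    used; beyond \<open>X\<close>, \<open>lower\<close> dominates \<open>f\<close> by the heat
    trace. The growth \<open>exp (p * x)\<close> shifts the Laplace variable to
    \<open>z - p\<close>.\<close>
  have le: "\<bar>laplace f (z - p)\<bar> \<le> B * X + (mellin_const z * zeta_sum (\<lambda>k. 1) z) / c" if z: "p < z" for z
  proof -
    have hb: "has_bochner_integral lborel (\<lambda>x. exp (- z * x) * heat_sum (\<lambda>k. 1) x) (mellin_const z * zeta_sum (\<lambda>k. 1) z)"
      using p z by (intro heat_sum_mellin_one zeta_summable[OF p z upper]) auto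
    define h where "h x = B * indicator {0..X} x + (exp (- z * x) * heat_sum (\<lambda>k. 1) x) / c" for x
    have h: "has_bochner_integral lborel h (B * X + (mellin_const z * zeta_sum (\<lambda>k. 1) z) / c)"
      unfolding h_def using X
      by (intro has_bochner_integral_add has_bochner_integral_divide_zero hb has_bochner_integral_mult_right)
        (auto simp: has_bochner_integral_iff)
    have hn: "0 \<le> h x" for x
      unfolding h_def using B c heat_sum_one_nonneg by (intro add_nonneg_nonneg divide_nonneg_pos mult_nonneg_nonneg) auto
    have hl: "has_bochner_integral lebesgue h (B * X + (mellin_const z * zeta_sum (\<lambda>k. 1) z) / c)"
      using h by (auto simp: has_bochner_integral_iff integrable_completion integral_completion)
    let ?F = "\<lambda>x. indicator {0..} x *\<^sub>R (exp (- (z - p) * x) *\<^sub>R f x)"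
    have bound: "norm (?F x) \<le> h x" for x
    proof (cases "0 \<le> x")
      case False then show ?thesis using hn by simp
    next
      case True
      show ?thesis
      proof (cases "X \<le> x")
        case False
        have "norm (?F x) = exp (- (z - p) * x) * \<bar>f x\<bar>" using True by (simp add: abs_mult)
        also have "\<dots> \<le> 1 * B" using True z f by (intro mult_mono) (auto intro: mult_nonpos_nonneg)
        also have "\<dots> \<le> h x"
          unfolding h_def using True False c heat_sum_one_nonneg[of x] by simp
        finally show ?thesis .
      next
        case X: True
        have "c * (exp (- (z - p) * x) * f x) = exp (- z * x) * (c * f x * exp (p * x))"
          by (simp add: exp_add[symmetric] algebra_simps)
        also have "\<dots> \<le> exp (- z * x) * heat_sum (\<lambda>k. 1) x"
          using lower[OF X] by (intro mult_left_mono) auto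
        finally have "exp (- (z - p) * x) * f x \<le> exp (- z * x) * heat_sum (\<lambda>k. 1) x / c"
          using c by (simp add: field_simps)
        then show ?thesis using lower[OF X] True B by (simp add: h_def add_increasing)
      qed
    qed
    have "norm (\<integral>x. ?F x \<partial>lebesgue) \<le> (\<integral>x. h x \<partial>lebesgue)"
    proof (cases "integrable lebesgue ?F")
      case True
      then show ?thesis
        using hl bound by (intro Bochner_Integration.integral_norm_bound_integral) (auto simp: has_bochner_integral_iff)
    next
      \<comment> \<open>The Bochner integral of a function that is not integrable is 0 by
        convention, so the bound holds here too.\<close>
      case False
      then show ?thesis
        using hn by (simp add: not_integrable_integral_eq Bochner_Integration.integral_nonneg)
    qed
    then show ?thesis
      using hl by (simp add: laplace_def set_lebesgue_integral_def has_bochner_integral_iff)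
  qed
  have shift: "filterlim (\<lambda>z. z - p) (at_right 0) (at_right p)"
    by (simp add: filterlim_at_right_to_0[of _ _ p] filterlim_ident)
  have "((\<lambda>z. \<bar>(z - p) * laplace f (z - p)\<bar>) \<longlongrightarrow> \<bar>L\<bar>) (at_right p)"
    by (intro tendsto_rabs filterlim_compose[OF lim(1) shift])
  moreover have "filterlim (\<lambda>z. inverse (z - p)) at_top (at_right p)"
    by (rule filterlim_compose[OF filterlim_inverse_at_top_right shift])
  ultimately have "filterlim (\<lambda>z. \<bar>(z - p) * laplace f (z - p)\<bar> * inverse (z - p)) at_top (at_right p)"
    using lim(2) by (intro filterlim_tendsto_pos_mult_at_top) auto
  then have "filterlim (\<lambda>z. - (B * X) + \<bar>(z - p) * laplace f (z - p)\<bar> * inverse (z - p)) at_top (at_right p)"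
    by (intro filterlim_tendsto_add_at_top[OF tendsto_const])
  then have "filterlim (\<lambda>z. c * (- (B * X) + \<bar>(z - p) * laplace f (z - p)\<bar> * inverse (z - p))) at_top (at_right p)"
    using c by (intro filterlim_tendsto_pos_mult_at_top[OF tendsto_const])
  then show ?thesis
  proof (rule filterlim_at_top_mono)
    show "\<forall>\<^sub>F z in at_right p. c * (- (B * X) + \<bar>(z - p) * laplace f (z - p)\<bar> * inverse (z - p))
        \<le> mellin_const z * zeta_sum (\<lambda>k. 1) z"
      unfolding eventually_at_right_field
    proof (intro exI[of _ "p + 1"] conjI allI impI)
      fix z assume z: "p < z"
      then have "\<bar>(z - p) * laplace f (z - p)\<bar> * inverse (z - p) = \<bar>laplace f (z - p)\<bar>"
        by (simp add: abs_mult)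
      then show "c * (- (B * X) + \<bar>(z - p) * laplace f (z - p)\<bar> * inverse (z - p))
        \<le> mellin_const z * zeta_sum (\<lambda>k. 1) z"
        using le[OF z] c by (simp add: field_simps)
    qed simp
  qed
qed

text \<open>Split the Mellin integral of the heat sum of \<open>d\<close> at \<open>X\<close>. The
  part beyond \<open>X\<close> is at most a small multiple of the Mellin transform
  \<open>M z\<close>, the rest stays bounded as \<open>z\<close> tends to \<open>p\<close>, and
  \<open>M z\<close> tends to infinity.\<close>

lemma zeta_ratio_tendsto_0:
  fixes d :: "'k \<Rightarrow> complex"
  assumes p: "0 < p" and upper: "\<And>x. 0 \<le> x \<Longrightarrow> heat_sum (\<lambda>k. 1) x \<le> C * exp (p * x)"
    and top: "filterlim (\<lambda>z. mellin_const z * zeta_sum (\<lambda>k. 1::real) z) at_top (at_right p)"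
    and d: "\<And>k. k \<in> K \<Longrightarrow> norm (d k) \<le> B"
    and small: "\<And>\<epsilon>. 0 < \<epsilon> \<Longrightarrow> \<exists>X. \<forall>x\<ge>X. norm (heat_sum d x) \<le> \<epsilon> * heat_sum (\<lambda>k. 1) x"
  shows "((\<lambda>z. zeta_sum d z / of_real (zeta_sum (\<lambda>k. 1) z)) \<longlongrightarrow> 0) (at_right p)"
\<comment> \<open>On an empty index set the bound \<open>B\<close> may be negative.\<close>
proof (cases "K = {}")
  case True
  have "zeta_sum d z = 0" for z unfolding zeta_sum_def by (simp add: True)
  then show ?thesis by simp
next
  case False
  then have B: "0 \<le> B" using d norm_ge_zero order_trans by blast
  define M where "M z = mellin_const z * zeta_sum (\<lambda>k. 1::real) z" for z
  have sum: "(\<lambda>k. m k powr (- 2 * z)) summable_on K" if "p < z" for z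
    by (rule zeta_summable[OF p that upper])
  have hM: "has_bochner_integral lborel (\<lambda>x. exp (- z * x) * heat_sum (\<lambda>k. 1) x) (M z)" if "p < z" for z
    unfolding M_def using that p by (intro heat_sum_mellin_one sum) auto
  show ?thesis
  proof (rule tendstoI)
    fix e :: real assume e: "0 < e"
    obtain X0 where X0: "\<And>x. X0 \<le> x \<Longrightarrow> norm (heat_sum d x) \<le> e / 3 * heat_sum (\<lambda>k. 1) x"
      using small[of "e / 3"] e by auto
    define X where "X = max X0 0"
    \<comment> \<open>Bounds the part below \<open>X\<close> uniformly in \<open>z\<close>, by the
      Mellin integral at the fixed exponent \<open>p + 1\<close>. Once
      \<open>M z \<ge> 3 * Q / e\<close>, the two parts add up to at most
      \<open>2 / 3 * e * M z\<close>.\<close>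
    define Q where "Q = B * exp X * M (p + 1)"
    have est: "mellin_const z * norm (zeta_sum d z) \<le> Q + e / 3 * M z" if z: "p < z" "z < p + 1" for z
    proof -
      have z0: "0 < z" using p z by simp
      have h1: "has_bochner_integral lborel (\<lambda>x. exp (- z * x) *\<^sub>R heat_sum d x) (mellin_const z *\<^sub>R zeta_sum d z)"
        by (rule heat_sum_mellin[OF z0 sum[OF z(1)] d])
      have h2: "has_bochner_integral lborel (\<lambda>x. B * exp X * (exp (- (p + 1) * x) * heat_sum (\<lambda>k. 1) x)
          + e / 3 * (exp (- z * x) * heat_sum (\<lambda>k. 1) x)) (Q + e / 3 * M z)"
        unfolding Q_def using z by (intro has_bochner_integral_add has_bochner_integral_mult_right hM) auto
      have "norm (\<integral>x. exp (- z * x) *\<^sub>R heat_sum d x \<partial>lborel) \<le>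
          (\<integral>x. B * exp X * (exp (- (p + 1) * x) * heat_sum (\<lambda>k. 1) x) + e / 3 * (exp (- z * x) * heat_sum (\<lambda>k. 1) x) \<partial>lborel)"
      proof (rule Bochner_Integration.integral_norm_bound_integral)
        fix x
        have H: "0 \<le> heat_sum (\<lambda>k. 1::real) x" by (rule heat_sum_one_nonneg)
        have n: "norm (exp (- z * x) *\<^sub>R heat_sum d x) = exp (- z * x) * norm (heat_sum d x)" by simp
        show "norm (exp (- z * x) *\<^sub>R heat_sum d x) \<le>
          B * exp X * (exp (- (p + 1) * x) * heat_sum (\<lambda>k. 1) x) + e / 3 * (exp (- z * x) * heat_sum (\<lambda>k. 1) x)"
        proof (cases "X \<le> x")
          case True
          then have "exp (- z * x) * norm (heat_sum d x) \<le> exp (- z * x) * (e / 3 * heat_sum (\<lambda>k. 1) x)" (is "_ \<le> ?r")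
            using X0[of x] by (intro mult_left_mono) (auto simp: X_def)
          moreover have "0 \<le> B * exp X * (exp (- (p + 1) * x) * heat_sum (\<lambda>k. 1) x)"
            using B H by simp
          moreover have "?r = e / 3 * (exp (- z * x) * heat_sum (\<lambda>k. 1) x)" by (rule mult.left_commute)
          ultimately show ?thesis unfolding n by linarith
        next
          case False
          \<comment> \<open>Since \<open>p + 1 - z\<close> lies between 0 and 1, exchanging the
            exponent \<open>z\<close> for \<open>p + 1\<close> costs at most the factor
            \<open>exp X\<close>.\<close>
          have "(p + 1 - z) * x \<le> X"
          proof (cases "0 \<le> x")
            case True
            then have "(p + 1 - z) * x \<le> 1 * x" using z by (intro mult_right_mono) auto
            then show ?thesis using False by simp
          next
            case neg: False
            then have "(p + 1 - z) * x \<le> 0" using z by (simp add: mult_nonneg_nonpos)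
            then show ?thesis by (simp add: X_def)
          qed
          then have "exp (- z * x) \<le> exp X * exp (- (p + 1) * x)"
            by (simp add: exp_add[symmetric] algebra_simps)
          then have "exp (- z * x) * norm (heat_sum d x) \<le> (exp X * exp (- (p + 1) * x)) * (B * heat_sum (\<lambda>k. 1) x)" (is "_ \<le> ?r")
            using norm_heat_sum_le[OF d] by (intro mult_mono) auto
          moreover have "0 \<le> e / 3 * (exp (- z * x) * heat_sum (\<lambda>k. 1) x)" using e H by simp
          moreover have "?r = B * exp X * (exp (- (p + 1) * x) * heat_sum (\<lambda>k. 1) x)" by simp
          ultimately show ?thesis unfolding n by linarith
        qed
      qed (use h1 h2 in \<open>auto simp: has_bochner_integral_iff\<close>)
      then show ?thesis
        using has_bochner_integral_integral_eq[OF h1] has_bochner_integral_integral_eq[OF h2]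
          mellin_const_pos[OF z0] by simp
    qed
    have "\<forall>\<^sub>F z in at_right p. M z \<ge> max 1 (3 * Q / e)"
      using top unfolding M_def filterlim_at_top by blast
    moreover have "\<forall>\<^sub>F z in at_right p. p < z \<and> z < p + 1"
      unfolding eventually_at_right_field by (intro exI[of _ "p + 1"]) auto
    ultimately show "\<forall>\<^sub>F z in at_right p. dist (zeta_sum d z / of_real (zeta_sum (\<lambda>k. 1) z)) 0 < e"
    proof eventually_elim
      fix z assume Mz: "max 1 (3 * Q / e) \<le> M z" and z: "p < z \<and> z < p + 1"
      have G: "0 < mellin_const z" using p z by (intro mellin_const_pos) auto
      have Z: "0 < zeta_sum (\<lambda>k. 1::real) z"
        using Mz G by (simp add: M_def zero_less_mult_iff not_less) (smt (verit) mult_nonneg_nonpos zero_less_mult_iff)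
      have "3 * Q \<le> e * M z" using Mz e by (simp add: field_simps)
      then have "mellin_const z * norm (zeta_sum d z) \<le> 2 / 3 * e * M z"
        using est[of z] z by simp
      then have "norm (zeta_sum d z) \<le> 2 / 3 * e * zeta_sum (\<lambda>k. 1) z"
        using G by (simp add: M_def)
      also have "\<dots> < e * zeta_sum (\<lambda>k. 1) z" using e Z by simp
      finally show "dist (zeta_sum d z / of_real (zeta_sum (\<lambda>k. 1) z)) 0 < e"
        using Z by (simp add: norm_divide field_simps)
    qed
  qed
qed

text \<open>Summability at some \<open>s < 2 * p\<close> would persist for all
  \<open>z \<ge> p\<close>, because the \<open>m k\<close> are bounded below. For \<open>z\<close>
  between \<open>p\<close> and \<open>p + 1\<close> the kernel \<open>exp (- z * x)\<close> is at
  most the sum of the kernels for the two endpoints, so the Mellin transform would stay bounded near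
  \<open>p\<close>, contrary to \<open>top\<close>.\<close>

lemma zeta_not_summable:
  assumes p: "0 < p" and s: "s < 2 * p"
    and upper: "\<And>x. 0 \<le> x \<Longrightarrow> heat_sum (\<lambda>k. 1) x \<le> C * exp (p * x)"
    and top: "filterlim (\<lambda>z. mellin_const z * zeta_sum (\<lambda>k. 1::real) z) at_top (at_right p)"
  shows "\<not> (\<lambda>k. m k powr - s) summable_on K"
proof
  assume sum: "(\<lambda>k. m k powr - s) summable_on K"
  have sumz: "(\<lambda>k. m k powr (- 2 * z)) summable_on K" if z: "p \<le> z" for z
  proof (rule summable_on_comparison_test)
    show "(\<lambda>k. m k powr - s * \<delta> powr - (2 * z - s)) summable_on K"
      by (intro summable_on_cmult_left sum)
    fix k assume k: "k \<in> K"
    have "m k powr (- 2 * z) = m k powr - s * m k powr - (2 * z - s)"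
      by (simp flip: powr_add)
    also have "\<dots> \<le> m k powr - s * \<delta> powr - (2 * z - s)"
      using s z m_ge[OF k] \<delta>_pos by (intro mult_left_mono powr_mono2') auto
    finally show "m k powr (- 2 * z) \<le> m k powr - s * \<delta> powr - (2 * z - s)" .
  qed simp
  define M where "M z = mellin_const z * zeta_sum (\<lambda>k. 1::real) z" for z
  have hM: "has_bochner_integral lborel (\<lambda>x. exp (- z * x) * heat_sum (\<lambda>k. 1) x) (M z)" if "p \<le> z" for z
    unfolding M_def using that p by (intro heat_sum_mellin_one sumz) auto
  have "M z \<le> M p + M (p + 1)" if z: "p < z" "z < p + 1" for z
  proof -
    have "exp (- z * x) * heat_sum (\<lambda>k. 1) x \<le>
        exp (- p * x) * heat_sum (\<lambda>k. 1) x + exp (- (p + 1) * x) * heat_sum (\<lambda>k. 1) x" for x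
    proof -
      have "exp (- z * x) \<le> exp (- p * x) + exp (- (p + 1) * x)"
      proof (cases "0 \<le> x")
        case True
        then have "exp (- z * x) \<le> exp (- p * x)" using z by (simp add: mult_right_mono)
        then show ?thesis by (simp add: add_increasing2)
      next
        case False
        then have "(p + 1 - z) * x \<le> 0" using z by (intro mult_nonneg_nonpos) auto
        then have "exp (- z * x) \<le> exp (- (p + 1) * x)" by (simp add: algebra_simps)
        then show ?thesis by (simp add: add_increasing)
      qed
      then show ?thesis using heat_sum_one_nonneg[of x] by (metis distrib_right mult_right_mono)
    qed
    then have "(\<integral>x. exp (- z * x) * heat_sum (\<lambda>k. 1) x \<partial>lborel) \<le>
        (\<integral>x. exp (- p * x) * heat_sum (\<lambda>k. 1) x + exp (- (p + 1) * x) * heat_sum (\<lambda>k. 1) x \<partial>lborel)"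
      by (intro Bochner_Integration.integral_mono Bochner_Integration.integrable_add integrable.intros[OF hM]) (use z in auto)
    also have "\<dots> = M p + M (p + 1)"
      by (intro has_bochner_integral_integral_eq has_bochner_integral_add hM) auto
    finally show ?thesis
      using has_bochner_integral_integral_eq[OF hM[of z]] z by simp
  qed
  moreover have "\<forall>\<^sub>F z in at_right p. M z \<ge> M p + M (p + 1) + 1"
    using top unfolding M_def filterlim_at_top by blast
  moreover have "\<forall>\<^sub>F z in at_right p. p < z \<and> z < p + 1"
    unfolding eventually_at_right_field by (intro exI[of _ "p + 1"]) auto
  ultimately have "\<forall>\<^sub>F z in at_right p. False"
    by (elim eventually_rev_mp) (intro always_eventually, smt (verit))
  then show False by (simp add: eventually_False trivial_limit_at_right_real)
qed

end

section \<open>Spectral states from heat traces\<close>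

lemma infsum_diff_scaled:
  fixes f g :: "'k \<Rightarrow> complex"
  assumes "f summable_on A" "g summable_on A"
  shows "(\<Sum>\<^sub>\<infinity>x\<in>A. f x - c * g x) = infsum f A - c * infsum g A"
proof -
  have "((\<lambda>x. f x + (- c) * g x) has_sum infsum f A + (- c) * infsum g A) A"
    using assms by (intro has_sum_add has_sum_cmult_right has_sum_infsum)
  then show ?thesis by (simp add: infsumI)
qed

lemma infsum_times:
  fixes a :: "'i \<Rightarrow> 'e::{real_normed_field, banach, second_countable_topology}" and b :: "'j \<Rightarrow> 'e"
  assumes a: "(\<lambda>i. norm (a i)) summable_on A" and b: "(\<lambda>j. norm (b j)) summable_on B"
  shows "(\<lambda>(i, j). norm (a i * b j)) summable_on A \<times> B"
    and "(\<Sum>\<^sub>\<infinity>(i, j)\<in>A \<times> B. a i * b j) = infsum a A * infsum b B"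
proof -
  show s: "(\<lambda>(i, j). norm (a i * b j)) summable_on A \<times> B"
  proof (rule summable_on_SigmaI)
    show "((\<lambda>j. case (i, j) of (i, j) \<Rightarrow> norm (a i * b j)) has_sum norm (a i) * (\<Sum>\<^sub>\<infinity>j\<in>B. norm (b j))) B" for i
      using has_sum_cmult_right[OF has_sum_infsum[OF b], of "norm (a i)"] by (simp add: norm_mult)
    show "(\<lambda>i. norm (a i) * (\<Sum>\<^sub>\<infinity>j\<in>B. norm (b j))) summable_on A"
      by (intro summable_on_cmult_left a)
  qed auto
  have "(\<lambda>(i, j). a i * b j) summable_on A \<times> B"
    by (rule abs_summable_summable) (use s in \<open>simp add: case_prod_unfold\<close>)
  then have "((\<lambda>(i, j). a i * b j) has_sum infsum a A * infsum b B) (A \<times> B)"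
    using has_sum_cmult_right[OF has_sum_infsum[OF abs_summable_summable[OF b]]]
      has_sum_cmult_left[OF has_sum_infsum[OF abs_summable_summable[OF a]]]
    by (intro has_sum_SigmaI) auto
  then show "(\<Sum>\<^sub>\<infinity>(i, j)\<in>A \<times> B. a i * b j) = infsum a A * infsum b B" by (rule infsumI)
qed

lemma (in heat_data) heat_weighted_summable:
  fixes a :: "'k \<Rightarrow> 'e::{banach, second_countable_topology}"
  assumes "\<And>k. k \<in> K \<Longrightarrow> norm (a k) \<le> B"
  shows "(\<lambda>k. norm (exp (- exp (- x) * (m k)\<^sup>2) *\<^sub>R a k)) summable_on K"
  by (rule abs_summable_weighted[OF heat_summable _ assms]) auto

lemma (in heat_data) heat_sum_diff:
  fixes a b :: "'k \<Rightarrow> complex"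
  assumes "\<And>k. k \<in> K \<Longrightarrow> norm (a k) \<le> A" "\<And>k. k \<in> K \<Longrightarrow> norm (b k) \<le> B"
  shows "heat_sum (\<lambda>k. a k - c * b k) x = heat_sum a x - c * heat_sum b x"
proof -
  have "(\<lambda>k. exp (- exp (- x) * (m k)\<^sup>2) *\<^sub>R a k) summable_on K"
    by (rule abs_summable_summable, rule heat_weighted_summable[OF assms(1)])
  moreover have "(\<lambda>k. exp (- exp (- x) * (m k)\<^sup>2) *\<^sub>R b k) summable_on K"
    by (rule abs_summable_summable, rule heat_weighted_summable[OF assms(2)])
  ultimately show ?thesis
    using infsum_diff_scaled[of "\<lambda>k. exp (- exp (- x) * (m k)\<^sup>2) *\<^sub>R a k" K "\<lambda>k. exp (- exp (- x) * (m k)\<^sup>2) *\<^sub>R b k" c]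
    by (simp add: heat_sum_def scaleR_diff_right)
qed

lemma (in heat_data) zeta_sum_diff:
  fixes a b :: "'k \<Rightarrow> complex"
  assumes s: "(\<lambda>k. m k powr (- 2 * z)) summable_on K"
    and "\<And>k. k \<in> K \<Longrightarrow> norm (a k) \<le> A" "\<And>k. k \<in> K \<Longrightarrow> norm (b k) \<le> B"
  shows "zeta_sum (\<lambda>k. a k - c * b k) z = zeta_sum a z - c * zeta_sum b z"
proof -
  have "(\<lambda>k. m k powr (- 2 * z) *\<^sub>R a k) summable_on K"
    by (rule abs_summable_summable, rule abs_summable_weighted[OF s _ assms(2)]) auto
  moreover have "(\<lambda>k. m k powr (- 2 * z) *\<^sub>R b k) summable_on K"
    by (rule abs_summable_summable, rule abs_summable_weighted[OF s _ assms(3)]) auto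
  ultimately show ?thesis
    using infsum_diff_scaled[of "\<lambda>k. m k powr (- 2 * z) *\<^sub>R a k" K "\<lambda>k. m k powr (- 2 * z) *\<^sub>R b k" c]
    by (simp add: zeta_sum_def scaleR_diff_right)
qed

locale heat_spectrum = abs_spectrum I u D \<nu> \<delta> + heat: heat_data I \<nu> \<delta>
  for I :: "'i set" and u :: "'i \<Rightarrow> 'h::chilbert_space" and D \<nu> \<delta>
begin

abbreviation diag_coeffs :: "('h \<Rightarrow> 'h) \<Rightarrow> 'i \<Rightarrow> complex" where
  "diag_coeffs B i \<equiv> cinner (u i) (B (u i))"

lemma norm_diag_coeffs_le:
  assumes "bounded_clinear B" "i \<in> I"
  shows "norm (diag_coeffs B i) \<le> onorm B"
  using norm_cinner_le[of "u i" "B (u i)"] bounded_clinearD(8)[OF assms(1), of "u i"] norm_basis[OF assms(2)]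
  by simp

lemma op_trace_heat_op:
  assumes "bounded_clinear B"
  shows "op_trace (heat_op D (exp (- x)) \<circ> B) = heat.heat_sum (diag_coeffs B) x"
  using op_trace_heat[OF heat.heat_summable _ assms, of "exp (- x)"]
  by (simp add: heat.heat_sum_def scaleR_conv_of_real)

lemma heat_sum_id: "heat.heat_sum (diag_coeffs id) x = of_real (heat.heat_sum (\<lambda>i. 1) x)"
proof -
  have "heat.heat_sum (diag_coeffs id) x = (\<Sum>\<^sub>\<infinity>i\<in>I. of_real (exp (- exp (- x) * (\<nu> i)\<^sup>2)))"
    by (simp add: heat.heat_sum_def orthonormal scaleR_conv_of_real cong: infsum_cong)
  also have "\<dots> = of_real (\<Sum>\<^sub>\<infinity>i\<in>I. exp (- exp (- x) * (\<nu> i)\<^sup>2))"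
    by (intro infsumI has_sum_of_real has_sum_infsum heat.heat_summable) simp
  finally show ?thesis by (simp add: heat.heat_sum_def)
qed

end

text \<open>The two consequences of the heat asymptotics that locate the abscissa: the growth bound
  makes the zeta series converge beyond \<open>2 * p\<close>, and the blow-up rules out convergence
  before it. In the application \<open>p\<close> is \<open>- \<alpha>\<close>.\<close>

locale zeta_asymptotics = heat_spectrum I u D \<nu> \<delta>
  for I :: "'i set" and u :: "'i \<Rightarrow> 'h::chilbert_space" and D \<nu> \<delta> +
  fixes p C :: real
  assumes p_pos: "0 < p"
    and heat_upper: "0 \<le> x \<Longrightarrow> heat.heat_sum (\<lambda>i. 1) x \<le> C * exp (p * x)"
    and zeta_at_top: "filterlim (\<lambda>z. mellin_const z * heat.zeta_sum (\<lambda>i. 1::real) z) at_top (at_right p)"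
begin

lemma zeta_abscissa_eq: "zeta_abscissa D = 2 * p"
proof -
  define S where "S = {s. trace_class (abs_power D (- s))}"
  have mem: "s \<in> S" if "2 * p < s" for s
    using heat.zeta_summable[OF p_pos _ heat_upper, of "s / 2"] that p_pos
    by (auto simp: S_def intro!: trace_class_abs_power)
  have lower: "2 * p \<le> s" if "s \<in> S" for s
    using heat.zeta_not_summable[OF p_pos _ heat_upper zeta_at_top] abs_power_summable that
    by (force simp: S_def not_less)
  have "Inf S \<le> 2 * p + e" if "0 < e" for e
    using lower mem[of "2 * p + e"] that by (intro cInf_lower bdd_belowI) auto
  then have "Inf S \<le> 2 * p" by (rule field_le_epsilon)
  moreover have "2 * p \<le> Inf S"
    using lower mem[of "2 * p + 1"] by (intro cInf_greatest) auto
  ultimately show ?thesis by (simp add: zeta_abscissa_def S_def)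
qed

lemma spectral_ratio_eq:
  assumes B: "bounded_clinear B" and s: "2 * p < s"
  shows "spectral_ratio D B s =
    heat.zeta_sum (diag_coeffs B) (s / 2) / of_real (heat.zeta_sum (\<lambda>i. 1) (s / 2))"
proof -
  have sum: "(\<lambda>i. \<nu> i powr - s) summable_on I"
    using heat.zeta_summable[OF p_pos _ heat_upper, of "s / 2"] s by simp
  have tr: "op_trace (abs_power D (- s) \<circ> B) = heat.zeta_sum (diag_coeffs B) (s / 2)" if "bounded_clinear B" for B
    using op_trace_abs_power[OF _ sum that] s p_pos by (simp add: heat.zeta_sum_def scaleR_conv_of_real)
  have "op_trace (abs_power D (- s)) = (\<Sum>\<^sub>\<infinity>i\<in>I. of_real (\<nu> i powr - s))"
    using tr[OF bounded_clinear_id] by (simp add: heat.zeta_sum_def orthonormal scaleR_conv_of_real cong: infsum_cong)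
  also have "\<dots> = of_real (\<Sum>\<^sub>\<infinity>i\<in>I. \<nu> i powr - s)"
    using sum by (intro infsumI has_sum_of_real has_sum_infsum)
  finally show ?thesis
    by (simp add: spectral_ratio_def tr[OF B] heat.zeta_sum_def)
qed

lemma filterlim_half: "filterlim (\<lambda>s. s / 2) (at_right p) (at_right (2 * p))"
  unfolding filterlim_at
  by (auto intro!: tendsto_eq_intros simp: eventually_at_right_field intro: exI[of _ "2 * p + 1"])

lemma eventually_abscissa: "\<forall>\<^sub>F s in at_right (2 * p). 2 * p < s"
  by (simp add: eventually_at_right_less)

text \<open>Convergence of neither ratio is presupposed. For part (i) \<open>B'\<close> is
  \<open>tensor_op ten id A2\<close>, whose spectral state is not known to exist.\<close>

lemma spectral_ratio_diff_tendsto: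
  assumes B: "bounded_clinear B" "bounded_clinear B'"
    and small: "\<And>\<epsilon>. 0 < \<epsilon> \<Longrightarrow> \<exists>X. \<forall>x\<ge>X.
      norm (heat.heat_sum (diag_coeffs B) x - c * heat.heat_sum (diag_coeffs B') x) \<le> \<epsilon> * heat.heat_sum (\<lambda>i. 1) x"
  shows "((\<lambda>s. spectral_ratio D B s - c * spectral_ratio D B' s) \<longlongrightarrow> 0) (at_right (zeta_abscissa D))"
proof -
  define d where "d i = diag_coeffs B i - c * diag_coeffs B' i" for i
  note bd = norm_diag_coeffs_le[OF B(1)] norm_diag_coeffs_le[OF B(2)]
  have "norm (d i) \<le> onorm B + norm c * onorm B'" if "i \<in> I" for i
  proof -
    have "norm (d i) \<le> norm (diag_coeffs B i) + norm (c * diag_coeffs B' i)"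
      unfolding d_def by (rule norm_triangle_ineq4)
    also have "\<dots> \<le> onorm B + norm c * onorm B'"
      unfolding norm_mult using bd that by (intro add_mono mult_left_mono) auto
    finally show ?thesis .
  qed
  moreover have "heat.heat_sum d x = heat.heat_sum (diag_coeffs B) x - c * heat.heat_sum (diag_coeffs B') x" for x
    unfolding d_def by (rule heat.heat_sum_diff[OF bd])
  ultimately have "((\<lambda>z. heat.zeta_sum d z / of_real (heat.zeta_sum (\<lambda>i. 1) z)) \<longlongrightarrow> 0) (at_right p)"
    using small by (intro heat.zeta_ratio_tendsto_0[OF p_pos heat_upper zeta_at_top]) auto
  from filterlim_compose[OF this filterlim_half]
  have "((\<lambda>s. heat.zeta_sum d (s / 2) / of_real (heat.zeta_sum (\<lambda>i. 1) (s / 2))) \<longlongrightarrow> 0) (at_right (2 * p))" .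
  moreover have "\<forall>\<^sub>F s in at_right (2 * p). heat.zeta_sum d (s / 2) / of_real (heat.zeta_sum (\<lambda>i. 1) (s / 2)) =
      spectral_ratio D B s - c * spectral_ratio D B' s"
    using eventually_abscissa
  proof eventually_elim
    fix s assume s: "2 * p < s"
    have "heat.zeta_sum d (s / 2) = heat.zeta_sum (diag_coeffs B) (s / 2) - c * heat.zeta_sum (diag_coeffs B') (s / 2)"
      unfolding d_def using s
      by (intro heat.zeta_sum_diff[OF _ bd] heat.zeta_summable[OF p_pos _ heat_upper]) auto
    then show "heat.zeta_sum d (s / 2) / of_real (heat.zeta_sum (\<lambda>i. 1) (s / 2)) =
      spectral_ratio D B s - c * spectral_ratio D B' s"
      by (simp add: spectral_ratio_eq B s diff_divide_distrib)
  qed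
  ultimately show ?thesis
    unfolding zeta_abscissa_eq by (rule Lim_transform_eventually)
qed

text \<open>The blow-up at \<open>p\<close> keeps the denominator non-zero close to the abscissa;
  where it vanished, the ratio would be 0 by the convention for division.\<close>

lemma spectral_ratio_id: "\<forall>\<^sub>F s in at_right (zeta_abscissa D). spectral_ratio D id s = 1"
proof -
  have "\<forall>\<^sub>F z in at_right p. 0 < mellin_const z * heat.zeta_sum (\<lambda>i. 1::real) z"
    using zeta_at_top by (simp add: filterlim_at_top_dense)
  from eventually_compose_filterlim[OF this filterlim_half]
  have "\<forall>\<^sub>F s in at_right (2 * p). heat.zeta_sum (\<lambda>i. 1::real) (s / 2) \<noteq> 0"
    by eventually_elim auto
  then show ?thesis
    unfolding zeta_abscissa_eq using eventually_abscissa
  proof eventually_elim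
    fix s assume nz: "heat.zeta_sum (\<lambda>i. 1::real) (s / 2) \<noteq> 0" and s: "2 * p < s"
    have sum: "(\<lambda>i. \<nu> i powr - s) summable_on I"
      using heat.zeta_summable[OF p_pos _ heat_upper, of "s / 2"] s by simp
    have "heat.zeta_sum (diag_coeffs id) (s / 2) = (\<Sum>\<^sub>\<infinity>i\<in>I. of_real (\<nu> i powr - s))"
      by (simp add: heat.zeta_sum_def orthonormal scaleR_conv_of_real cong: infsum_cong)
    also have "\<dots> = of_real (\<Sum>\<^sub>\<infinity>i\<in>I. \<nu> i powr - s)"
      using sum by (intro infsumI has_sum_of_real has_sum_infsum)
    also have "\<dots> = of_real (heat.zeta_sum (\<lambda>i. 1) (s / 2))"
      by (simp add: heat.zeta_sum_def)
    finally show "spectral_ratio D id s = 1"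
      using nz by (simp add: spectral_ratio_eq[OF bounded_clinear_id s])
  qed
qed

end

context zeta_asymptotics
begin

lemma spectral_state_strongly_regular:
  assumes B: "bounded_clinear B"
    and small: "\<And>\<epsilon>. 0 < \<epsilon> \<Longrightarrow> \<exists>X. \<forall>x\<ge>X.
      norm (heat.heat_sum (diag_coeffs B) x - c * heat.heat_sum (diag_coeffs id) x) \<le> \<epsilon> * heat.heat_sum (\<lambda>i. 1) x"
  shows "(spectral_ratio D B \<longlongrightarrow> c) (at_right (zeta_abscissa D))"
proof -
  have "((\<lambda>s. spectral_ratio D B s - c * spectral_ratio D id s + c) \<longlongrightarrow> 0 + c) (at_right (zeta_abscissa D))"
    by (intro tendsto_add tendsto_const spectral_ratio_diff_tendsto B bounded_clinear_id small)
  moreover have "\<forall>\<^sub>F s in at_right (zeta_abscissa D).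
      spectral_ratio D B s - c * spectral_ratio D id s + c = spectral_ratio D B s"
    using spectral_ratio_id by eventually_elim simp
  ultimately show ?thesis using Lim_transform_eventually by fastforce
qed

end

section \<open>From asymptotics as \<open>t\<close> tends to 0 to bounds for large
  \<open>x\<close>\<close>

lemma eventually_at_right_0_exp:
  assumes "eventually P (at_right (0::real))"
  shows "\<exists>X\<ge>0. \<forall>x\<ge>X. P (exp (- x))"
proof -
  obtain b where b: "0 < b" "\<forall>t>0. t < b \<longrightarrow> P t"
    using assms unfolding eventually_at_right_field by (elim exE conjE)
  have "P (exp (- x))" if "max 0 (1 - ln b) \<le> x" for x
  proof -
    \<comment> \<open>The 1 in the threshold makes this inequality strict.\<close>
    have "- x < ln b" using that by simp
    then have "exp (- x) < exp (ln b)" by (simp only: exp_less_cancel_iff)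
    also have "\<dots> = b" using b(1) by (rule exp_ln)
    finally show ?thesis using b(2) exp_gt_zero by blast
  qed
  then show ?thesis by (intro exI[of _ "max 0 (1 - ln b)"] conjI) auto
qed

text \<open>The error fraction 1/2 is below 1, so the sign of the heat trace decides that of
  \<open>f\<close>: a negative \<open>g\<close> would differ from the non-negative trace by at least
  its own modulus.\<close>

lemma (in heat_data) heat_trace_bounds:
  assumes tr: "\<And>x. T (exp (- x)) = complex_of_real (heat_sum (\<lambda>k. 1) x)"
    and asymp: "asymp_at_0 T (\<lambda>t. of_real (f (- ln t) * t powr \<alpha>))"
  obtains X where "0 \<le> X"
    "\<And>x. X \<le> x \<Longrightarrow> 0 \<le> f x \<and> 1 / 2 * f x * exp (- \<alpha> * x) \<le> heat_sum (\<lambda>k. 1) x \<and>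
      heat_sum (\<lambda>k. 1) x \<le> 2 * f x * exp (- \<alpha> * x)"
proof -
  have "\<forall>\<^sub>F t in at_right 0. norm (T t - of_real (f (- ln t) * t powr \<alpha>)) \<le> 1 / 2 * norm (complex_of_real (f (- ln t) * t powr \<alpha>))"
    using landau_o.smallD[OF asymp[unfolded asymp_at_0_def], of "1 / 2"] by simp
  from eventually_at_right_0_exp[OF this] obtain X where X: "0 \<le> X" "\<And>x. X \<le> x \<Longrightarrow>
      norm (T (exp (- x)) - of_real (f (- ln (exp (- x))) * exp (- x) powr \<alpha>)) \<le>
        1 / 2 * norm (complex_of_real (f (- ln (exp (- x))) * exp (- x) powr \<alpha>))"
    by metis
  have "0 \<le> f x \<and> 1 / 2 * f x * exp (- \<alpha> * x) \<le> heat_sum (\<lambda>k. 1) x \<and>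
      heat_sum (\<lambda>k. 1) x \<le> 2 * f x * exp (- \<alpha> * x)" if x: "X \<le> x" for x
  proof -
    define g where "g = f x * exp (- \<alpha> * x)"
    have "norm (complex_of_real (heat_sum (\<lambda>k. 1) x - g)) \<le> 1 / 2 * norm (complex_of_real g)"
      using X(2)[OF x] by (simp add: tr g_def powr_def)
    then have le: "\<bar>heat_sum (\<lambda>k. 1) x - g\<bar> \<le> 1 / 2 * \<bar>g\<bar>" by (simp only: norm_of_real)
    then have g: "0 \<le> g" using heat_sum_one_nonneg[of x] by linarith
    then have "0 \<le> f x" by (simp add: g_def zero_le_mult_iff)
    moreover have "1 / 2 * g \<le> heat_sum (\<lambda>k. 1) x" "heat_sum (\<lambda>k. 1) x \<le> 2 * g"
      using le g by linarith+
    ultimately show ?thesis by (simp add: g_def)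
  qed
  then show ?thesis using that X(1) by blast
qed

text \<open>The constants \<open>c\<close> and \<open>C\<close> are free because the factors give
  1/2 and 2, and the tensor product gives 1/4 and 4.\<close>

lemma zeta_asymptoticsI:
  fixes f :: "real \<Rightarrow> real"
  assumes spec: "abs_spectrum I u D \<nu> \<delta>" and hd: "heat_data I \<nu> \<delta>" and p: "0 < p"
    and f: "\<And>x. 0 \<le> x \<Longrightarrow> \<bar>f x\<bar> \<le> B" and X: "0 \<le> X" and c: "0 < c"
    and bounds: "\<And>x. X \<le> x \<Longrightarrow> 0 \<le> f x \<and> c * f x * exp (p * x) \<le> heat_data.heat_sum I \<nu> (\<lambda>i. 1) x \<and>
      heat_data.heat_sum I \<nu> (\<lambda>i. 1) x \<le> C * f x * exp (p * x)"
    and lim: "((\<lambda>s. s * laplace f s) \<longlongrightarrow> L) (at_right 0)" "L \<noteq> 0"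
  obtains C' where "zeta_asymptotics I u D \<nu> \<delta> p C'"
proof -
  interpret heat_data I \<nu> \<delta> by (rule hd)
  \<comment> \<open>The term with \<open>B\<close> serves beyond \<open>X\<close>; below
    \<open>X\<close> the heat trace is at most its value at \<open>X\<close>, as it increases with
    \<open>x\<close>.\<close>
  define C' where "C' = \<bar>C\<bar> * B + heat_sum (\<lambda>i. 1) X"
  have B: "0 \<le> B" using f[of 0] by linarith
  have upper: "heat_sum (\<lambda>i. 1) x \<le> C' * exp (p * x)" if x: "0 \<le> x" for x
  proof (cases "X \<le> x")
    case True
    have "C * f x \<le> \<bar>C\<bar> * \<bar>f x\<bar>" by (metis abs_ge_self abs_mult)
    also have "\<dots> \<le> \<bar>C\<bar> * B" by (intro mult_left_mono f x) simp
    finally have "C * f x \<le> C'" using heat_sum_one_nonneg[of X] by (simp add: C'_def)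
    then have "C * f x * exp (p * x) \<le> C' * exp (p * x)" by (intro mult_right_mono) auto
    then show ?thesis using bounds[OF True] by linarith
  next
    case False
    have "heat_sum (\<lambda>i. 1::real) x \<le> heat_sum (\<lambda>i. 1) X" using False by (intro heat_sum_one_mono) simp
    also have "\<dots> \<le> C' * 1" using B by (simp add: C'_def)
    also have "\<dots> \<le> C' * exp (p * x)"
      using p x B heat_sum_one_nonneg[of X] by (intro mult_left_mono) (auto simp: C'_def)
    finally show ?thesis .
  qed
  have "filterlim (\<lambda>z. mellin_const z * zeta_sum (\<lambda>i. 1::real) z) at_top (at_right p)"
    by (rule mellin_zeta_at_top[OF p upper f X c _ lim]) (use bounds in auto)
  then have "zeta_asymptotics I u D \<nu> \<delta> p C'"
    by (intro zeta_asymptotics.intro heat_spectrum.intro spec hd zeta_asymptotics_axioms.intro p upper)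
  then show ?thesis by (rule that)
qed

lemma (in zeta_asymptotics) strongly_regular_heat:
  assumes "strongly_regular D A" "bounded_clinear A"
  obtains c where "\<And>\<epsilon>. 0 < \<epsilon> \<Longrightarrow> \<exists>X. \<forall>x\<ge>X.
      norm (heat.heat_sum (diag_coeffs A) x - c * heat.heat_sum (diag_coeffs id) x) \<le> \<epsilon> * heat.heat_sum (\<lambda>i. 1) x"
proof -
  obtain c where c: "(\<lambda>t. op_trace (heat_op D t \<circ> A) - c * op_trace (heat_op D t)) \<in> o[at_right 0](\<lambda>t. op_trace (heat_op D t))"
    using assms(1) by (auto simp: strongly_regular_def)
  have tr: "op_trace (heat_op D (exp (- x))) = heat.heat_sum (diag_coeffs id) x" for x
    using op_trace_heat_op[OF bounded_clinear_id, of x] by simp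
  show ?thesis
  proof (rule that)
    fix \<epsilon> :: real assume "0 < \<epsilon>"
    from eventually_at_right_0_exp[OF landau_o.smallD[OF c this]] obtain X where X: "\<And>x. X \<le> x \<Longrightarrow>
        norm (op_trace (heat_op D (exp (- x)) \<circ> A) - c * op_trace (heat_op D (exp (- x))))
          \<le> \<epsilon> * norm (op_trace (heat_op D (exp (- x))))"
      by metis
    show "\<exists>X. \<forall>x\<ge>X. norm (heat.heat_sum (diag_coeffs A) x - c * heat.heat_sum (diag_coeffs id) x)
        \<le> \<epsilon> * heat.heat_sum (\<lambda>i. 1) x"
      using X unfolding op_trace_heat_op[OF assms(2)] tr heat_sum_id norm_of_real
        abs_of_nonneg[OF heat.heat_sum_one_nonneg] by blast
  qed
qed

section \<open>Factorisation of heat traces on the tensor product\<close>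

lemma heat_data_product:
  assumes h1: "heat_data I \<nu>1 \<delta>1" and h2: "heat_data J \<nu>2 \<delta>2"
  shows "heat_data (I \<times> J) (\<lambda>(i, j). sqrt ((\<nu>1 i)\<^sup>2 + (\<nu>2 j)\<^sup>2)) \<delta>1"
proof
  interpret H1: heat_data I \<nu>1 \<delta>1 by (rule h1)
  interpret H2: heat_data J \<nu>2 \<delta>2 by (rule h2)
  show "0 < \<delta>1" by (rule H1.\<delta>_pos)
  show "\<delta>1 \<le> (case k of (i, j) \<Rightarrow> sqrt ((\<nu>1 i)\<^sup>2 + (\<nu>2 j)\<^sup>2))" if "k \<in> I \<times> J" for k
    using that H1.m_ge real_sqrt_sum_squares_ge1 order_trans by fastforce
  fix t :: real assume t: "0 < t"
  have "(\<lambda>(i, j). norm (exp (- t * (\<nu>1 i)\<^sup>2) * exp (- t * (\<nu>2 j)\<^sup>2))) summable_on I \<times> J"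
    using H1.heat_summable[OF t] H2.heat_summable[OF t] by (intro infsum_times) auto
  then show "(\<lambda>k. exp (- t * (case k of (i, j) \<Rightarrow> sqrt ((\<nu>1 i)\<^sup>2 + (\<nu>2 j)\<^sup>2))\<^sup>2)) summable_on I \<times> J"
    by (rule summable_on_cong[THEN iffD1, rotated])
      (auto simp: norm_mult exp_add[symmetric] algebra_simps)
qed

lemma heat_sum_product:
  fixes a :: "'i \<Rightarrow> 'e::{real_normed_field, banach, second_countable_topology}" and b :: "'j \<Rightarrow> 'e"
  assumes h1: "heat_data I \<nu>1 \<delta>1" and h2: "heat_data J \<nu>2 \<delta>2"
    and a: "\<And>i. i \<in> I \<Longrightarrow> norm (a i) \<le> A" and b: "\<And>j. j \<in> J \<Longrightarrow> norm (b j) \<le> B"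
  shows "heat_data.heat_sum (I \<times> J) (\<lambda>(i, j). sqrt ((\<nu>1 i)\<^sup>2 + (\<nu>2 j)\<^sup>2)) (\<lambda>(i, j). a i * b j) x =
    heat_data.heat_sum I \<nu>1 a x * heat_data.heat_sum J \<nu>2 b x"
proof -
  interpret H1: heat_data I \<nu>1 \<delta>1 by (rule h1)
  interpret H2: heat_data J \<nu>2 \<delta>2 by (rule h2)
  interpret H: heat_data "I \<times> J" "\<lambda>(i, j). sqrt ((\<nu>1 i)\<^sup>2 + (\<nu>2 j)\<^sup>2)" \<delta>1
    by (rule heat_data_product[OF h1 h2])
  let ?a = "\<lambda>i. exp (- exp (- x) * (\<nu>1 i)\<^sup>2) *\<^sub>R a i" and ?b = "\<lambda>j. exp (- exp (- x) * (\<nu>2 j)\<^sup>2) *\<^sub>R b j"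
  have "H.heat_sum (\<lambda>(i, j). a i * b j) x = (\<Sum>\<^sub>\<infinity>(i, j)\<in>I \<times> J. ?a i * ?b j)"
    unfolding H.heat_sum_def
    by (intro infsum_cong) (auto simp: exp_add[symmetric] algebra_simps)
  also have "\<dots> = infsum ?a I * infsum ?b J"
    by (intro infsum_times(2) H1.heat_weighted_summable[OF a] H2.heat_weighted_summable[OF b])
  finally show ?thesis by (simp add: H1.heat_sum_def H2.heat_sum_def)
qed

lemma spectral_stateI:
  assumes "(spectral_ratio D B \<longlongrightarrow> \<tau>) (at_right (zeta_abscissa D))"
  shows "spectral_state_exists D B" "spectral_state D B = \<tau>"
  using assms tendsto_Lim[OF trivial_limit_at_right_real assms]
  by (auto simp: spectral_state_exists_def spectral_state_def)

lemma spectral_stateE: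
  assumes "spectral_state_exists D B"
  shows "(spectral_ratio D B \<longlongrightarrow> spectral_state D B) (at_right (zeta_abscissa D))"
  using assms spectral_stateI(2) by (auto simp: spectral_state_exists_def)

text \<open>The equation in (i) is stated together with existence of the limits: it passes from 1
  \<otimes> A2 to A1 \<otimes> A2, and back if \<open>spectral_state D1 A1 \<noteq> 0\<close>. If
  that state is 0, the ratio for A1 \<otimes> A2 tends to 0 whether or not the ratio for 1 \<otimes>
  A2 converges.\<close>

theorem corollary2p8:
  fixes ten :: "'a::chilbert_space \<Rightarrow> 'b::chilbert_space \<Rightarrow> 'c::chilbert_space"
    and \<A>1 :: "('a \<Rightarrow> 'a) set" and D1 :: "('a \<times> 'a) set" and \<gamma> :: "'a \<Rightarrow> 'a"
    and \<A>2 :: "('b \<Rightarrow> 'b) set" and D2 :: "('b \<times> 'b) set"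
    and \<A> :: "('c \<Rightarrow> 'c) set" and D :: "('c \<times> 'c) set"
    and f1 f2 :: "real \<Rightarrow> real" and \<alpha>1 \<alpha>2 :: real
    and A1 :: "'a \<Rightarrow> 'a" and A2 :: "'b \<Rightarrow> 'b"
  assumes "hilbert_tensor ten"
    and "even_spectral_triple \<A>1 D1 \<gamma>"
    and "spectral_triple \<A>2 D2"
    and "\<A> = tensor_algebra ten \<A>1 \<A>2"
    and "D = tensor_dirac ten D1 \<gamma> D2"
    and "\<alpha>1 < 0" and "\<alpha>2 < 0"
    and "bounded_loc_integrable f1" and "bounded_loc_integrable f2"
    and "asymp_at_0 (\<lambda>t. op_trace (heat_op D1 t)) (\<lambda>t. of_real (f1 (- ln t) * t powr \<alpha>1))"
    and "asymp_at_0 (\<lambda>t. op_trace (heat_op D2 t)) (\<lambda>t. of_real (f2 (- ln t) * t powr \<alpha>2))"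
    and "\<exists>L. L \<noteq> 0 \<and> ((\<lambda>s. s * laplace f1 s) \<longlongrightarrow> L) (at_right 0)"
    and "\<exists>L. L \<noteq> 0 \<and> ((\<lambda>s. s * laplace f2 s) \<longlongrightarrow> L) (at_right 0)"
    and "\<exists>L. L \<noteq> 0 \<and> ((\<lambda>s. s * laplace (\<lambda>x. f1 x * f2 x) s) \<longlongrightarrow> L) (at_right 0)"
    and "bounded_clinear A1" and "bounded_clinear A2"
    and "weakly_regular D1 \<alpha>1 A1" and "weakly_regular D2 \<alpha>2 A2"
  shows "(strongly_regular D1 A1 \<longrightarrow>
      spectral_state_exists D1 A1 \<and>
      (spectral_state_exists D (tensor_op ten id A2) \<longrightarrow>
        spectral_state_exists D (tensor_op ten A1 A2) \<and>
        spectral_state D (tensor_op ten A1 A2) =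
          spectral_state D1 A1 * spectral_state D (tensor_op ten id A2)) \<and>
      (spectral_state_exists D (tensor_op ten A1 A2) \<and> spectral_state D1 A1 \<noteq> 0 \<longrightarrow>
        spectral_state_exists D (tensor_op ten id A2))) \<and>
    (strongly_regular D1 A1 \<and> strongly_regular D2 A2 \<longrightarrow>
      spectral_state_exists D1 A1 \<and> spectral_state_exists D2 A2 \<and>
      spectral_state_exists D (tensor_op ten A1 A2) \<and>
      spectral_state D (tensor_op ten A1 A2) = spectral_state D1 A1 * spectral_state D2 A2)"
proof -
  have st1: "selfadjoint D1" "has_compact_inverse D1" "\<And>t. 0 < t \<Longrightarrow> trace_class (heat_op D1 t)"
    and \<gamma>: "bounded_clinear \<gamma>" "\<gamma> \<circ> \<gamma> = id" "cadjoint \<gamma> = \<gamma>" "\<And>x y. (x, y) \<in> D1 \<Longrightarrow> (\<gamma> x, - \<gamma> y) \<in> D1"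
    using assms(2) by (auto simp: even_spectral_triple_def spectral_triple_def)
  have st2: "selfadjoint D2" "has_compact_inverse D2" "\<And>t. 0 < t \<Longrightarrow> trace_class (heat_op D2 t)"
    using assms(3) by (auto simp: spectral_triple_def)
  obtain E l \<delta>1 where S1: "abs_spectrum E (\<lambda>e. e) D1 (\<lambda>e. \<bar>l e\<bar>) \<delta>1" and l: "\<And>e. e \<in> E \<Longrightarrow> (e, l e *\<^sub>R e) \<in> D1"
    using selfadjoint_eigenbasis[OF st1(1,2)] by blast
  obtain F k \<delta>2 where S2: "abs_spectrum F (\<lambda>e. e) D2 (\<lambda>e. \<bar>k e\<bar>) \<delta>2" and k: "\<And>e. e \<in> F \<Longrightarrow> (e, k e *\<^sub>R e) \<in> D2"
    using selfadjoint_eigenbasis[OF st2(1,2)] by blast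
  define \<nu>1 \<nu>2 where "\<nu>1 = (\<lambda>e. \<bar>l e\<bar>)" and "\<nu>2 = (\<lambda>e. \<bar>k e\<bar>)"
  note S1 = S1[folded \<nu>1_def] and S2 = S2[folded \<nu>2_def]
  let ?\<nu> = "\<lambda>(i, j). sqrt ((\<nu>1 i)\<^sup>2 + (\<nu>2 j)\<^sup>2)" and ?u = "\<lambda>(i, j). ten i j"
  interpret tensor_product ten by standard (rule assms(1))
  interpret S1: abs_spectrum E "\<lambda>e. e" D1 \<nu>1 \<delta>1 by (rule S1)
  interpret S2: abs_spectrum F "\<lambda>e. e" D2 \<nu>2 \<delta>2 by (rule S2)
  interpret tensor_bases ten E "\<lambda>e. e" F "\<lambda>e. e" by unfold_locales
  have S: "abs_spectrum (E \<times> F) ?u D ?\<nu> \<delta>1"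
    unfolding assms(5)
    by (rule tensor_dirac_abs_spectrum[OF S1 l _ S2 k _ st1(1) st2(1) \<gamma>]) (auto simp: \<nu>1_def \<nu>2_def)
  have h1: "heat_data E \<nu>1 \<delta>1"
    by standard (use S1.\<delta>_pos S1.\<nu>_ge S1.heat_exp_summable[OF st1(3)] in auto)
  have h2: "heat_data F \<nu>2 \<delta>2"
    by standard (use S2.\<delta>_pos S2.\<nu>_ge S2.heat_exp_summable[OF st2(3)] in auto)
  have h: "heat_data (E \<times> F) ?\<nu> \<delta>1" by (rule heat_data_product[OF h1 h2])
  interpret H1: heat_data E \<nu>1 \<delta>1 by (rule h1)
  interpret H2: heat_data F \<nu>2 \<delta>2 by (rule h2)
  interpret H: heat_data "E \<times> F" ?\<nu> \<delta>1 by (rule h)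
  interpret Y1: heat_spectrum E "\<lambda>e. e" D1 \<nu>1 \<delta>1 by (intro heat_spectrum.intro S1 h1)
  interpret Y2: heat_spectrum F "\<lambda>e. e" D2 \<nu>2 \<delta>2 by (intro heat_spectrum.intro S2 h2)
  have tr1: "op_trace (heat_op D1 (exp (- x))) = of_real (H1.heat_sum (\<lambda>i. 1) x)" for x
    using Y1.op_trace_heat_op[OF bounded_clinear_id, of x] unfolding Y1.heat_sum_id by simp
  have tr2: "op_trace (heat_op D2 (exp (- x))) = of_real (H2.heat_sum (\<lambda>i. 1) x)" for x
    using Y2.op_trace_heat_op[OF bounded_clinear_id, of x] unfolding Y2.heat_sum_id by simp
  obtain X1 where X1: "0 \<le> X1"
    "\<And>x. X1 \<le> x \<Longrightarrow> 0 \<le> f1 x \<and> 1 / 2 * f1 x * exp (- \<alpha>1 * x) \<le> H1.heat_sum (\<lambda>k. 1) x \<and>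
      H1.heat_sum (\<lambda>k. 1) x \<le> 2 * f1 x * exp (- \<alpha>1 * x)"
    using H1.heat_trace_bounds[OF tr1 assms(10)] by blast
  obtain X2 where X2: "0 \<le> X2"
    "\<And>x. X2 \<le> x \<Longrightarrow> 0 \<le> f2 x \<and> 1 / 2 * f2 x * exp (- \<alpha>2 * x) \<le> H2.heat_sum (\<lambda>k. 1) x \<and>
      H2.heat_sum (\<lambda>k. 1) x \<le> 2 * f2 x * exp (- \<alpha>2 * x)"
    using H2.heat_trace_bounds[OF tr2 assms(11)] by blast
  obtain B1 where B1: "\<And>x. 0 \<le> x \<Longrightarrow> \<bar>f1 x\<bar> \<le> B1"
    using assms(8) by (auto simp: bounded_loc_integrable_def bounded_iff)
  obtain B2 where B2: "\<And>x. 0 \<le> x \<Longrightarrow> \<bar>f2 x\<bar> \<le> B2"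
    using assms(9) by (auto simp: bounded_loc_integrable_def bounded_iff)
  obtain L1 L2 L where L1: "((\<lambda>s. s * laplace f1 s) \<longlongrightarrow> L1) (at_right 0)" "L1 \<noteq> 0"
    and L2: "((\<lambda>s. s * laplace f2 s) \<longlongrightarrow> L2) (at_right 0)" "L2 \<noteq> 0"
    and L: "((\<lambda>s. s * laplace (\<lambda>x. f1 x * f2 x) s) \<longlongrightarrow> L) (at_right 0)" "L \<noteq> 0"
    using assms(12,13,14) by blast
  have heat_one: "H.heat_sum (\<lambda>i. 1) x = H1.heat_sum (\<lambda>i. 1) x * H2.heat_sum (\<lambda>i. 1::real) x" for x
    using heat_sum_product[OF h1 h2, of "\<lambda>i. 1::real" 1 "\<lambda>j. 1" 1 x] by (simp add: case_prod_unfold)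
  obtain C1 where "zeta_asymptotics E (\<lambda>e. e) D1 \<nu>1 \<delta>1 (- \<alpha>1) C1"
    using zeta_asymptoticsI[OF S1 h1 _ B1 X1(1) _ X1(2) L1] assms(6) by auto
  then interpret Z1: zeta_asymptotics E "\<lambda>e. e" D1 \<nu>1 \<delta>1 "- \<alpha>1" C1 .
  obtain C2 where "zeta_asymptotics F (\<lambda>e. e) D2 \<nu>2 \<delta>2 (- \<alpha>2) C2"
    using zeta_asymptoticsI[OF S2 h2 _ B2 X2(1) _ X2(2) L2] assms(7) by auto
  then interpret Z2: zeta_asymptotics F "\<lambda>e. e" D2 \<nu>2 \<delta>2 "- \<alpha>2" C2 .
  \<comment> \<open>Multiplying the bounds for the two factors gives the constants 1/4 and 4 and
    adds the exponents.\<close>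
  have bounds: "0 \<le> f1 x * f2 x \<and> 1 / 4 * (f1 x * f2 x) * exp ((- \<alpha>1 + - \<alpha>2) * x) \<le> H.heat_sum (\<lambda>k. 1) x \<and>
      H.heat_sum (\<lambda>k. 1) x \<le> 4 * (f1 x * f2 x) * exp ((- \<alpha>1 + - \<alpha>2) * x)" if x: "max X1 X2 \<le> x" for x
  proof -
    have 1: "0 \<le> f1 x" "1 / 2 * f1 x * exp (- \<alpha>1 * x) \<le> H1.heat_sum (\<lambda>k. 1) x"
      "H1.heat_sum (\<lambda>k. 1) x \<le> 2 * f1 x * exp (- \<alpha>1 * x)" using X1(2)[of x] x by auto
    have 2: "0 \<le> f2 x" "1 / 2 * f2 x * exp (- \<alpha>2 * x) \<le> H2.heat_sum (\<lambda>k. 1) x"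
      "H2.heat_sum (\<lambda>k. 1) x \<le> 2 * f2 x * exp (- \<alpha>2 * x)" using X2(2)[of x] x by auto
    have e: "exp ((- \<alpha>1 + - \<alpha>2) * x) = exp (- \<alpha>1 * x) * exp (- \<alpha>2 * x)"
      by (simp add: exp_add[symmetric] algebra_simps)
    have "1 / 4 * (f1 x * f2 x) * exp ((- \<alpha>1 + - \<alpha>2) * x) =
        (1 / 2 * f1 x * exp (- \<alpha>1 * x)) * (1 / 2 * f2 x * exp (- \<alpha>2 * x))" unfolding e by simp
    also have "\<dots> \<le> H.heat_sum (\<lambda>k. 1) x"
      unfolding heat_one using 1 2 H1.heat_sum_one_nonneg H2.heat_sum_one_nonneg by (intro mult_mono) auto
    finally have lo: "1 / 4 * (f1 x * f2 x) * exp ((- \<alpha>1 + - \<alpha>2) * x) \<le> H.heat_sum (\<lambda>k. 1) x" .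
    have "H.heat_sum (\<lambda>k. 1) x \<le> (2 * f1 x * exp (- \<alpha>1 * x)) * (2 * f2 x * exp (- \<alpha>2 * x))"
      unfolding heat_one using 1 2 H1.heat_sum_one_nonneg H2.heat_sum_one_nonneg by (intro mult_mono) auto
    also have "\<dots> = 4 * (f1 x * f2 x) * exp ((- \<alpha>1 + - \<alpha>2) * x)" unfolding e by simp
    finally show ?thesis using lo 1(1) 2(1) by simp
  qed
  have f12: "\<bar>f1 x * f2 x\<bar> \<le> B1 * B2" if "0 \<le> x" for x
    using B1[OF that] B2[OF that] by (auto simp: abs_mult intro!: mult_mono order_trans[OF abs_ge_zero])
  obtain C where "zeta_asymptotics (E \<times> F) ?u D ?\<nu> \<delta>1 (- \<alpha>1 + - \<alpha>2) C"
  proof (rule zeta_asymptoticsI[OF S h _ f12 _ _ bounds L])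
    show "0 < - \<alpha>1 + - \<alpha>2" "0 \<le> max X1 X2" "(0::real) < 1 / 4"
      using X1(1) assms(6,7) by auto
  qed (assumption | rule that)+
  then interpret Z: zeta_asymptotics "E \<times> F" ?u D ?\<nu> \<delta>1 "- \<alpha>1 + - \<alpha>2" C .

  have heat_tensor: "H.heat_sum (Z.diag_coeffs (tensor_op ten A B)) x =
      H1.heat_sum (Y1.diag_coeffs A) x * H2.heat_sum (Y2.diag_coeffs B) x"
    if A: "bounded_clinear A" and B: "bounded_clinear B" for A B x
  proof -
    have "Z.diag_coeffs (tensor_op ten A B) = (\<lambda>(i, j). Y1.diag_coeffs A i * Y2.diag_coeffs B j)"
      by (auto simp: fun_eq_iff tensor_op_works[OF A B] cinner_ten)
    then show ?thesis
      using heat_sum_product[OF h1 h2 Y1.norm_diag_coeffs_le[OF A] Y2.norm_diag_coeffs_le[OF B], where x = x]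
      by simp
  qed
  define G1 G2 where "G1 x = H1.heat_sum (\<lambda>i. 1::real) x" and "G2 x = H2.heat_sum (\<lambda>i. 1::real) x" for x
  define F1 F2 where "F1 = H1.heat_sum (Y1.diag_coeffs A1)" and "F2 = H2.heat_sum (Y2.diag_coeffs A2)"
  \<comment> \<open>\<open>K2\<close> bounds the heat trace of \<open>A2\<close> by that of the
    identity, which is how an error in the first factor stays small after multiplication by
    \<open>F2\<close>.\<close>
  define K2 where "K2 = onorm A2"
  have K2: "0 \<le> K2" unfolding K2_def by (rule onorm_pos_le[OF bounded_clinearD(1)[OF assms(16)]])
  have G: "0 \<le> G1 x" "0 \<le> G2 x" for x
    by (simp_all add: G1_def G2_def H1.heat_sum_one_nonneg H2.heat_sum_one_nonneg)
  have F2: "norm (F2 x) \<le> K2 * G2 x" for x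
    unfolding F2_def G2_def K2_def by (rule H2.norm_heat_sum_le) (rule Y2.norm_diag_coeffs_le[OF assms(16)])
  \<comment> \<open>From here on the simplifier turns heat sums over the product into
    \<open>G1 x * G2 x\<close>, \<open>F1 x * F2 x\<close> and
    \<open>of_real (G1 x) * F2 x\<close>.\<close>
  note [simp] = heat_one[folded G1_def G2_def] heat_tensor[OF assms(15,16), folded F1_def F2_def]
    heat_tensor[OF bounded_clinear_id assms(16), unfolded Y1.heat_sum_id, folded G1_def F2_def]

  have part1: "\<exists>c. (spectral_ratio D1 A1 \<longlongrightarrow> c) (at_right (zeta_abscissa D1)) \<and>
      (\<forall>\<epsilon>>0. \<exists>X. \<forall>x\<ge>X. norm (F1 x - c * of_real (G1 x)) \<le> \<epsilon> * G1 x)" if reg: "strongly_regular D1 A1"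
  proof -
    obtain c where c: "\<And>\<epsilon>. 0 < \<epsilon> \<Longrightarrow> \<exists>X. \<forall>x\<ge>X. norm (H1.heat_sum (Y1.diag_coeffs A1) x
        - c * H1.heat_sum (Y1.diag_coeffs id) x) \<le> \<epsilon> * H1.heat_sum (\<lambda>i. 1) x"
      using Z1.strongly_regular_heat[OF reg assms(15)] by metis
    show ?thesis
      using Z1.spectral_state_strongly_regular[OF assms(15) c] c[unfolded Y1.heat_sum_id]
      by (auto simp: F1_def G1_def)
  qed
  have part2: "\<exists>c. (spectral_ratio D2 A2 \<longlongrightarrow> c) (at_right (zeta_abscissa D2)) \<and>
      (\<forall>\<epsilon>>0. \<exists>X. \<forall>x\<ge>X. norm (F2 x - c * of_real (G2 x)) \<le> \<epsilon> * G2 x)" if reg: "strongly_regular D2 A2"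
  proof -
    obtain c where c: "\<And>\<epsilon>. 0 < \<epsilon> \<Longrightarrow> \<exists>X. \<forall>x\<ge>X. norm (H2.heat_sum (Y2.diag_coeffs A2) x
        - c * H2.heat_sum (Y2.diag_coeffs id) x) \<le> \<epsilon> * H2.heat_sum (\<lambda>i. 1) x"
      using Z2.strongly_regular_heat[OF reg assms(16)] by metis
    show ?thesis
      using Z2.spectral_state_strongly_regular[OF assms(16) c] c[unfolded Y2.heat_sum_id]
      by (auto simp: F2_def G2_def)
  qed

  have part_i: "spectral_state_exists D1 A1 \<and>
      (spectral_state_exists D (tensor_op ten id A2) \<longrightarrow>
        spectral_state_exists D (tensor_op ten A1 A2) \<and>
        spectral_state D (tensor_op ten A1 A2) =
          spectral_state D1 A1 * spectral_state D (tensor_op ten id A2)) \<and>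
      (spectral_state_exists D (tensor_op ten A1 A2) \<and> spectral_state D1 A1 \<noteq> 0 \<longrightarrow>
        spectral_state_exists D (tensor_op ten id A2))" if reg: "strongly_regular D1 A1"
  proof -
    obtain c where c: "(spectral_ratio D1 A1 \<longlongrightarrow> c) (at_right (zeta_abscissa D1))"
      and small: "\<And>\<epsilon>. 0 < \<epsilon> \<Longrightarrow> \<exists>X. \<forall>x\<ge>X. norm (F1 x - c * of_real (G1 x)) \<le> \<epsilon> * G1 x"
      using part1[OF reg] by blast
    note T1 = spectral_stateI[OF c]
    have lim: "((\<lambda>s. spectral_ratio D (tensor_op ten A1 A2) s - c * spectral_ratio D (tensor_op ten id A2) s)
        \<longlongrightarrow> 0) (at_right (zeta_abscissa D))"
    proof (rule Z.spectral_ratio_diff_tendsto)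
      show "bounded_clinear (tensor_op ten A1 A2)" "bounded_clinear (tensor_op ten id A2)"
        by (intro tensor_op_works assms bounded_clinear_id)+
      fix \<epsilon> :: real assume "0 < \<epsilon>"
      \<comment> \<open>The denominator is \<open>K2 + 1\<close> since \<open>K2\<close> is 0 for
        \<open>A2 = 0\<close>.\<close>
      then obtain X where X: "\<And>x. X \<le> x \<Longrightarrow> norm (F1 x - c * of_real (G1 x)) \<le> \<epsilon> / (K2 + 1) * G1 x"
        using small[of "\<epsilon> / (K2 + 1)"] K2 by auto
      have "norm (F1 x * F2 x - c * (of_real (G1 x) * F2 x)) \<le> \<epsilon> * (G1 x * G2 x)" if "X \<le> x" for x
      proof -
        have "norm (F1 x * F2 x - c * (of_real (G1 x) * F2 x)) = norm (F1 x - c * of_real (G1 x)) * norm (F2 x)"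
          by (simp add: algebra_simps flip: norm_mult)
        also have "\<dots> \<le> (\<epsilon> / (K2 + 1) * G1 x) * ((K2 + 1) * G2 x)"
          using X[OF that] F2[of x] G[of x] K2 \<open>0 < \<epsilon>\<close> by (intro mult_mono) (auto simp: algebra_simps)
        also have "\<dots> = \<epsilon> * (G1 x * G2 x)" using K2 by (simp add: field_simps)
        finally show ?thesis .
      qed
      then show "\<exists>X. \<forall>x\<ge>X. norm (H.heat_sum (Z.diag_coeffs (tensor_op ten A1 A2)) x -
          c * H.heat_sum (Z.diag_coeffs (tensor_op ten id A2)) x) \<le> \<epsilon> * H.heat_sum (\<lambda>i. 1) x"
        by auto
    qed
    have "spectral_state_exists D (tensor_op ten A1 A2) \<and>
        spectral_state D (tensor_op ten A1 A2) = c * spectral_state D (tensor_op ten id A2)"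
      if "spectral_state_exists D (tensor_op ten id A2)"
    proof -
      from tendsto_add[OF lim tendsto_mult[OF tendsto_const[of c] spectral_stateE[OF that]]]
      have "(spectral_ratio D (tensor_op ten A1 A2) \<longlongrightarrow> c * spectral_state D (tensor_op ten id A2)) (at_right (zeta_abscissa D))"
        by simp
      from spectral_stateI[OF this] show ?thesis by simp
    qed
    moreover have "spectral_state_exists D (tensor_op ten id A2)"
      if ex: "spectral_state_exists D (tensor_op ten A1 A2)" and "c \<noteq> 0"
    proof -
      from tendsto_divide[OF tendsto_diff[OF spectral_stateE[OF ex] lim] tendsto_const[of c] \<open>c \<noteq> 0\<close>]
      have "(spectral_ratio D (tensor_op ten id A2) \<longlongrightarrow> spectral_state D (tensor_op ten A1 A2) / c) (at_right (zeta_abscissa D))"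
        using \<open>c \<noteq> 0\<close> by simp
      then show ?thesis by (rule spectral_stateI)
    qed
    ultimately show ?thesis using T1 by simp
  qed
  have part_ii: "spectral_state_exists D1 A1 \<and> spectral_state_exists D2 A2 \<and>
      spectral_state_exists D (tensor_op ten A1 A2) \<and>
      spectral_state D (tensor_op ten A1 A2) = spectral_state D1 A1 * spectral_state D2 A2"
    if reg: "strongly_regular D1 A1" "strongly_regular D2 A2"
  proof -
    obtain c where c: "(spectral_ratio D1 A1 \<longlongrightarrow> c) (at_right (zeta_abscissa D1))"
      and small: "\<And>\<epsilon>. 0 < \<epsilon> \<Longrightarrow> \<exists>X. \<forall>x\<ge>X. norm (F1 x - c * of_real (G1 x)) \<le> \<epsilon> * G1 x"
      using part1[OF reg(1)] by blast
    obtain c2 where c2: "(spectral_ratio D2 A2 \<longlongrightarrow> c2) (at_right (zeta_abscissa D2))"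
      and small2: "\<And>\<epsilon>. 0 < \<epsilon> \<Longrightarrow> \<exists>X. \<forall>x\<ge>X. norm (F2 x - c2 * of_real (G2 x)) \<le> \<epsilon> * G2 x"
      using part2[OF reg(2)] by blast
    have "(spectral_ratio D (tensor_op ten A1 A2) \<longlongrightarrow> c * c2) (at_right (zeta_abscissa D))"
    proof (rule Z.spectral_state_strongly_regular)
      show "bounded_clinear (tensor_op ten A1 A2)" by (intro tensor_op_works assms)
      fix \<epsilon> :: real assume \<epsilon>: "0 < \<epsilon>"
      \<comment> \<open>The error is split into \<open>F1 x - c * of_real (G1 x)\<close> times
        \<open>F2 x\<close> and \<open>c * of_real (G1 x)\<close> times
        \<open>F2 x - c2 * of_real (G2 x)\<close>. These are at most \<open>e * K2\<close> and
        \<open>e * norm c\<close> times \<open>G1 x * G2 x\<close>; the 1 avoids division by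
        0.\<close>
      define e where "e = \<epsilon> / (K2 + norm c + 1)"
      have e: "0 < e" "e * (K2 + norm c + 1) = \<epsilon>"
        using \<epsilon> K2 add_nonneg_pos[of "K2 + norm c" 1] by (auto simp: e_def)
      obtain X1 X2 where X1: "\<And>x. X1 \<le> x \<Longrightarrow> norm (F1 x - c * of_real (G1 x)) \<le> e * G1 x"
        and X2: "\<And>x. X2 \<le> x \<Longrightarrow> norm (F2 x - c2 * of_real (G2 x)) \<le> e * G2 x"
        using small[OF e(1)] small2[OF e(1)] by blast
      have "norm (F1 x * F2 x - c * c2 * of_real (G1 x * G2 x)) \<le> \<epsilon> * (G1 x * G2 x)" if x: "max X1 X2 \<le> x" for x
      proof -
        have "F1 x * F2 x - c * c2 * of_real (G1 x * G2 x) =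
            (F1 x - c * of_real (G1 x)) * F2 x + c * of_real (G1 x) * (F2 x - c2 * of_real (G2 x))"
          by (simp add: algebra_simps)
        also have "norm \<dots> \<le> norm (F1 x - c * of_real (G1 x)) * norm (F2 x) +
            norm c * G1 x * norm (F2 x - c2 * of_real (G2 x))"
          by (rule order_trans[OF norm_triangle_ineq]) (simp add: norm_mult G)
        also have "\<dots> \<le> (e * G1 x) * (K2 * G2 x) + norm c * G1 x * (e * G2 x)"
          using X1[of x] X2[of x] x F2[of x] G[of x] e(1) by (intro add_mono mult_mono) auto
        also have "\<dots> = e * (K2 + norm c) * (G1 x * G2 x)" by (simp add: algebra_simps)
        also have "\<dots> \<le> \<epsilon> * (G1 x * G2 x)"
          using G[of x] e by (intro mult_right_mono) (auto simp: algebra_simps)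
        finally show ?thesis .
      qed
      then show "\<exists>X. \<forall>x\<ge>X. norm (H.heat_sum (Z.diag_coeffs (tensor_op ten A1 A2)) x -
          c * c2 * H.heat_sum (Z.diag_coeffs id) x) \<le> \<epsilon> * H.heat_sum (\<lambda>i. 1) x"
        unfolding Z.heat_sum_id by (intro exI[of _ "max X1 X2"]) simp
    qed
    from spectral_stateI[OF this] spectral_stateI[OF c2] spectral_stateI[OF c]
    show ?thesis by simp
  qed
  show ?thesis using part_i part_ii by blast
qed

end
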